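(* Let $\alpha\in\mathbb{R}$ not be a negative integer. Then a function $u$ in $\mathbb{D}$ has the form of a Poisson integral $u=P_\alpha[f]$ in $\mathbb{D}$ for some $f\in\mathcal{D}'(\mathbb{T})$ if and only if it is $\alpha$-harmonic in $\mathbb{D}$ and of temperate growth there.
   Context: $\mathbb{D}$ is the open unit disc in $\mathbb{C}$, $\mathbb{T}=\partial\mathbb{D}$. Functions are complex-valued; $\partial_z=\frac12(\partial_x-i\partial_y)$, $\bar\partial_z=\frac12(\partial_x+i\partial_y)$. For $\alpha\in\mathbb{R}$, $u\in C^2(\mathbb{D})$ is $\alpha$-harmonic in $\mathbb{D}$ if $\partial_z\big((1-|z|^2)^{-\alpha}\bar\partial_z u(z)\big)=0$ in $\mathbb{D}$. A function $u$ has temperate growth in $\mathbb{D}$ if $|u(z)|\leq C(1-|z|^2)^{-N}$, $z\in\mathbb{D}$, for some positive constants $C,N$. The $\alpha$-harmonic Poisson kernel is $P_\alpha(z)=\dfrac{(1-|z|^2)^{\alpha+1}}{(1-z)(1-\bar z)^{\alpha+1}}$, $z\in\mathbb{D}$ (principal branch of the power). $\mathcal{D}'(\mathbb{T})$ is the space of distributions on $\mathbb{T}$, with $f\in L^1(\mathbb{T})$ identified with $\langle f,\psi\rangle=\frac1{2\pi}\int_{\mathbb{T}}f(e^{i\theta})\psi(e^{i\theta})\,d\theta$, $\psi\in C^\infty(\mathbb{T})$. Fourier coefficients: $\hat f(k)=\langle f,\phi_{-k}\rangle$, $\phi_k(e^{i\theta})=e^{ik\theta}$. The convolution $f*g$ is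 the distribution with $(f*g)\hat{\ }(k)=\hat f(k)\hat g(k)$, $k\in\mathbb{Z}$; it is a $C^\infty$ function if $g\in C^\infty(\mathbb{T})$. The Poisson integral of $f\in\mathcal{D}'(\mathbb{T})$ is $P_\alpha[f](re^{i\theta})=(P_{\alpha,r}*f)(e^{i\theta})$, where $P_{\alpha,r}(e^{i\theta})=P_\alpha(re^{i\theta})$, $0\leq r<1$. *)

theory Defs
  imports "HOL-Analysis.Analysis"
begin

definition partial_x :: "(complex \<Rightarrow> complex) \<Rightarrow> complex \<Rightarrow> complex" where
  "partial_x u z = vector_derivative (\<lambda>t. u (z + complex_of_real t)) (at 0)"

definition partial_y :: "(complex \<Rightarrow> complex) \<Rightarrow> complex \<Rightarrow> complex" where
  "partial_y u z = vector_derivative (\<lambda>t. u (z + \<i> * complex_of_real t)) (at 0)"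

definition partials_exist_on :: "complex set \<Rightarrow> (complex \<Rightarrow> complex) \<Rightarrow> bool" where
  "partials_exist_on S u \<longleftrightarrow> (\<forall>z\<in>S.
     (\<lambda>t. u (z + complex_of_real t)) differentiable (at 0) \<and>
     (\<lambda>t. u (z + \<i> * complex_of_real t)) differentiable (at 0))"

text \<open>The classes $C^k(S)$, $k = 1, 2$, of complex-valued functions in the real sense,
  for open \<open>S\<close>.\<close>

definition C1_on :: "complex set \<Rightarrow> (complex \<Rightarrow> complex) \<Rightarrow> bool" where
  "C1_on S u \<longleftrightarrow> continuous_on S u \<and> partials_exist_on S u \<and>
     continuous_on S (partial_x u) \<and> continuous_on S (partial_y u)"

definition C2_on :: "complex set \<Rightarrow> (complex \<Rightarrow> complex) \<Rightarrow> bool" where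
  "C2_on S u \<longleftrightarrow> C1_on S u \<and> C1_on S (partial_x u) \<and> C1_on S (partial_y u)"

definition d_z :: "(complex \<Rightarrow> complex) \<Rightarrow> complex \<Rightarrow> complex" where
  "d_z u z = (partial_x u z - \<i> * partial_y u z) / 2"

definition dbar_z :: "(complex \<Rightarrow> complex) \<Rightarrow> complex \<Rightarrow> complex" where
  "dbar_z u z = (partial_x u z + \<i> * partial_y u z) / 2"

definition alpha_harmonic :: "real \<Rightarrow> (complex \<Rightarrow> complex) \<Rightarrow> bool" where
  "alpha_harmonic \<alpha> u \<longleftrightarrow> C2_on (ball 0 1) u \<and>
     (\<forall>z\<in>ball 0 1.
        d_z (\<lambda>w. complex_of_real ((1 - (cmod w)\<^sup>2) powr (- \<alpha>)) * dbar_z u w) z = 0)"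

definition temperate_growth :: "(complex \<Rightarrow> complex) \<Rightarrow> bool" where
  "temperate_growth u \<longleftrightarrow> (\<exists>C>0. \<exists>N>0. \<forall>z\<in>ball 0 1.
     cmod (u z) \<le> C * (1 - (cmod z)\<^sup>2) powr (- N))"

definition poisson_kernel :: "real \<Rightarrow> complex \<Rightarrow> complex" where
  "poisson_kernel \<alpha> z =
     complex_of_real ((1 - (cmod z)\<^sup>2) powr (\<alpha> + 1)) /
     ((1 - z) * (1 - cnj z) powr complex_of_real (\<alpha> + 1))"

text \<open>A function on the unit circle is represented by a function on the complex plane of which
  only the values on the circle matter; its derivatives are taken with respect to the
  angle \<open>\<theta>\<close>.\<close>

definition circle_deriv :: "nat \<Rightarrow> (complex \<Rightarrow> complex) \<Rightarrow> real \<Rightarrow> complex" where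
  "circle_deriv k \<psi> = ((\<lambda>g t. vector_derivative g (at t)) ^^ k) (\<lambda>\<theta>. \<psi> (cis \<theta>))"

definition circle_smooth :: "(complex \<Rightarrow> complex) set" where
  "circle_smooth = {\<psi>. \<forall>k. circle_deriv k \<psi> differentiable_on UNIV}"

text \<open>Distributions on the circle: the complex linear functionals that are continuous with
  respect to the usual seminorms on the smooth functions. The estimate forces \<open>f \<psi>\<close> to depend
  only on the values of \<open>\<psi>\<close> on the circle. The value \<open>0\<close> at functions that are not smooth
  is a convention that makes equality of distributions coincide with equality in HOL.\<close>

definition circle_distributions :: "((complex \<Rightarrow> complex) \<Rightarrow> complex) set" where
  "circle_distributions = {f.
     (\<forall>\<psi>\<in>circle_smooth. \<forall>\<eta>\<in>circle_smooth. f (\<lambda>\<zeta>. \<psi> \<zeta> + \<eta> \<zeta>) = f \<psi> + f \<eta>) \<and>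
     (\<forall>c. \<forall>\<psi>\<in>circle_smooth. f (\<lambda>\<zeta>. c * \<psi> \<zeta>) = c * f \<psi>) \<and>
     (\<exists>C N. \<forall>\<psi>\<in>circle_smooth.
        cmod (f \<psi>) \<le> C * (\<Sum>k\<le>N. SUP \<theta>. cmod (circle_deriv k \<psi> \<theta>))) \<and>
     (\<forall>\<psi>. \<psi> \<notin> circle_smooth \<longrightarrow> f \<psi> = 0)}"

text \<open>The distribution identified with an integrable function on the circle.\<close>

definition distr_of_fun :: "(complex \<Rightarrow> complex) \<Rightarrow> (complex \<Rightarrow> complex) \<Rightarrow> complex" where
  "distr_of_fun g \<psi> =
     (if \<psi> \<in> circle_smooth
      then (LINT \<theta>:{0..2*pi}|lebesgue. g (cis \<theta>) * \<psi> (cis \<theta>)) / complex_of_real (2 * pi)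
      else 0)"

definition fourier_coeff :: "((complex \<Rightarrow> complex) \<Rightarrow> complex) \<Rightarrow> int \<Rightarrow> complex" where
  "fourier_coeff f k = f (\<lambda>\<zeta>. \<zeta> powi (- k))"

definition circle_convolution ::
  "((complex \<Rightarrow> complex) \<Rightarrow> complex) \<Rightarrow> ((complex \<Rightarrow> complex) \<Rightarrow> complex)
     \<Rightarrow> (complex \<Rightarrow> complex) \<Rightarrow> complex" where
  "circle_convolution f g = (THE h. h \<in> circle_distributions \<and>
     (\<forall>k. fourier_coeff h k = fourier_coeff f k * fourier_coeff g k))"

text \<open>The value at a point \<open>\<zeta>\<close> of the circle of a distribution that is a smooth function.\<close>

definition distr_value :: "((complex \<Rightarrow> complex) \<Rightarrow> complex) \<Rightarrow> complex \<Rightarrow> complex" where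
  "distr_value h \<zeta> = (THE c. \<exists>g\<in>circle_smooth. distr_of_fun g = h \<and> g \<zeta> = c)"

text \<open>A point \<open>z\<close> of the disc is written as \<open>r * cis \<theta>\<close> with \<open>r = cmod z\<close> and \<open>\<theta> = Arg z\<close>.
  For \<open>r = 0\<close> the choice of \<open>\<theta>\<close> is immaterial, the kernel being constant on the circle.\<close>

definition poisson_integral ::
  "real \<Rightarrow> ((complex \<Rightarrow> complex) \<Rightarrow> complex) \<Rightarrow> complex \<Rightarrow> complex" where
  "poisson_integral \<alpha> f z =
     distr_value
       (circle_convolution
          (distr_of_fun (\<lambda>\<zeta>. poisson_kernel \<alpha> (complex_of_real (cmod z) * \<zeta>))) f)
       (cis (Arg z))"

end

theory Submission
  imports Defs "HOL-Complex_Analysis.Cauchy_Integral_Formula"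
begin

text \<open>
  With \<open>s = |z|\<^sup>2\<close> and \<open>\<beta>\<^sub>l\<close> the Taylor coefficients of \<open>(1 - w) powr (- (\<alpha> + 1))\<close>, the Poisson integral of a
  distribution with Fourier coefficients \<open>c\<^sub>k\<close> is \<open>(1 - s) powr (\<alpha> + 1)\<close> times the double series
  \<open>\<Sum>\<^sub>j\<^sub>,\<^sub>l \<beta>\<^sub>l c\<^sub>j\<^sub>-\<^sub>l z^j cnj z^l\<close>. When \<open>dbar_z\<close> is applied to this expression, the recursion
  \<open>(l + 1) \<beta>\<^sub>l\<^sub>+\<^sub>1 = (l + \<alpha> + 1) \<beta>\<^sub>l\<close> cancels all terms except those with \<open>j = 0\<close>, leaving
  \<open>(1 - s) powr \<alpha>\<close> times a power series in \<open>cnj z\<close>; hence Poisson integrals are \<open>\<alpha>\<close>-harmonic.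

  Conversely, if \<open>u\<close> is \<open>\<alpha>\<close>-harmonic then \<open>(1 - s) powr (- \<alpha>) * dbar_z u\<close> is antiholomorphic, and its
  Taylor coefficients determine \<open>c\<^sub>k\<close> for \<open>k < 0\<close>, because \<open>\<beta>\<^sub>l \<noteq> 0\<close>. Subtracting the corresponding double
  series leaves a holomorphic function, whose Taylor coefficients are the \<open>c\<^sub>k\<close> with \<open>k \<ge> 0\<close>. The
  Fourier coefficients of \<open>u\<close> on the circle of radius \<open>r = n / (n + 1)\<close>, \<open>n = |k|\<close>, show that temperate growth forces
  \<open>c\<^sub>k\<close> to grow at most polynomially, so that they are the Fourier coefficients of a distribution.
\<close>

section \<open>Wirtinger derivatives\<close>

text \<open>Both \<open>circle_convolution\<close> and \<open>distr_value\<close> are definite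
  descriptions, so a Poisson integral can be replaced by its series only after two uniqueness
  results: Fourier coefficients determine a distribution (trigonometric polynomials are dense for
  all seminorms), and a smooth function is determined on the circle by its distribution. If \<alpha>
  is a negative integer, the coefficients \<beta>_l vanish for l \<ge> -\<alpha>, and the
  corresponding c_k cannot be read off from the dbar derivative. An \<alpha>-harmonic function alone
  yields only subexponential c_k, which is why convergence is handled by \<open>subexp\<close> and
  \<open>subexp_int\<close>; growth enters last. On the circle of radius r the Fourier coefficients
  of u are c_k times those of the kernel, which must therefore be bounded below. They equal r^k for
  k \<ge> 0. For k < 0 they are hypergeometric sums, bounded below by their first term once \<alpha>
  + 1 + |k| > 0. The radius n / (n + 1) keeps r^n \<ge> 1/e and 1 - r^2 \<ge> 1 / (n + 1), so that
  division costs only powers of n.\<close>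

lemma has_derivative_infsum:
  fixes f :: "'i \<Rightarrow> 'a::real_normed_vector \<Rightarrow> 'b::banach"
  assumes I: "countable (UNIV::'i set)" "infinite (UNIV::'i set)"
    and S: "convex S" "x \<in> S"
    and d: "\<And>i y. y \<in> S \<Longrightarrow> (f i has_derivative f' i y) (at y within S)"
    and b: "\<And>i y h. y \<in> S \<Longrightarrow> norm (f' i y h) \<le> M i * norm h"
    and M: "M summable_on UNIV"
    and s: "\<And>y. y \<in> S \<Longrightarrow> (\<lambda>i. f i y) summable_on UNIV"
  shows "((\<lambda>y. \<Sum>\<^sub>\<infinity>i. f i y) has_derivative (\<lambda>h. \<Sum>\<^sub>\<infinity>i. f' i x h)) (at x within S)"
proof -
  \<comment> \<open>An enumeration of the index set turns the unordered sums into ordinary series,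
    to which \<open>has_derivative_series\<close> applies.\<close>
  obtain e :: "nat \<Rightarrow> 'i" where e: "bij e"
    using bij_betw_from_nat_into[OF I] by blast
  have sums: "(\<lambda>n. F (e n)) sums (\<Sum>\<^sub>\<infinity>i. F i)" if "F summable_on UNIV" for F :: "'i \<Rightarrow> 'c::banach"
  proof -
    have "((\<lambda>n. F (e n)) has_sum (\<Sum>\<^sub>\<infinity>i. F i)) UNIV"
      using has_sum_reindex_bij_betw[OF e, of F] has_sum_infsum[OF that] by blast
    then show ?thesis by (rule has_sum_imp_sums)
  qed
  have Ms: "summable (\<lambda>n. M (e n))"
    using sums[OF M] by (rule sums_summable)
  have fs: "(\<lambda>i. f' i y h) summable_on UNIV" if "y \<in> S" for y h
    by (rule abs_summable_summable, rule Infinite_Sum.abs_summable_on_comparison_test'[where g = "\<lambda>i. M i * norm h"])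
       (use b that summable_on_cmult_left[OF M] in auto)
  have "\<exists>g. \<forall>y\<in>S. (\<lambda>n. f (e n) y) sums g y \<and>
      (g has_derivative (\<lambda>h. \<Sum>\<^sub>\<infinity>i. f' i y h)) (at y within S)"
  proof (rule has_derivative_series[where f' = "\<lambda>n. f' (e n)" and x = x])
    \<comment> \<open>The tails of the majorant \<open>M\<close> give uniform convergence of the
      derivative series, relative to \<open>norm h\<close>.\<close>
    fix \<epsilon> :: real assume "\<epsilon> > 0"
    then obtain N where N: "\<And>n. n \<ge> N \<Longrightarrow> norm (\<Sum>i. M (e (i + n))) < \<epsilon>"
      using suminf_exist_split[OF _ Ms] by blast
    have "norm ((\<Sum>i<n. f' (e i) y h) - (\<Sum>\<^sub>\<infinity>i. f' i y h)) \<le> \<epsilon> * norm h"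
      if n: "n \<ge> N" and y: "y \<in> S" for n y h
    proof -
      have su: "(\<lambda>n. f' (e n) y h) sums (\<Sum>\<^sub>\<infinity>i. f' i y h)" using sums[OF fs[OF y]] .
      have "(\<Sum>\<^sub>\<infinity>i. f' i y h) - (\<Sum>i<n. f' (e i) y h) = (\<Sum>i. f' (e (i + n)) y h)"
        using su suminf_split_initial_segment[of "\<lambda>n. f' (e n) y h" n] by (simp add: sums_iff)
      moreover have "norm (\<Sum>i. f' (e (i + n)) y h) \<le> (\<Sum>i. M (e (i + n)) * norm h)"
        using summable_ignore_initial_segment[OF Ms, of n] b[OF y]
        by (intro norm_suminf_le summable_mult2) auto
      moreover have "\<dots> = (\<Sum>i. M (e (i + n))) * norm h"
        using summable_ignore_initial_segment[OF Ms, of n] by (rule suminf_mult2[symmetric])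
      moreover have "\<dots> \<le> \<epsilon> * norm h"
        using N[OF n] by (intro mult_right_mono) auto
      ultimately show ?thesis by (simp add: norm_minus_commute)
    qed
    then show "\<forall>\<^sub>F n in sequentially. \<forall>y\<in>S. \<forall>h.
        norm ((\<Sum>i<n. f' (e i) y h) - (\<Sum>\<^sub>\<infinity>i. f' i y h)) \<le> \<epsilon> * norm h"
      unfolding eventually_sequentially by blast
  qed (use S d sums[OF s[OF S(2)]] in auto)
  then obtain g where g: "\<And>y. y \<in> S \<Longrightarrow> (\<lambda>n. f (e n) y) sums g y"
      "\<And>y. y \<in> S \<Longrightarrow> (g has_derivative (\<lambda>h. \<Sum>\<^sub>\<infinity>i. f' i y h)) (at y within S)" by blast
  have "g y = (\<Sum>\<^sub>\<infinity>i. f i y)" if "y \<in> S" for y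
    using g(1)[OF that] sums[OF s[OF that]] sums_unique2 by blast
  then show ?thesis
    using g(2)[OF S(2)] S(2) has_derivative_transform by metis
qed

lemma has_derivative_partials:
  assumes u: "(u has_derivative L) (at z)"
  shows "partial_x u z = L 1" "partial_y u z = L \<i>"
    "(\<lambda>t. u (z + complex_of_real t)) differentiable (at 0)"
    "(\<lambda>t. u (z + \<i> * complex_of_real t)) differentiable (at 0)"
proof -
  have L: "bounded_linear L" using u by (rule has_derivative_bounded_linear)
  have *: "((\<lambda>t. u (z + a * complex_of_real t)) has_vector_derivative L a) (at 0)" for a
  proof -
    have "((\<lambda>t. z + a * complex_of_real t) has_derivative (\<lambda>t. a * complex_of_real t)) (at 0)"
      by (auto intro!: derivative_eq_intros)
    from has_derivative_compose[OF this, of u L] u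
    have "((\<lambda>t. u (z + a * complex_of_real t)) has_derivative (\<lambda>t. L (a * complex_of_real t))) (at 0)"
      by simp
    moreover have "L (a * complex_of_real t) = t *\<^sub>R L a" for t
      using linear_scale[OF bounded_linear.linear[OF L], of t a]
      by (simp add: scaleR_conv_of_real mult.commute)
    ultimately show ?thesis by (simp add: has_vector_derivative_def)
  qed
  show "partial_x u z = L 1" "partial_y u z = L \<i>"
    unfolding partial_x_def partial_y_def
    using vector_derivative_at[OF *[of 1]] vector_derivative_at[OF *[of \<i>]] by simp_all
  show "(\<lambda>t. u (z + complex_of_real t)) differentiable (at 0)"
    "(\<lambda>t. u (z + \<i> * complex_of_real t)) differentiable (at 0)"
    using differentiableI_vector[OF *[of 1]] differentiableI_vector[OF *[of \<i>]] by simp_all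
qed

text \<open>Total real differentiability is part of the predicate; \<open>d_z\<close> and
  \<open>dbar_z\<close> are built from partial derivatives along the axes, which by themselves obey
  no product or chain rule.\<close>

definition has_wirtinger :: "(complex \<Rightarrow> complex) \<Rightarrow> complex \<Rightarrow> complex \<Rightarrow> complex \<Rightarrow> bool" where
  "has_wirtinger u p q z \<longleftrightarrow> (u has_derivative (\<lambda>h. p * h + q * cnj h)) (at z)"

lemma has_wirtinger_imp:
  assumes "has_wirtinger u p q z"
  shows "partial_x u z = p + q" "partial_y u z = \<i> * (p - q)" "d_z u z = p" "dbar_z u z = q"
proof -
  show 1: "partial_x u z = p + q" "partial_y u z = \<i> * (p - q)"
    using has_derivative_partials(1,2)[OF assms[unfolded has_wirtinger_def]] by (simp_all add: algebra_simps)
  have "\<i> * (\<i> * x) = - x" for x by (simp add: mult.assoc[symmetric])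
  then show "d_z u z = p" "dbar_z u z = q" by (simp_all only: d_z_def dbar_z_def 1) simp_all
qed

text \<open>A real linear map of the plane is determined by its values at 1 and \<i>, and these can
  be matched by a unique combination of h and \<open>cnj h\<close>.\<close>

lemma differentiable_imp_has_wirtinger:
  assumes "u differentiable (at z)"
  shows "has_wirtinger u (d_z u z) (dbar_z u z) z"
proof -
  obtain L where L: "(u has_derivative L) (at z)" using assms unfolding differentiable_def by blast
  have lin: "linear L" using L has_derivative_bounded_linear bounded_linear.linear by blast
  have "L h = d_z u z * h + dbar_z u z * cnj h" for h
  proof -
    have "h = Re h *\<^sub>R 1 + Im h *\<^sub>R \<i>" by (simp add: complex_eq_iff)
    then have "L h = Re h *\<^sub>R L 1 + Im h *\<^sub>R L \<i>"
      using linear_add[OF lin] linear_scale[OF lin] by metis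
    moreover have "d_z u z * h + dbar_z u z * cnj h =
        (d_z u z + dbar_z u z) * of_real (Re h) + (d_z u z - dbar_z u z) * \<i> * of_real (Im h)"
      by (subst (1 2) complex_eq[of h]) (simp add: algebra_simps)
    moreover have "d_z u z + dbar_z u z = L 1" "d_z u z - dbar_z u z = - \<i> * L \<i>"
      unfolding d_z_def dbar_z_def has_derivative_partials[OF L] by (simp_all add: field_simps)
    ultimately show ?thesis by (simp add: scaleR_conv_of_real algebra_simps)
  qed
  then have "L = (\<lambda>h. d_z u z * h + dbar_z u z * cnj h)" by auto
  with L show ?thesis unfolding has_wirtinger_def by simp
qed

lemma has_wirtinger_mult:
  assumes "has_wirtinger u p q z" "has_wirtinger v p' q' z"
  shows "has_wirtinger (\<lambda>w. u w * v w) (u z * p' + p * v z) (u z * q' + q * v z) z"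
  unfolding has_wirtinger_def
  by (rule has_derivative_eq_rhs[OF has_derivative_mult[OF assms[unfolded has_wirtinger_def]]])
     (simp add: fun_eq_iff algebra_simps)

lemma has_wirtinger_diff:
  assumes "has_wirtinger u p q z" "has_wirtinger v p' q' z"
  shows "has_wirtinger (\<lambda>w. u w - v w) (p - p') (q - q') z"
  unfolding has_wirtinger_def
  by (rule has_derivative_eq_rhs[OF has_derivative_diff[OF assms[unfolded has_wirtinger_def]]])
     (simp add: fun_eq_iff left_diff_distrib)

lemma has_wirtinger_cong:
  assumes "has_wirtinger u p q z" "open S" "z \<in> S" "\<And>w. w \<in> S \<Longrightarrow> u w = v w"
  shows "has_wirtinger v p q z"
  using has_derivative_transform_within_open[OF assms(1)[unfolded has_wirtinger_def] assms(2-4)]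
  unfolding has_wirtinger_def by simp

lemma has_wirtinger_one_minus_norm_powr:
  assumes "cmod z < 1"
  shows "has_wirtinger (\<lambda>w. complex_of_real ((1 - (cmod w)\<^sup>2) powr b))
     (- (of_real (b * (1 - (cmod z)\<^sup>2) powr (b - 1)) * cnj z))
     (- (of_real (b * (1 - (cmod z)\<^sup>2) powr (b - 1)) * z)) z"
proof -
  have pos: "1 - (cmod z)\<^sup>2 > 0" using assms by (simp add: power_less_one_iff abs_square_less_1)
  have n: "(cmod w)\<^sup>2 = w \<bullet> w" for w by (simp add: power2_norm_eq_inner)
  have 1: "((\<lambda>w. 1 - (cmod w)\<^sup>2) has_derivative (\<lambda>h. - (2 * (z \<bullet> h)))) (at z)"
    unfolding n by (auto intro!: derivative_eq_intros simp: inner_commute)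
  have 2: "((\<lambda>s. s powr b) has_derivative (\<lambda>t. t * (b * (1 - (cmod z)\<^sup>2) powr (b - 1)))) (at (1 - (cmod z)\<^sup>2))"
    using has_real_derivative_powr[OF pos, of b] by (simp add: has_field_derivative_def mult.commute[of _ "b * (1 - (cmod z)\<^sup>2) powr (b - 1)"] del: mult.assoc)
  have "((\<lambda>w. complex_of_real ((1 - (cmod w)\<^sup>2) powr b)) has_derivative
     (\<lambda>h. of_real (- (2 * (z \<bullet> h)) * (b * (1 - (cmod z)\<^sup>2) powr (b - 1))))) (at z)"
    by (rule has_derivative_of_real[OF has_derivative_compose[OF 1 2]])
  moreover have "complex_of_real (- (2 * (z \<bullet> h)) * (b * (1 - (cmod z)\<^sup>2) powr (b - 1))) =
     (- (of_real (b * (1 - (cmod z)\<^sup>2) powr (b - 1)) * cnj z)) * h +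
     (- (of_real (b * (1 - (cmod z)\<^sup>2) powr (b - 1)) * z)) * cnj h" for h
    by (simp add: complex_eq_iff inner_complex_def algebra_simps)
  ultimately show ?thesis unfolding has_wirtinger_def by simp
qed

text \<open>Continuous partial derivatives give total differentiability. This links
  \<open>C2_on\<close>, which speaks of partial derivatives only, with the Wirtinger calculus; the
  two-variable criterion is applied on a closed rectangle around z after identifying the plane with
  pairs of reals.\<close>

lemma C1_on_imp_differentiable:
  assumes u: "C1_on S u" and S: "open S" "z \<in> S"
  shows "u differentiable (at z)"
proof -
  obtain e where e: "e > 0" "cball z e \<subseteq> S"
    using S open_contains_cball by blast
  \<comment> \<open>Half-width e/2 in each direction keeps the sum of the coordinate distances,
    hence the distance to z, at most e.\<close>
  define X where "X = {Re z - e/2..Re z + e/2}"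
  define Y where "Y = {Im z - e/2..Im z + e/2}"
  have sub: "Complex x y \<in> S" if "x \<in> X" "y \<in> Y" for x y
  proof -
    have "dist z (Complex x y) \<le> \<bar>Re (z - Complex x y)\<bar> + \<bar>Im (z - Complex x y)\<bar>"
      unfolding dist_norm by (rule cmod_le)
    also have "\<dots> \<le> e" using that by (auto simp: X_def Y_def abs_if)
    finally show ?thesis using e by auto
  qed
  define g where "g x y = u (Complex x y)" for x y
  have shift: "((\<lambda>s. F (s - x)) has_vector_derivative D) (at x)"
    if "(F has_vector_derivative D) (at 0)" for F :: "real \<Rightarrow> complex" and D x
  proof -
    have "((\<lambda>s. s - x) has_derivative (\<lambda>h. h)) (at x)" by (auto intro!: derivative_eq_intros)
    from has_derivative_compose[OF this, of F "\<lambda>h. h *\<^sub>R D"] that show ?thesis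
      by (simp add: has_vector_derivative_def)
  qed
  have dx: "((\<lambda>x. g x y) has_vector_derivative partial_x u (Complex x y)) (at x)"
    if "x \<in> X" "y \<in> Y" for x y
  proof -
    have "((\<lambda>t. u (Complex x y + complex_of_real t)) has_vector_derivative partial_x u (Complex x y)) (at 0)"
      using u sub[OF that] unfolding C1_on_def partials_exist_on_def partial_x_def
      by (metis vector_derivative_works)
    moreover have "Complex x y + complex_of_real (t - x) = Complex t y" for t
      by (simp add: complex_eq_iff)
    ultimately show ?thesis
      using shift[of "\<lambda>t. u (Complex x y + complex_of_real t)" _ x] by (simp add: g_def)
  qed
  have dy: "((\<lambda>y. g x y) has_vector_derivative partial_y u (Complex x y)) (at y)"
    if "x \<in> X" "y \<in> Y" for x y
  proof -
    have "((\<lambda>t. u (Complex x y + \<i> * complex_of_real t)) has_vector_derivative partial_y u (Complex x y)) (at 0)"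
      using u sub[OF that] unfolding C1_on_def partials_exist_on_def partial_y_def
      by (metis vector_derivative_works)
    moreover have "Complex x y + \<i> * complex_of_real (t - y) = Complex x t" for t
      by (simp add: complex_eq_iff)
    ultimately show ?thesis
      using shift[of "\<lambda>t. u (Complex x y + \<i> * complex_of_real t)" _ y] by (simp add: g_def)
  qed
  have zXY: "Re z \<in> interior X" "Im z \<in> interior Y" using e by (auto simp: X_def Y_def)
  then have zXY': "Re z \<in> X" "Im z \<in> Y" using interior_subset by blast+
  have "((\<lambda>(x, y). g x y) has_derivative
      (\<lambda>(tx, ty). tx *\<^sub>R partial_x u (Complex (Re z) (Im z)) +
        blinfun_apply (blinfun_scaleR_left (partial_y u (Complex (Re z) (Im z)))) ty))
      (at (Re z, Im z) within X \<times> Y)"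
  proof (rule has_derivative_partialsI)
    show "((\<lambda>x. g x (Im z)) has_derivative (\<lambda>tx. tx *\<^sub>R partial_x u (Complex (Re z) (Im z)))) (at (Re z) within X)"
      using dx[OF zXY'] has_derivative_at_withinI unfolding has_vector_derivative_def by blast
    show "((\<lambda>y. g x y) has_derivative blinfun_apply (blinfun_scaleR_left (partial_y u (Complex x y)))) (at y within Y)"
      if "x \<in> X" "y \<in> Y" for x y
      using dy[OF that] has_derivative_at_withinI unfolding has_vector_derivative_def by auto
    have "continuous_on S (partial_y u)" using u by (simp add: C1_on_def)
    moreover have "continuous_on (X \<times> Y) (\<lambda>p. Complex (fst p) (snd p))"
      unfolding Complex_eq by (intro continuous_intros)
    ultimately have "continuous_on (X \<times> Y) (\<lambda>p. partial_y u (Complex (fst p) (snd p)))"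
      by (rule continuous_on_compose2) (use sub in auto)
    then have "continuous_on (X \<times> Y) (\<lambda>p. blinfun_scaleR_left (partial_y u (Complex (fst p) (snd p))) :: real \<Rightarrow>\<^sub>L complex)"
      by (intro bounded_linear.continuous_on[OF bounded_linear_blinfun_scaleR_left])
    then show "continuous (at (Re z, Im z) within X \<times> Y)
        (\<lambda>(x, y). blinfun_scaleR_left (partial_y u (Complex x y)) :: real \<Rightarrow>\<^sub>L complex)"
      using zXY' by (simp add: continuous_on_eq_continuous_within case_prod_beta')
  qed (use zXY' in \<open>auto simp: Y_def\<close>)
  moreover have "at (Re z, Im z) within X \<times> Y = at (Re z, Im z)"
    using zXY by (intro at_within_interior) (simp add: interior_Times)
  ultimately obtain L where L: "((\<lambda>(x, y). g x y) has_derivative L) (at (Re z, Im z))" by auto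
  have "((\<lambda>w. (Re w, Im w)) has_derivative (\<lambda>w. (Re w, Im w))) (at z)"
    by (auto intro!: derivative_eq_intros)
  from has_derivative_compose[OF this, of "\<lambda>(x, y). g x y" L] L
  have "(u has_derivative (\<lambda>w. L (Re w, Im w))) (at z)" by (simp add: g_def)
  then show ?thesis unfolding differentiable_def by blast
qed

lemma dbar_zero_imp_holomorphic:
  assumes "open S" "\<And>z. z \<in> S \<Longrightarrow> \<exists>p. has_wirtinger u p 0 z"
  shows "u holomorphic_on S"
  using assms unfolding has_wirtinger_def holomorphic_on_open[OF assms(1)] has_field_derivative_def
  by simp

text \<open>Composition with conjugation exchanges the two Wirtinger coefficients, so an
  antiholomorphic function becomes a holomorphic one and the Taylor theorem is available.\<close>

lemma d_zero_imp_holomorphic: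
  assumes "open S" "\<And>z. z \<in> S \<Longrightarrow> \<exists>q. has_wirtinger u 0 q z"
  shows "(\<lambda>w. u (cnj w)) holomorphic_on (cnj -` S)"
proof -
  have o: "open (cnj -` S)"
    using assms(1) by (intro open_vimage continuous_intros)
  show ?thesis
  proof (rule dbar_zero_imp_holomorphic[OF o])
    fix w assume "w \<in> cnj -` S"
    then obtain q where q: "has_wirtinger u 0 q (cnj w)" using assms(2) by auto
    have "(cnj has_derivative cnj) (at w)"
      using bounded_linear_cnj bounded_linear_imp_has_derivative by blast
    from has_derivative_compose[OF this, of u "\<lambda>h. q * cnj h"] q
    have "has_wirtinger (\<lambda>w. u (cnj w)) q 0 w"
      unfolding has_wirtinger_def by simp
    then show "\<exists>p. has_wirtinger (\<lambda>w. u (cnj w)) p 0 w" ..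
  qed
qed

section \<open>Double power series in the variable and its conjugate\<close>

lemma power_le_fact_exp:
  fixes x :: real assumes "x \<ge> 0" shows "x ^ n \<le> fact n * exp x"
proof -
  have "(\<Sum>k\<in>{n}. x ^ k /\<^sub>R fact k) \<le> (\<Sum>k. x ^ k /\<^sub>R fact k)"
    using assms by (intro sum_le_suminf summable_exp_generic) auto
  then have "x ^ n / fact n \<le> exp x" by (simp add: exp_def divide_inverse mult.commute)
  then show ?thesis by (simp add: field_simps)
qed

text \<open>Exchanges polynomial growth in n for a power of 1 / (1 - r). For x = (1 + n)(1 - r) one
  has x^N \<le> N! e^x, while r^n \<le> e^(-(1 - r) n); the exponents add up to 1 - r, which is at
  most 1. Temperate growth of Poisson integrals comes from this estimate.\<close>

lemma poly_geom_bound: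
  fixes r :: real assumes r: "0 \<le> r" "r < 1"
  shows "(1 + real n) ^ N * r ^ n \<le> fact N * exp 1 / (1 - r) ^ N"
proof -
  have "r \<le> exp (- (1 - r))" using exp_ge_add_one_self[of "- (1 - r)"] by simp
  then have "r ^ n \<le> exp (- (1 - r)) ^ n" using r by (intro power_mono)
  then have rn: "r ^ n \<le> exp (- (1 - r) * real n)" by (metis exp_of_nat2_mult)
  have "((1 + real n) * (1 - r)) ^ N * r ^ n \<le>
      (fact N * exp ((1 + real n) * (1 - r))) * exp (- (1 - r) * real n)"
    using r by (intro mult_mono power_le_fact_exp rn) auto
  also have "\<dots> = fact N * exp ((1 + real n) * (1 - r) + (- (1 - r) * real n))"
    by (simp only: exp_add mult.assoc)
  also have "(1 + real n) * (1 - r) + (- (1 - r) * real n) = 1 - r" by (simp add: algebra_simps)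
  also have "fact N * exp (1 - r) \<le> fact N * exp 1" using r by simp
  finally have "(1 - r) ^ N * ((1 + real n) ^ N * r ^ n) \<le> fact N * exp 1"
    by (simp add: power_mult_distrib mult_ac)
  then show ?thesis using r by (simp add: pos_le_divide_eq mult.commute)
qed

lemma summable_on_product_real:
  fixes f :: "'a \<Rightarrow> real" and g :: "'b \<Rightarrow> real"
  assumes "f summable_on UNIV" "g summable_on UNIV" "\<And>x. f x \<ge> 0" "\<And>y. g y \<ge> 0"
  shows "(\<lambda>p. f (fst p) * g (snd p)) summable_on UNIV"
proof -
  have "(\<lambda>p. f (fst p) * g (snd p)) summable_on (UNIV \<times> UNIV)"
  proof (rule summable_on_SigmaI)
    show "((\<lambda>y. f (fst (x, y)) * g (snd (x, y))) has_sum f x * infsum g UNIV) UNIV" for x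
      using assms(2) by (simp add: has_sum_cmult_right)
    show "(\<lambda>x. f x * infsum g UNIV) summable_on UNIV"
      using assms(1) by (rule summable_on_cmult_left)
  qed (use assms in auto)
  then show ?thesis by simp
qed

lemma has_sum_product:
  fixes f :: "'a \<Rightarrow> 'c::{banach, real_normed_field}" and g :: "'b \<Rightarrow> 'c"
  assumes "(\<lambda>x. norm (f x)) summable_on UNIV" "(\<lambda>y. norm (g y)) summable_on UNIV"
  shows "((\<lambda>p. f (fst p) * g (snd p)) has_sum infsum f UNIV * infsum g UNIV) UNIV"
proof -
  have f: "f summable_on UNIV" and g: "g summable_on UNIV"
    using assms abs_summable_summable by blast+
  have "((\<lambda>p. f (fst p) * g (snd p)) has_sum infsum f UNIV * infsum g UNIV) (UNIV \<times> UNIV)"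
  proof (rule has_sum_SigmaI)
    show "((\<lambda>y. f (fst (x, y)) * g (snd (x, y))) has_sum f x * infsum g UNIV) UNIV" for x
      using g by (simp add: has_sum_cmult_right)
    show "((\<lambda>x. f x * infsum g UNIV) has_sum infsum f UNIV * infsum g UNIV) UNIV"
      using f by (simp add: has_sum_cmult_left)
    have "(\<lambda>p. norm (f (fst p)) * norm (g (snd p))) summable_on UNIV"
      by (rule summable_on_product_real[OF assms]) simp_all
    then show "(\<lambda>p. f (fst p) * g (snd p)) summable_on UNIV \<times> UNIV"
      using abs_summable_summable[of "\<lambda>p. f (fst p) * g (snd p)"] by (simp add: norm_mult)
  qed
  then show ?thesis by simp
qed

lemma geometric_summable_on:
  fixes r :: real assumes "0 \<le> r" "r < 1"
  shows "(\<lambda>n. r ^ n) summable_on UNIV"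
  using assms by (intro norm_summable_imp_summable_on) (simp add: summable_geometric)

text \<open>Convergence of the double power series on the whole disc, expressed by bounds on the coefficients.\<close>

definition subexp :: "(nat \<times> nat \<Rightarrow> complex) \<Rightarrow> bool" where
  "subexp a \<longleftrightarrow> (\<forall>\<rho>. 0 < \<rho> \<and> \<rho> < 1 \<longrightarrow> (\<exists>C. \<forall>p. cmod (a p) * \<rho> ^ (fst p + snd p) \<le> C))"

definition double_series :: "(nat \<times> nat \<Rightarrow> complex) \<Rightarrow> complex \<Rightarrow> complex" where
  "double_series a z = (\<Sum>\<^sub>\<infinity>p. a p * z ^ fst p * cnj z ^ snd p)"

lemma subexpD:
  assumes "subexp a" "0 < \<rho>" "\<rho> < 1"
  obtains C where "C \<ge> 0" "\<And>p. cmod (a p) * \<rho> ^ (fst p + snd p) \<le> C"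
proof -
  obtain C where C: "\<And>p. cmod (a p) * \<rho> ^ (fst p + snd p) \<le> C"
    using assms unfolding subexp_def by blast
  have "C \<ge> 0" using C[of undefined] assms by (meson order_trans norm_ge_zero zero_le_power mult_nonneg_nonneg less_imp_le)
  with C that show thesis by blast
qed

lemma subexp_summable:
  assumes a: "subexp a" and r: "0 \<le> r" "r < 1"
  shows "(\<lambda>p. cmod (a p) * r ^ (fst p + snd p)) summable_on UNIV"
proof -
  \<comment> \<open>A radius strictly between r and 1: boundedness at \<rho> leaves the geometric
    ratio r / \<rho> < 1 for summation.\<close>
  define \<rho> where "\<rho> = (1 + r) / 2"
  have \<rho>: "0 < \<rho>" "\<rho> < 1" "r < \<rho>" using r by (auto simp: \<rho>_def)
  obtain C where C: "C \<ge> 0" "\<And>p. cmod (a p) * \<rho> ^ (fst p + snd p) \<le> C"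
    using subexpD[OF a \<rho>(1,2)] by blast
  define q where "q = r / \<rho>"
  have q: "0 \<le> q" "q < 1" using r \<rho> by (auto simp: q_def)
  have "(\<lambda>p::nat\<times>nat. C * (q ^ fst p * q ^ snd p)) summable_on UNIV"
    using q by (intro summable_on_cmult_right summable_on_product_real[OF geometric_summable_on geometric_summable_on]) auto
  then show ?thesis
  proof (rule summable_on_comparison_test)
    fix p
    have "r = \<rho> * q" using \<rho> by (simp add: q_def)
    then have "cmod (a p) * r ^ (fst p + snd p) = (cmod (a p) * \<rho> ^ (fst p + snd p)) * (q ^ fst p * q ^ snd p)"
      by (simp add: power_mult_distrib power_add)
    also have "\<dots> \<le> C * (q ^ fst p * q ^ snd p)" using q by (intro mult_right_mono C) auto
    finally show "cmod (a p) * r ^ (fst p + snd p) \<le> C * (q ^ fst p * q ^ snd p)" .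
  qed (use r in auto)
qed

lemma norm_double_series_term: "cmod (a p * z ^ fst p * cnj z ^ snd p) = cmod (a p) * cmod z ^ (fst p + snd p)"
  by (simp add: norm_mult norm_power power_add)

lemma double_series_abs_summable:
  assumes "subexp a" "cmod z < 1"
  shows "(\<lambda>p. cmod (a p * z ^ fst p * cnj z ^ snd p)) summable_on UNIV"
  using subexp_summable[OF assms(1) norm_ge_zero assms(2)] by (simp add: norm_double_series_term)

lemma double_series_summable:
  assumes "subexp a" "cmod z < 1"
  shows "(\<lambda>p. a p * z ^ fst p * cnj z ^ snd p) summable_on UNIV"
  using double_series_abs_summable[OF assms] by (rule abs_summable_summable)

lemma double_series_add:
  assumes "subexp a" "subexp b" "cmod z < 1"
  shows "double_series (\<lambda>p. a p + b p) z = double_series a z + double_series b z"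
  unfolding double_series_def
  by (subst infsum_add[symmetric]) (use assms double_series_summable in \<open>auto simp: algebra_simps\<close>)

lemma double_series_cmult: "double_series (\<lambda>p. c * a p) z = c * double_series a z"
  unfolding double_series_def by (subst infsum_cmult_right'[symmetric]) (simp add: mult.assoc)

lemma subexp_add:
  assumes "subexp a" "subexp b" shows "subexp (\<lambda>p. a p + b p)"
  unfolding subexp_def
proof (intro allI impI)
  fix \<rho> :: real assume \<rho>: "0 < \<rho> \<and> \<rho> < 1"
  obtain C where C: "\<And>p. cmod (a p) * \<rho> ^ (fst p + snd p) \<le> C" using subexpD[OF assms(1)] \<rho> by blast
  obtain D where D: "\<And>p. cmod (b p) * \<rho> ^ (fst p + snd p) \<le> D" using subexpD[OF assms(2)] \<rho> by blast
  have "cmod (a p + b p) * \<rho> ^ (fst p + snd p) \<le> C + D" for p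
  proof -
    have "cmod (a p + b p) * \<rho> ^ (fst p + snd p) \<le> (cmod (a p) + cmod (b p)) * \<rho> ^ (fst p + snd p)"
      using \<rho> by (intro mult_right_mono norm_triangle_ineq) auto
    then show ?thesis using C[of p] D[of p] by (simp add: distrib_right)
  qed
  then show "\<exists>C. \<forall>p. cmod (a p + b p) * \<rho> ^ (fst p + snd p) \<le> C" by blast
qed

text \<open>A polynomial factor is absorbed by passing to a slightly larger radius \<sigma> < 1,
  since (1 + n)^N (\<rho> / \<sigma>)^n is bounded.\<close>

lemma subexp_poly:
  assumes a: "subexp a" and b: "\<And>p. cmod (b p) \<le> K * (1 + real (fst p + snd p)) ^ N * cmod (a p)"
  shows "subexp b"
  unfolding subexp_def
proof (intro allI impI)
  fix \<rho> :: real assume \<rho>: "0 < \<rho> \<and> \<rho> < 1"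
  define \<sigma> where "\<sigma> = (1 + \<rho>) / 2"
  have \<sigma>: "0 < \<sigma>" "\<sigma> < 1" "\<rho> < \<sigma>" using \<rho> by (auto simp: \<sigma>_def)
  define q where "q = \<rho> / \<sigma>"
  have q: "0 \<le> q" "q < 1" using \<rho> \<sigma> by (auto simp: q_def)
  obtain C where C: "C \<ge> 0" "\<And>p. cmod (a p) * \<sigma> ^ (fst p + snd p) \<le> C"
    using subexpD[OF a \<sigma>(1,2)] by blast
  have "cmod (b p) * \<rho> ^ (fst p + snd p) \<le> \<bar>K\<bar> * (fact N * exp 1 / (1 - q) ^ N) * C" for p
  proof -
    let ?n = "fst p + snd p"
    have "cmod (b p) \<le> \<bar>K\<bar> * (1 + real ?n) ^ N * cmod (a p)"
      using b[of p] by (rule order_trans) (intro mult_right_mono, auto)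
    then have "cmod (b p) * \<rho> ^ ?n \<le> (\<bar>K\<bar> * (1 + real ?n) ^ N * cmod (a p)) * (\<sigma> * q) ^ ?n"
      using \<rho> \<sigma> by (auto simp: q_def intro!: mult_right_mono)
    also have "\<dots> = \<bar>K\<bar> * ((1 + real ?n) ^ N * q ^ ?n) * (cmod (a p) * \<sigma> ^ ?n)"
      by (simp add: power_mult_distrib)
    also have "\<dots> \<le> \<bar>K\<bar> * (fact N * exp 1 / (1 - q) ^ N) * C"
      using q \<sigma> by (intro mult_mono poly_geom_bound C) auto
    finally show ?thesis .
  qed
  then show "\<exists>C. \<forall>p. cmod (b p) * \<rho> ^ (fst p + snd p) \<le> C" by blast
qed

lemma subexp_cmult: "subexp a \<Longrightarrow> subexp (\<lambda>p. c * a p)"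
  by (rule subexp_poly[where K = "cmod c" and N = 0]) (auto simp: norm_mult)

text \<open>On coefficients, \<open>up1\<close> and \<open>up2\<close> are multiplication by z and
  \<open>cnj z\<close>; \<open>diff1\<close> and \<open>diff2\<close> are the formal Wirtinger
  derivatives.\<close>

definition up1 :: "(nat \<times> nat \<Rightarrow> complex) \<Rightarrow> nat \<times> nat \<Rightarrow> complex" where
  "up1 a p = (case fst p of 0 \<Rightarrow> 0 | Suc j \<Rightarrow> a (j, snd p))"

definition up2 :: "(nat \<times> nat \<Rightarrow> complex) \<Rightarrow> nat \<times> nat \<Rightarrow> complex" where
  "up2 a p = (case snd p of 0 \<Rightarrow> 0 | Suc l \<Rightarrow> a (fst p, l))"

definition diff1 :: "(nat \<times> nat \<Rightarrow> complex) \<Rightarrow> nat \<times> nat \<Rightarrow> complex" where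
  "diff1 a p = of_nat (Suc (fst p)) * a (Suc (fst p), snd p)"

definition diff2 :: "(nat \<times> nat \<Rightarrow> complex) \<Rightarrow> nat \<times> nat \<Rightarrow> complex" where
  "diff2 a p = of_nat (Suc (snd p)) * a (fst p, Suc (snd p))"

lemma subexp_up: assumes a: "subexp a" shows "subexp (up1 a)" "subexp (up2 a)"
proof -
  have *: "\<exists>C. \<forall>p. cmod (up1 a p) * \<rho> ^ (fst p + snd p) \<le> C \<and> cmod (up2 a p) * \<rho> ^ (fst p + snd p) \<le> C"
    if \<rho>: "0 < \<rho>" "\<rho> < 1" for \<rho>
  proof -
    obtain C where C: "C \<ge> 0" "\<And>p. cmod (a p) * \<rho> ^ (fst p + snd p) \<le> C"
      using subexpD[OF a \<rho>] by blast
    have E: "cmod (a (j, l)) * (\<rho> * \<rho> ^ (j + l)) \<le> C" for j l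
    proof -
      have "cmod (a (j, l)) * (\<rho> * \<rho> ^ (j + l)) = \<rho> * (cmod (a (j, l)) * \<rho> ^ (j + l))" by simp
      also have "\<dots> \<le> \<rho> * C" using C(2)[of "(j, l)"] \<rho> by (intro mult_left_mono) auto
      also have "\<dots> \<le> C" using \<rho> C by (simp add: mult_left_le_one_le)
      finally show ?thesis .
    qed
    have "cmod (up1 a p) * \<rho> ^ (fst p + snd p) \<le> C" for p
      using E[of "fst p - 1" "snd p"] C(1) by (cases "fst p") (auto simp: up1_def)
    moreover have "cmod (up2 a p) * \<rho> ^ (fst p + snd p) \<le> C" for p
      using E[of "fst p" "snd p - 1"] C(1) by (cases "snd p") (auto simp: up2_def)
    ultimately show ?thesis by blast
  qed
  show "subexp (up1 a)" "subexp (up2 a)" unfolding subexp_def using * by meson+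
qed

lemma subexp_diff: assumes a: "subexp a" shows "subexp (diff1 a)" "subexp (diff2 a)"
proof -
  have *: "\<exists>C. \<forall>p. cmod (a (Suc (fst p), snd p)) * \<rho> ^ (fst p + snd p) \<le> C \<and>
      cmod (a (fst p, Suc (snd p))) * \<rho> ^ (fst p + snd p) \<le> C"
    if \<rho>: "0 < \<rho>" "\<rho> < 1" for \<rho>
  proof -
    obtain C where C: "C \<ge> 0" "\<And>p. cmod (a p) * \<rho> ^ (fst p + snd p) \<le> C"
      using subexpD[OF a \<rho>] by blast
    have "x * y \<le> C / \<rho>" if "x * (\<rho> * y) \<le> C" for x y
      using that \<rho> by (simp add: field_simps)
    then show ?thesis
      using C(2)[of "(Suc _, _)"] C(2)[of "(_, Suc _)"] by (intro exI[of _ "C / \<rho>"]) auto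
  qed
  have "subexp (\<lambda>p. a (Suc (fst p), snd p))" "subexp (\<lambda>p. a (fst p, Suc (snd p)))"
    unfolding subexp_def using * by meson+
  note 1 = subexp_poly[OF this(1), where K = 1 and N = 1, of "diff1 a"]
    subexp_poly[OF this(2), where K = 1 and N = 1, of "diff2 a"]
  show "subexp (diff1 a)"
    by (rule 1(1)) (simp add: diff1_def norm_mult mult_right_mono del: of_nat_Suc)
  show "subexp (diff2 a)"
    by (rule 1(2)) (simp add: diff2_def norm_mult mult_right_mono del: of_nat_Suc)
qed

lemma infsum_shift:
  fixes g :: "nat \<times> nat \<Rightarrow> 'c::{comm_monoid_add, t2_space}"
  shows "(\<And>l. g (0, l) = 0) \<Longrightarrow> infsum g UNIV = (\<Sum>\<^sub>\<infinity>p. g (Suc (fst p), snd p))"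
    "(\<And>j. g (j, 0) = 0) \<Longrightarrow> infsum g UNIV = (\<Sum>\<^sub>\<infinity>p. g (fst p, Suc (snd p)))"
proof -
  have inj: "inj (\<lambda>p. (Suc (fst p), snd p))" "inj (\<lambda>p. (fst p, Suc (snd p)))"
    by (auto simp: inj_on_def prod_eq_iff)
  have "infsum g UNIV = infsum g (range (\<lambda>p. (Suc (fst p), snd p)))" if "\<And>l. g (0, l) = 0"
  proof (rule infsum_cong_neutral)
    fix p assume "p \<in> UNIV - range (\<lambda>p. (Suc (fst p), snd p :: nat))"
    then show "g p = 0" using that by (cases p; cases "fst p") (auto simp: image_iff)
  qed auto
  then show "(\<And>l. g (0, l) = 0) \<Longrightarrow> infsum g UNIV = (\<Sum>\<^sub>\<infinity>p. g (Suc (fst p), snd p))"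
    using infsum_reindex[OF inj(1), of g] by (simp add: o_def)
  have "infsum g UNIV = infsum g (range (\<lambda>p. (fst p, Suc (snd p))))" if "\<And>j. g (j, 0) = 0"
  proof (rule infsum_cong_neutral)
    fix p assume "p \<in> UNIV - range (\<lambda>p. (fst p :: nat, Suc (snd p)))"
    then show "g p = 0" using that by (cases p; cases "snd p") (auto simp: image_iff)
  qed auto
  then show "(\<And>j. g (j, 0) = 0) \<Longrightarrow> infsum g UNIV = (\<Sum>\<^sub>\<infinity>p. g (fst p, Suc (snd p)))"
    using infsum_reindex[OF inj(2), of g] by (simp add: o_def)
qed

lemma double_series_up:
  "double_series (up1 a) z = z * double_series a z" "double_series (up2 a) z = cnj z * double_series a z"
proof -
  show "double_series (up1 a) z = z * double_series a z"
    unfolding double_series_def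
    by (subst infsum_shift(1)) (simp_all add: up1_def infsum_cmult_right'[symmetric] mult_ac)
  show "double_series (up2 a) z = cnj z * double_series a z"
    unfolding double_series_def
    by (subst infsum_shift(2)) (simp_all add: up2_def infsum_cmult_right'[symmetric] mult_ac)
qed

lemma has_wirtinger_monomial:
  "has_wirtinger (\<lambda>w. c * w ^ j * cnj w ^ l)
     (c * of_nat j * z ^ (j - 1) * cnj z ^ l) (c * of_nat l * z ^ j * cnj z ^ (l - 1)) z"
proof -
  have "(cnj has_derivative cnj) (at z)"
    using bounded_linear_cnj bounded_linear_imp_has_derivative by blast
  then show ?thesis unfolding has_wirtinger_def
    by (auto intro!: derivative_eq_intros simp: fun_eq_iff algebra_simps)
qed

text \<open>Termwise differentiation on a disc of radius r with |z| < r < 1, where one summable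
  majorant serves all points.\<close>

lemma double_series_has_wirtinger:
  assumes a: "subexp a" and z: "cmod z < 1"
  shows "has_wirtinger (double_series a) (double_series (diff1 a) z) (double_series (diff2 a) z) z"
proof -
  define r where "r = (1 + cmod z) / 2"
  have r: "0 < r" "r < 1" "cmod z < r" using z by (auto simp: r_def add_pos_nonneg)
  define F where "F p y = a p * y ^ fst p * cnj y ^ snd p" for p y
  define P where "P p y = a p * of_nat (fst p) * y ^ (fst p - 1) * cnj y ^ snd p" for p y
  define Q where "Q p y = a p * of_nat (snd p) * y ^ fst p * cnj y ^ (snd p - 1)" for p y
  \<comment> \<open>The weight 1 + j + l dominates the factors j and l produced by the two
    derivatives together, and 1 / r pays for the lowered exponent.\<close>
  define M where "M p = cmod (a p * (1 + of_nat (fst p + snd p))) * r ^ (fst p + snd p) / r" for p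
  have "subexp (\<lambda>p. a p * (1 + of_nat (fst p + snd p)))"
  proof (rule subexp_poly[OF a, where K = 1 and N = 1])
    have "cmod (1 + of_nat n) = 1 + real n" for n
      by (metis norm_of_nat of_nat_Suc)
    then show "cmod (a p * (1 + of_nat (fst p + snd p))) \<le> 1 * (1 + real (fst p + snd p)) ^ 1 * cmod (a p)" for p
      by (simp only: norm_mult) simp
  qed
  from subexp_summable[OF this _ r(2)] have M: "M summable_on UNIV"
    unfolding M_def divide_inverse using r by (intro summable_on_cmult_left) auto
  have PQ: "cmod (P p y) + cmod (Q p y) \<le> M p" if y: "cmod y < r" for p y
  proof -
    have 1: "real m * cmod y ^ (m - 1) \<le> real m * (r ^ m / r)" for m
      using y r by (cases m) (auto intro!: mult_left_mono power_mono)
    have 2: "cmod y ^ m \<le> r ^ m" for m using y by (intro power_mono) auto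
    have "cmod (P p y) + cmod (Q p y) =
      cmod (a p) * ((real (fst p) * cmod y ^ (fst p - 1)) * cmod y ^ snd p +
        (cmod y ^ fst p * (real (snd p) * cmod y ^ (snd p - 1))))"
      by (simp add: P_def Q_def norm_mult norm_power algebra_simps)
    also have "\<dots> \<le> cmod (a p) * ((real (fst p) * (r ^ fst p / r)) * r ^ snd p +
        (r ^ fst p * (real (snd p) * (r ^ snd p / r))))"
      using r by (intro mult_left_mono add_mono mult_mono 1 2) auto
    also have "\<dots> = cmod (a p) * real (fst p + snd p) * r ^ (fst p + snd p) / r"
      by (simp add: power_add algebra_simps add_divide_distrib)
    also have "\<dots> \<le> M p"
    proof -
      have "cmod (1 + of_nat n) = 1 + real n" for n
        by (metis norm_of_nat of_nat_Suc)
      then show ?thesis unfolding M_def norm_mult using r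
        by (auto intro!: divide_right_mono mult_right_mono mult_left_mono simp del: of_nat_add)
    qed
    finally show ?thesis .
  qed
  have Ps: "(\<lambda>p. P p y) summable_on UNIV" and Qs: "(\<lambda>p. Q p y) summable_on UNIV" if "cmod y < r" for y
  proof -
    have 1: "cmod (P p y) \<le> M p" "cmod (Q p y) \<le> M p" for p
      using PQ[OF that, of p] norm_ge_zero[of "P p y"] norm_ge_zero[of "Q p y"] by linarith+
    show "(\<lambda>p. P p y) summable_on UNIV"
      by (rule abs_summable_summable[OF Infinite_Sum.abs_summable_on_comparison_test'[OF M]]) (rule 1)
    show "(\<lambda>p. Q p y) summable_on UNIV"
      by (rule abs_summable_summable[OF Infinite_Sum.abs_summable_on_comparison_test'[OF M]]) (rule 1)
  qed
  have "((\<lambda>y. \<Sum>\<^sub>\<infinity>p. F p y) has_derivative (\<lambda>h. \<Sum>\<^sub>\<infinity>p. P p z * h + Q p z * cnj h)) (at z within ball 0 r)"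
  proof (rule has_derivative_infsum[where M = M])
    show "infinite (UNIV :: (nat \<times> nat) set)" by (simp add: finite_prod)
    show "(F p has_derivative (\<lambda>h. P p y * h + Q p y * cnj h)) (at y within ball 0 r)" for p y
      using has_wirtinger_monomial[of "a p" "fst p" "snd p" y] has_derivative_at_withinI
      unfolding has_wirtinger_def F_def[abs_def] P_def Q_def by blast
    show "cmod (P p y * h + Q p y * cnj h) \<le> M p * cmod h" if "y \<in> ball 0 r" for p y h
    proof -
      have "cmod (P p y * h + Q p y * cnj h) \<le> (cmod (P p y) + cmod (Q p y)) * cmod h"
        by (metis norm_triangle_ineq norm_mult complex_mod_cnj distrib_right)
      also have "\<dots> \<le> M p * cmod h" using PQ[of y p] that by (intro mult_right_mono) auto
      finally show ?thesis .
    qed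
    show "(\<lambda>p. F p y) summable_on UNIV" if "y \<in> ball 0 r" for y
      unfolding F_def using that r by (intro double_series_summable a) auto
  qed (use r M in auto)
  moreover have "(\<Sum>\<^sub>\<infinity>p. P p z * h + Q p z * cnj h) = double_series (diff1 a) z * h + double_series (diff2 a) z * cnj h" for h
  proof -
    have "(\<Sum>\<^sub>\<infinity>p. P p z) = double_series (diff1 a) z" "(\<Sum>\<^sub>\<infinity>p. Q p z) = double_series (diff2 a) z"
      unfolding double_series_def by (subst infsum_shift; simp add: P_def Q_def diff1_def diff2_def mult_ac)+
    then show ?thesis
      using Ps[OF r(3)] Qs[OF r(3)]
      by (simp add: infsum_add summable_on_cmult_left infsum_cmult_left')
  qed
  moreover have "at z within ball 0 r = at z" using r by (intro at_within_open) auto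
  ultimately show ?thesis unfolding has_wirtinger_def double_series_def[abs_def] F_def by simp
qed

section \<open>Weighted double series and their derivatives\<close>

definition disc_form :: "real \<Rightarrow> (nat \<times> nat \<Rightarrow> complex) \<Rightarrow> (complex \<Rightarrow> complex) \<Rightarrow> bool" where
  "disc_form b a u \<longleftrightarrow> subexp a \<and> (\<forall>z\<in>ball 0 1. u z = of_real ((1 - (cmod z)\<^sup>2) powr b) * double_series a z)"

text \<open>The class of functions \<open>disc_form b a\<close> with varying \<open>b\<close> is closed under differentiation: the
  derivatives of \<open>(1 - |z|\<^sup>2) powr b * double_series a z\<close> are \<open>(1 - |z|\<^sup>2) powr (b - 1)\<close> times the following series.\<close>

definition bracket1 :: "real \<Rightarrow> (nat \<times> nat \<Rightarrow> complex) \<Rightarrow> nat \<times> nat \<Rightarrow> complex" where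
  "bracket1 b a p = diff1 a p - up2 (\<lambda>p. (of_nat (fst p) + of_real b) * a p) p"

definition bracket2 :: "real \<Rightarrow> (nat \<times> nat \<Rightarrow> complex) \<Rightarrow> nat \<times> nat \<Rightarrow> complex" where
  "bracket2 b a p = diff2 a p - up1 (\<lambda>p. (of_nat (snd p) + of_real b) * a p) p"

lemma subexp_affine:
  assumes "subexp a"
  shows "subexp (\<lambda>p. (of_nat (fst p) + of_real b) * a p)" "subexp (\<lambda>p. (of_nat (snd p) + of_real b) * a p)"
proof -
  have *: "cmod (of_nat m + of_real b) \<le> (1 + \<bar>b\<bar>) * (1 + real n) ^ 1" if "m \<le> n" for m n
  proof -
    have "cmod (of_nat m + of_real b) \<le> real m + \<bar>b\<bar>"
      by (metis norm_triangle_ineq norm_of_nat norm_of_real)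
    also have "\<dots> \<le> real n + \<bar>b\<bar> + (1 + \<bar>b\<bar> * real n)" using that mult_nonneg_nonneg[of "\<bar>b\<bar>" "real n"] by linarith
    finally show ?thesis by (simp add: algebra_simps)
  qed
  show "subexp (\<lambda>p. (of_nat (fst p) + of_real b) * a p)" "subexp (\<lambda>p. (of_nat (snd p) + of_real b) * a p)"
    unfolding norm_mult
    by (rule subexp_poly[OF assms, where K = "1 + \<bar>b\<bar>" and N = 1], unfold norm_mult,
        intro mult_right_mono *; simp)+
qed

lemma subexp_bracket:
  assumes a: "subexp a" shows "subexp (bracket1 b a)" "subexp (bracket2 b a)"
  using subexp_add[OF subexp_diff(1)[OF a] subexp_cmult[OF subexp_up(2)[OF subexp_affine(1)[OF a]], of "-1"]]
    subexp_add[OF subexp_diff(2)[OF a] subexp_cmult[OF subexp_up(1)[OF subexp_affine(2)[OF a]], of "-1"]]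
  unfolding bracket1_def[abs_def] bracket2_def[abs_def] by simp_all

text \<open>The right-hand sides are what remains of the derivatives of (1 - |z|^2)^b F once (1 -
  |z|^2)^(b - 1) is factored out. The product of z and the z-derivative multiplies a coefficient by
  its first index j, which explains the factor j + b in \<open>bracket1\<close>;
  \<open>bracket2\<close> is symmetric.\<close>

lemma double_series_bracket:
  assumes a: "subexp a" "cmod z < 1"
  shows "double_series (bracket1 b a) z = (1 - z * cnj z) * double_series (diff1 a) z - of_real b * cnj z * double_series a z"
    "double_series (bracket2 b a) z = (1 - z * cnj z) * double_series (diff2 a) z - of_real b * z * double_series a z"
proof -
  note s = subexp_diff[OF a(1)] subexp_up[OF subexp_diff(1)[OF a(1)]] subexp_up[OF subexp_diff(2)[OF a(1)]]
  have 1: "(\<lambda>p. (of_nat (fst p) + of_real b) * a p) = (\<lambda>p. up1 (diff1 a) p + of_real b * a p)"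
    "(\<lambda>p. (of_nat (snd p) + of_real b) * a p) = (\<lambda>p. up2 (diff2 a) p + of_real b * a p)"
    by (auto simp: fun_eq_iff up1_def up2_def diff1_def diff2_def algebra_simps split: nat.splits)
  define A where "A p = up1 (diff1 a) p + of_real b * a p" for p
  define B where "B p = up2 (diff2 a) p + of_real b * a p" for p
  have A: "subexp A" "subexp B"
    unfolding A_def[abs_def] B_def[abs_def] using subexp_add[OF s(3) subexp_cmult[OF a(1)]]
      subexp_add[OF s(6) subexp_cmult[OF a(1)]] by auto
  have "bracket1 b a = (\<lambda>p. diff1 a p + (-1) * up2 A p)" "bracket2 b a = (\<lambda>p. diff2 a p + (-1) * up1 B p)"
    unfolding bracket1_def[abs_def] bracket2_def[abs_def] 1 A_def[abs_def] B_def[abs_def] by auto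
  then have 2: "double_series (bracket1 b a) z = double_series (diff1 a) z - cnj z * double_series A z"
    "double_series (bracket2 b a) z = double_series (diff2 a) z - z * double_series B z"
    using double_series_add[OF s(1) subexp_cmult[OF subexp_up(2)[OF A(1)], of "-1"] a(2)]
      double_series_add[OF s(2) subexp_cmult[OF subexp_up(1)[OF A(2)], of "-1"] a(2)]
    unfolding double_series_cmult double_series_up by simp_all
  have 3: "double_series A z = z * double_series (diff1 a) z + of_real b * double_series a z"
    "double_series B z = cnj z * double_series (diff2 a) z + of_real b * double_series a z"
    unfolding A_def[abs_def] B_def[abs_def] double_series_add[OF s(3) subexp_cmult[OF a(1)] a(2)]
      double_series_add[OF s(6) subexp_cmult[OF a(1)] a(2)] double_series_cmult double_series_up by simp_all
  show "double_series (bracket1 b a) z = (1 - z * cnj z) * double_series (diff1 a) z - of_real b * cnj z * double_series a z"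
    "double_series (bracket2 b a) z = (1 - z * cnj z) * double_series (diff2 a) z - of_real b * z * double_series a z"
    unfolding 2 3 by (simp_all add: ring_distribs mult_ac left_diff_distrib)
qed

lemma disc_form_has_wirtinger:
  assumes u: "disc_form b a u" and z: "cmod z < 1"
  shows "has_wirtinger u (of_real ((1 - (cmod z)\<^sup>2) powr (b - 1)) * double_series (bracket1 b a) z)
     (of_real ((1 - (cmod z)\<^sup>2) powr (b - 1)) * double_series (bracket2 b a) z) z"
proof -
  have a: "subexp a" using u by (simp add: disc_form_def)
  define s where "s = 1 - (cmod z)\<^sup>2"
  have s: "s > 0" using z by (simp add: s_def abs_square_less_1)
  have sz: "1 - z * cnj z = of_real s" by (simp add: s_def complex_norm_square[symmetric])
  have pw: "s powr b = s powr (b - 1) * s" using s by (simp add: powr_mult_base powr_diff)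
  have "has_wirtinger u
     (of_real (s powr b) * double_series (diff1 a) z + - (of_real (b * s powr (b - 1)) * cnj z) * double_series a z)
     (of_real (s powr b) * double_series (diff2 a) z + - (of_real (b * s powr (b - 1)) * z) * double_series a z) z"
    by (rule has_wirtinger_cong[OF has_wirtinger_mult[OF has_wirtinger_one_minus_norm_powr[OF z, of b] double_series_has_wirtinger[OF a z],
          folded s_def], where S = "ball 0 1"])
       (use u z in \<open>auto simp: disc_form_def\<close>)
  then show ?thesis
    unfolding s_def[symmetric] double_series_bracket[OF a z] sz pw of_real_mult
    by (simp add: algebra_simps)
qed

lemma disc_form_partials:
  assumes u: "disc_form b a u"
  shows "disc_form (b - 1) (\<lambda>p. bracket1 b a p + bracket2 b a p) (partial_x u)"
    "disc_form (b - 1) (\<lambda>p. \<i> * (bracket1 b a p + (-1) * bracket2 b a p)) (partial_y u)"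
proof -
  have a: "subexp a" using u by (simp add: disc_form_def)
  note s = subexp_bracket[OF a, of b]
  note s' = subexp_add[OF s(1) subexp_cmult[OF s(2), of "-1"]]
  show "disc_form (b - 1) (\<lambda>p. bracket1 b a p + bracket2 b a p) (partial_x u)"
    unfolding disc_form_def
    using subexp_add[OF s] has_wirtinger_imp(1)[OF disc_form_has_wirtinger[OF u]] double_series_add[OF s]
    by (simp add: distrib_left)
  show "disc_form (b - 1) (\<lambda>p. \<i> * (bracket1 b a p + (-1) * bracket2 b a p)) (partial_y u)"
    unfolding disc_form_def
  proof (intro conjI ballI subexp_cmult[OF s'])
    fix z :: complex assume "z \<in> ball 0 1"
    then have z: "cmod z < 1" by simp
    show "partial_y u z = of_real ((1 - (cmod z)\<^sup>2) powr (b - 1)) *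
        double_series (\<lambda>p. \<i> * (bracket1 b a p + (-1) * bracket2 b a p)) z"
      unfolding double_series_cmult double_series_add[OF s(1) subexp_cmult[OF s(2), of "-1"] z]
        has_wirtinger_imp(2)[OF disc_form_has_wirtinger[OF u z]]
      by (simp add: algebra_simps)
  qed
qed

text \<open>The partial derivatives stay in the class with exponent b - 1, so their continuity
  follows from the same differentiability result as that of u.\<close>

lemma disc_form_C1: assumes "disc_form b a u" shows "C1_on (ball 0 1) u"
proof -
  have d: "continuous_on (ball 0 1) v \<and> partials_exist_on (ball 0 1) v" if "disc_form b a v" for b a v
  proof -
    have D: "(v has_derivative (\<lambda>h. of_real ((1 - (cmod z)\<^sup>2) powr (b - 1)) * double_series (bracket1 b a) z * h +
       of_real ((1 - (cmod z)\<^sup>2) powr (b - 1)) * double_series (bracket2 b a) z * cnj h)) (at z)" if "z \<in> ball 0 1" for z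
      using disc_form_has_wirtinger[OF \<open>disc_form b a v\<close>, of z] that by (simp add: has_wirtinger_def)
    have "continuous_on (ball 0 1) v"
      using has_derivative_continuous[OF D] continuous_at_imp_continuous_on by blast
    then show ?thesis
      using has_derivative_partials(3,4)[OF D] by (auto simp: partials_exist_on_def)
  qed
  show ?thesis unfolding C1_on_def
    using d[OF assms] d[OF disc_form_partials(1)[OF assms]] d[OF disc_form_partials(2)[OF assms]] by blast
qed

lemma disc_form_C2: assumes "disc_form b a u" shows "C2_on (ball 0 1) u"
  unfolding C2_on_def using disc_form_C1 disc_form_partials assms by blast

section \<open>Functions and distributions on the circle\<close>

lemma circle_deriv_0: "circle_deriv 0 \<psi> = (\<lambda>\<theta>. \<psi> (cis \<theta>))"
  by (simp add: circle_deriv_def)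

lemma circle_deriv_Suc: "circle_deriv (Suc k) \<psi> \<theta> = vector_derivative (circle_deriv k \<psi>) (at \<theta>)"
  by (simp add: circle_deriv_def)

lemma circle_deriv_has_vector_derivative:
  assumes "\<psi> \<in> circle_smooth"
  shows "(circle_deriv k \<psi> has_vector_derivative circle_deriv (Suc k) \<psi> \<theta>) (at \<theta>)"
proof -
  have "circle_deriv k \<psi> differentiable (at \<theta>)"
    using assms by (auto simp: circle_smooth_def differentiable_on_def)
  then show ?thesis unfolding circle_deriv_Suc by (simp add: vector_derivative_works)
qed

text \<open>\<open>circle_deriv\<close> iterates a derivative chosen by description; exhibiting a
  chain \<open>D\<close> of successive derivatives yields smoothness and identifies every iterate at
  once.\<close>

lemma circle_smoothI:
  assumes 0: "D 0 = (\<lambda>\<theta>. \<psi> (cis \<theta>))"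
    and S: "\<And>k \<theta>. (D k has_vector_derivative D (Suc k) \<theta>) (at \<theta>)"
  shows "\<psi> \<in> circle_smooth" "circle_deriv k \<psi> = D k"
proof -
  have *: "circle_deriv k \<psi> = D k" for k
  proof (induction k)
    case (Suc k)
    show ?case by (rule ext) (simp add: circle_deriv_Suc Suc.IH vector_derivative_at[OF S])
  qed (simp add: circle_deriv_0 0)
  then show "circle_deriv k \<psi> = D k" .
  show "\<psi> \<in> circle_smooth"
    using differentiableI_vector[OF S] * by (auto simp: circle_smooth_def differentiable_on_def)
qed

lemma circle_smooth_add:
  assumes "\<psi> \<in> circle_smooth" "\<eta> \<in> circle_smooth"
  shows "(\<lambda>\<zeta>. \<psi> \<zeta> + \<eta> \<zeta>) \<in> circle_smooth"
    "circle_deriv k (\<lambda>\<zeta>. \<psi> \<zeta> + \<eta> \<zeta>) = (\<lambda>\<theta>. circle_deriv k \<psi> \<theta> + circle_deriv k \<eta> \<theta>)"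
  by (rule circle_smoothI[where D = "\<lambda>k \<theta>. circle_deriv k \<psi> \<theta> + circle_deriv k \<eta> \<theta>"],
      simp add: circle_deriv_0,
      rule has_vector_derivative_add[OF assms[THEN circle_deriv_has_vector_derivative]])+

lemma circle_smooth_cmult:
  assumes "\<psi> \<in> circle_smooth"
  shows "(\<lambda>\<zeta>. c * \<psi> \<zeta>) \<in> circle_smooth"
    "circle_deriv k (\<lambda>\<zeta>. c * \<psi> \<zeta>) = (\<lambda>\<theta>. c * circle_deriv k \<psi> \<theta>)"
  by (rule circle_smoothI[where D = "\<lambda>k \<theta>. c * circle_deriv k \<psi> \<theta>"],
      simp add: circle_deriv_0,
      rule has_vector_derivative_mult_right[OF assms[THEN circle_deriv_has_vector_derivative]])+

lemma circle_smooth_cnj: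
  assumes "\<psi> \<in> circle_smooth"
  shows "(\<lambda>\<zeta>. cnj (\<psi> \<zeta>)) \<in> circle_smooth"
  by (rule circle_smoothI[where D = "\<lambda>k \<theta>. cnj (circle_deriv k \<psi> \<theta>)"],
      simp add: circle_deriv_0,
      rule bounded_linear.has_vector_derivative[OF bounded_linear_cnj
          assms[THEN circle_deriv_has_vector_derivative]])

lemma has_vector_derivative_cis_mult:
  "((\<lambda>t. c * cis (of_int k * t)) has_vector_derivative c * (\<i> * of_int k) * cis (of_int k * \<theta>)) (at \<theta>)"
  unfolding has_vector_derivative_def
  by (auto intro!: derivative_eq_intros simp: fun_eq_iff scaleR_conv_of_real algebra_simps)

lemma circle_smooth_monomial:
  shows "(\<lambda>\<zeta>. \<zeta> powi k) \<in> circle_smooth"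
    "circle_deriv j (\<lambda>\<zeta>. \<zeta> powi k) = (\<lambda>\<theta>. (\<i> * of_int k) ^ j * cis (of_int k * \<theta>))"
proof -
  define D where "D j \<theta> = (\<i> * of_int k) ^ j * cis (of_int k * \<theta>)" for j \<theta>
  have "D 0 = (\<lambda>\<theta>. cis \<theta> powi k)" by (simp add: D_def fun_eq_iff cis_power_int)
  moreover have "(D j has_vector_derivative D (Suc j) \<theta>) (at \<theta>)" for j \<theta>
    using has_vector_derivative_cis_mult[of "(\<i> * of_int k) ^ j" k \<theta>] by (simp add: D_def[abs_def] mult_ac)
  ultimately show "(\<lambda>\<zeta>. \<zeta> powi k) \<in> circle_smooth"
    "circle_deriv j (\<lambda>\<zeta>. \<zeta> powi k) = (\<lambda>\<theta>. (\<i> * of_int k) ^ j * cis (of_int k * \<theta>))"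
    using circle_smoothI[of D "\<lambda>\<zeta>. \<zeta> powi k"] unfolding D_def[symmetric] by simp_all
qed

lemma circle_deriv_continuous:
  assumes "\<psi> \<in> circle_smooth" shows "continuous_on A (circle_deriv k \<psi>)"
  using has_vector_derivative_continuous[OF circle_deriv_has_vector_derivative[OF assms]]
    continuous_at_imp_continuous_on by blast

lemma circle_deriv_periodic:
  assumes "\<psi> \<in> circle_smooth" shows "circle_deriv k \<psi> (\<theta> + 2 * pi) = circle_deriv k \<psi> \<theta>"
proof (induction k arbitrary: \<theta>)
  case 0
  have "cis (\<theta> + 2 * pi) = cis \<theta>" by (simp add: cis_mult[symmetric])
  then show ?case by (simp add: circle_deriv_0)
next
  case (Suc k)
  have "((\<lambda>t. t + 2 * pi) has_derivative (\<lambda>h. h)) (at \<theta>)" by (auto intro!: derivative_eq_intros)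
  from has_derivative_compose[OF this
      circle_deriv_has_vector_derivative[OF assms, unfolded has_vector_derivative_def, of k]]
  have "((\<lambda>t. circle_deriv k \<psi> (t + 2 * pi)) has_vector_derivative circle_deriv (Suc k) \<psi> (\<theta> + 2 * pi)) (at \<theta>)"
    by (simp add: has_vector_derivative_def)
  moreover have "(\<lambda>t. circle_deriv k \<psi> (t + 2 * pi)) = circle_deriv k \<psi>" by (rule ext) (rule Suc.IH)
  ultimately have "(circle_deriv k \<psi> has_vector_derivative circle_deriv (Suc k) \<psi> (\<theta> + 2 * pi)) (at \<theta>)" by simp
  then show ?case
    using vector_derivative_at circle_deriv_has_vector_derivative[OF assms] by metis
qed

lemma periodic_reduce:
  fixes F :: "real \<Rightarrow> 'a"
  assumes "\<And>\<theta>. F (\<theta> + 2 * pi) = F \<theta>"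
  shows "\<exists>t\<in>{0..2 * pi}. F \<theta> = F t"
proof -
  interpret periodic_fun_simple F "2 * pi" by standard (rule assms)
  define n where "n = \<lfloor>\<theta> / (2 * pi)\<rfloor>"
  have n: "of_int n * (2 * pi) \<le> \<theta>" "\<theta> \<le> (of_int n + 1) * (2 * pi)"
    using floor_correct[of "\<theta> / (2 * pi)"] pi_gt_zero unfolding n_def[symmetric]
    by (simp_all add: pos_le_divide_eq pos_divide_less_eq less_imp_le)
  have "F \<theta> = F (\<theta> - of_int n * (2 * pi))" by (simp add: minus_of_int)
  then show ?thesis using n by (intro bexI[of _ "\<theta> - of_int n * (2 * pi)"]) (auto simp: algebra_simps)
qed

lemma circle_deriv_bdd:
  assumes "\<psi> \<in> circle_smooth" shows "bdd_above (range (\<lambda>\<theta>. cmod (circle_deriv k \<psi> \<theta>)))"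
proof -
  have "bounded (circle_deriv k \<psi> ` {0..2 * pi})"
    by (intro compact_imp_bounded compact_continuous_image circle_deriv_continuous assms compact_Icc)
  then obtain B where "\<And>t. t \<in> {0..2 * pi} \<Longrightarrow> cmod (circle_deriv k \<psi> t) \<le> B"
    unfolding bounded_iff by blast
  then have "cmod (circle_deriv k \<psi> \<theta>) \<le> B" for \<theta>
    using periodic_reduce[of "circle_deriv k \<psi>", OF circle_deriv_periodic[OF assms], of \<theta>] by auto
  then show ?thesis by (intro bdd_aboveI) auto
qed

lemma circle_deriv_le_SUP:
  assumes "\<psi> \<in> circle_smooth" shows "cmod (circle_deriv k \<psi> \<theta>) \<le> (SUP \<theta>. cmod (circle_deriv k \<psi> \<theta>))"
  using circle_deriv_bdd[OF assms] by (intro cSUP_upper) auto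

lemma SUP_circle_deriv_nonneg:
  assumes "\<psi> \<in> circle_smooth" shows "0 \<le> (SUP \<theta>. cmod (circle_deriv k \<psi> \<theta>))"
  using circle_deriv_le_SUP[OF assms, of k 0] norm_ge_zero order_trans by blast

section \<open>Distributions, their Fourier coefficients, and functions as distributions\<close>

lemma circle_distributionsD:
  assumes "f \<in> circle_distributions"
  shows "\<And>\<psi> \<eta>. \<psi> \<in> circle_smooth \<Longrightarrow> \<eta> \<in> circle_smooth \<Longrightarrow> f (\<lambda>\<zeta>. \<psi> \<zeta> + \<eta> \<zeta>) = f \<psi> + f \<eta>"
    "\<And>\<psi> c. \<psi> \<in> circle_smooth \<Longrightarrow> f (\<lambda>\<zeta>. c * \<psi> \<zeta>) = c * f \<psi>"
    "\<exists>C\<ge>0. \<exists>N. \<forall>\<psi>\<in>circle_smooth. cmod (f \<psi>) \<le> C * (\<Sum>k\<le>N. SUP \<theta>. cmod (circle_deriv k \<psi> \<theta>))"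
    "\<And>\<psi>. \<psi> \<notin> circle_smooth \<Longrightarrow> f \<psi> = 0"
proof -
  obtain C N where C: "\<And>\<psi>. \<psi> \<in> circle_smooth \<Longrightarrow> cmod (f \<psi>) \<le> C * (\<Sum>k\<le>N. SUP \<theta>. cmod (circle_deriv k \<psi> \<theta>))"
    using assms unfolding circle_distributions_def by blast
  have "cmod (f \<psi>) \<le> \<bar>C\<bar> * (\<Sum>k\<le>N. SUP \<theta>. cmod (circle_deriv k \<psi> \<theta>))" if "\<psi> \<in> circle_smooth" for \<psi>
    using C[OF that] by (rule order_trans) (intro mult_right_mono sum_nonneg SUP_circle_deriv_nonneg that, simp)
  then show "\<exists>C\<ge>0. \<exists>N. \<forall>\<psi>\<in>circle_smooth. cmod (f \<psi>) \<le> C * (\<Sum>k\<le>N. SUP \<theta>. cmod (circle_deriv k \<psi> \<theta>))"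
    using abs_ge_zero by blast
qed (use assms in \<open>auto simp: circle_distributions_def\<close>)

text \<open>The continuity estimate is applied to a monomial, whose j-th derivative has constant
  modulus |k|^j.\<close>

lemma fourier_coeff_poly_bounded:
  assumes f: "f \<in> circle_distributions"
  shows "\<exists>C\<ge>0. \<exists>N. \<forall>k. cmod (fourier_coeff f k) \<le> C * (1 + \<bar>real_of_int k\<bar>) ^ N"
proof -
  obtain C N where C: "C \<ge> 0" "\<And>\<psi>. \<psi> \<in> circle_smooth \<Longrightarrow> cmod (f \<psi>) \<le> C * (\<Sum>k\<le>N. SUP \<theta>. cmod (circle_deriv k \<psi> \<theta>))"
    using circle_distributionsD(3)[OF f] by blast
  have "cmod (fourier_coeff f k) \<le> C * real (Suc N) * (1 + \<bar>real_of_int k\<bar>) ^ N" for k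
  proof -
    have "cmod (fourier_coeff f k) \<le> C * (\<Sum>j\<le>N. SUP \<theta>. cmod (circle_deriv j (\<lambda>\<zeta>. \<zeta> powi (- k)) \<theta>))"
      unfolding fourier_coeff_def by (rule C(2)[OF circle_smooth_monomial(1)])
    also have "\<dots> \<le> C * (\<Sum>j\<le>N. (1 + \<bar>real_of_int k\<bar>) ^ N)"
    proof (intro mult_left_mono sum_mono C(1))
      fix j assume j: "j \<in> {..N}"
      have "(SUP \<theta>. cmod (circle_deriv j (\<lambda>\<zeta>. \<zeta> powi (- k)) \<theta>)) = \<bar>real_of_int k\<bar> ^ j"
        unfolding circle_smooth_monomial(2) by (simp add: norm_mult norm_power)
      also have "\<dots> \<le> (1 + \<bar>real_of_int k\<bar>) ^ j" by (intro power_mono) auto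
      also have "\<dots> \<le> (1 + \<bar>real_of_int k\<bar>) ^ N" using j by (intro power_increasing) auto
      finally show "(SUP \<theta>. cmod (circle_deriv j (\<lambda>\<zeta>. \<zeta> powi (- k)) \<theta>)) \<le> (1 + \<bar>real_of_int k\<bar>) ^ N" .
    qed
    finally show ?thesis by simp
  qed
  then show ?thesis using C(1) by (intro exI[of _ "C * real (Suc N)"] conjI exI[of _ N] allI) auto
qed

text \<open>Both the identification of functions with distributions and the construction of a
  distribution with prescribed Fourier coefficients are instances of the following.\<close>

lemma integral_distribution:
  fixes G1 G2 :: "real \<Rightarrow> complex"
  assumes G: "continuous_on {0..2 * pi} G1" "continuous_on {0..2 * pi} G2"
  shows "(\<lambda>\<psi>. if \<psi> \<in> circle_smooth
      then integral {0..2 * pi} (\<lambda>\<theta>. G1 \<theta> * circle_deriv 0 \<psi> \<theta> + G2 \<theta> * circle_deriv M \<psi> \<theta>) else 0)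
    \<in> circle_distributions"
proof -
  define I where "I \<psi> = integral {0..2 * pi} (\<lambda>\<theta>. G1 \<theta> * circle_deriv 0 \<psi> \<theta> + G2 \<theta> * circle_deriv M \<psi> \<theta>)" for \<psi>
  have int: "(\<lambda>\<theta>. G1 \<theta> * circle_deriv 0 \<psi> \<theta> + G2 \<theta> * circle_deriv M \<psi> \<theta>) integrable_on {0..2 * pi}"
    if "\<psi> \<in> circle_smooth" for \<psi>
    by (intro integrable_continuous_real continuous_intros G circle_deriv_continuous that)
  have add: "I (\<lambda>\<zeta>. \<psi> \<zeta> + \<eta> \<zeta>) = I \<psi> + I \<eta>" if "\<psi> \<in> circle_smooth" "\<eta> \<in> circle_smooth" for \<psi> \<eta>
    unfolding I_def circle_smooth_add(2)[OF that]
    by (subst integral_add[symmetric, OF int[OF that(1)] int[OF that(2)]]) (simp add: algebra_simps)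
  have mult: "I (\<lambda>\<zeta>. c * \<psi> \<zeta>) = c * I \<psi>" if "\<psi> \<in> circle_smooth" for \<psi> c
    unfolding I_def circle_smooth_cmult(2)[OF that]
    by (subst integral_mult_right[symmetric]) (simp add: algebra_simps)
  have "bounded (G1 ` {0..2 * pi})" "bounded (G2 ` {0..2 * pi})"
    by (intro compact_imp_bounded compact_continuous_image G compact_Icc)+
  then obtain B1 B2 where B: "\<And>t. t \<in> {0..2 * pi} \<Longrightarrow> cmod (G1 t) \<le> B1" "\<And>t. t \<in> {0..2 * pi} \<Longrightarrow> cmod (G2 t) \<le> B2"
    unfolding bounded_iff by blast
  have B0: "0 \<le> B1" "0 \<le> B2" using order_trans[OF norm_ge_zero B(1)[of 0]] order_trans[OF norm_ge_zero B(2)[of 0]] by auto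
  have bound: "cmod (I \<psi>) \<le> (2 * pi * (B1 + B2)) * (\<Sum>k\<le>M. SUP \<theta>. cmod (circle_deriv k \<psi> \<theta>))"
    if \<psi>: "\<psi> \<in> circle_smooth" for \<psi>
  proof -
    define T where "T = (\<Sum>k\<le>M. SUP \<theta>. cmod (circle_deriv k \<psi> \<theta>))"
    have T: "cmod (circle_deriv k \<psi> \<theta>) \<le> T" if "k \<le> M" for k \<theta>
    proof -
      have "(SUP \<theta>. cmod (circle_deriv k \<psi> \<theta>)) \<le> T" unfolding T_def
        using that SUP_circle_deriv_nonneg[OF \<psi>] by (intro member_le_sum) auto
      then show ?thesis using circle_deriv_le_SUP[OF \<psi>] order_trans by blast
    qed
    have "cmod (I \<psi>) \<le> ((B1 + B2) * T) * (2 * pi - 0)" unfolding I_def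
    proof (rule integral_bound)
      show "continuous_on {0..2 * pi} (\<lambda>\<theta>. G1 \<theta> * circle_deriv 0 \<psi> \<theta> + G2 \<theta> * circle_deriv M \<psi> \<theta>)"
        by (intro continuous_intros G circle_deriv_continuous \<psi>)
      show "cmod (G1 t * circle_deriv 0 \<psi> t + G2 t * circle_deriv M \<psi> t) \<le> (B1 + B2) * T"
        if "t \<in> {0..2 * pi}" for t
        unfolding distrib_right using B[OF that] B0 T
        by (intro order_trans[OF norm_triangle_ineq] add_mono) (auto simp: norm_mult intro!: mult_mono)
    qed simp
    also have "((B1 + B2) * T) * (2 * pi - 0) = 2 * pi * (B1 + B2) * T" by (simp only: diff_zero mult_ac)
    finally show ?thesis unfolding T_def .
  qed
  show ?thesis unfolding I_def[symmetric] circle_distributions_def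
    using add mult circle_smooth_add(1) circle_smooth_cmult(1)
    by (auto intro!: exI[of _ "2 * pi * (B1 + B2)"] exI[of _ M] bound)
qed

text \<open>For continuous integrands the Lebesgue integral in the definition equals the gauge
  integral, for which the calculus rules below are stated.\<close>

lemma distr_of_fun_eq:
  assumes g: "continuous_on {0..2 * pi} (\<lambda>\<theta>. g (cis \<theta>))" and \<psi>: "\<psi> \<in> circle_smooth"
  shows "distr_of_fun g \<psi> = integral {0..2 * pi} (\<lambda>\<theta>. g (cis \<theta>) * \<psi> (cis \<theta>)) / of_real (2 * pi)"
proof -
  have "continuous_on {0..2 * pi} (\<lambda>\<theta>. g (cis \<theta>) * \<psi> (cis \<theta>))"
    using circle_deriv_continuous[OF \<psi>, of _ 0] g by (intro continuous_intros) (auto simp: circle_deriv_0)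
  then show ?thesis
    using \<psi> set_lebesgue_integral_eq_integral(2)[OF absolutely_integrable_continuous_real]
    by (simp add: distr_of_fun_def)
qed

lemma distr_of_fun_distribution:
  assumes g: "continuous_on {0..2 * pi} (\<lambda>\<theta>. g (cis \<theta>))"
  shows "distr_of_fun g \<in> circle_distributions"
proof -
  have "distr_of_fun g = (\<lambda>\<psi>. if \<psi> \<in> circle_smooth
      then integral {0..2 * pi} (\<lambda>\<theta>. (g (cis \<theta>) / of_real (2 * pi)) * circle_deriv 0 \<psi> \<theta> + 0 * circle_deriv 0 \<psi> \<theta>) else 0)"
    using distr_of_fun_eq[OF g] by (auto simp: fun_eq_iff circle_deriv_0 distr_of_fun_def
        integral_divide[symmetric] simp del: integral_divide)
  then show ?thesis using integral_distribution[of "\<lambda>\<theta>. g (cis \<theta>) / of_real (2 * pi)" "\<lambda>_. 0" 0] g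
    by (simp add: continuous_on_divide)
qed

text \<open>Testing against the conjugate of the difference d gives a vanishing integral of |d|^2,
  and d is continuous. This makes \<open>distr_value\<close> well defined.\<close>

lemma distr_of_fun_inj:
  assumes g: "g \<in> circle_smooth" and h: "h \<in> circle_smooth" and eq: "distr_of_fun g = distr_of_fun h"
  shows "g (cis \<theta>) = h (cis \<theta>)"
proof -
  have gc: "continuous_on A (\<lambda>\<theta>. g (cis \<theta>))" and hc: "continuous_on A (\<lambda>\<theta>. h (cis \<theta>))" for A
    using circle_deriv_continuous[OF g, of A 0] circle_deriv_continuous[OF h, of A 0] by (simp_all add: circle_deriv_0)
  define d where "d \<zeta> = g \<zeta> + (-1) * h \<zeta>" for \<zeta>
  have d: "d \<in> circle_smooth" unfolding d_def[abs_def] by (intro circle_smooth_add circle_smooth_cmult g h)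
  have dc: "continuous_on A (\<lambda>\<theta>. d (cis \<theta>))" for A unfolding d_def using gc hc by (intro continuous_intros)
  note cd = circle_smooth_cnj[OF d]
  have "integral {0..2 * pi} (\<lambda>\<theta>. g (cis \<theta>) * cnj (d (cis \<theta>))) = integral {0..2 * pi} (\<lambda>\<theta>. h (cis \<theta>) * cnj (d (cis \<theta>)))"
    using fun_cong[OF eq, of "\<lambda>\<zeta>. cnj (d \<zeta>)"] unfolding distr_of_fun_eq[OF gc cd] distr_of_fun_eq[OF hc cd] by simp
  moreover have "(\<lambda>\<theta>. g (cis \<theta>) * cnj (d (cis \<theta>))) integrable_on {0..2 * pi}" "(\<lambda>\<theta>. h (cis \<theta>) * cnj (d (cis \<theta>))) integrable_on {0..2 * pi}"
    by (intro integrable_continuous_real continuous_intros gc hc dc)+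
  ultimately have "integral {0..2 * pi} (\<lambda>\<theta>. g (cis \<theta>) * cnj (d (cis \<theta>)) - h (cis \<theta>) * cnj (d (cis \<theta>))) = 0"
    by (simp add: integral_diff)
  moreover have "g \<zeta> * cnj (d \<zeta>) - h \<zeta> * cnj (d \<zeta>) = of_real ((cmod (d \<zeta>))\<^sup>2)" for \<zeta>
    unfolding complex_norm_square d_def by (simp add: algebra_simps)
  ultimately have "integral {0..2 * pi} (\<lambda>\<theta>. complex_of_real ((cmod (d (cis \<theta>)))\<^sup>2)) = 0" by simp
  moreover have "integral {0..2 * pi} (\<lambda>\<theta>. complex_of_real ((cmod (d (cis \<theta>)))\<^sup>2)) =
      of_real (integral {0..2 * pi} (\<lambda>\<theta>. (cmod (d (cis \<theta>)))\<^sup>2))"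
    using integral_linear[of "\<lambda>\<theta>. (cmod (d (cis \<theta>)))\<^sup>2" "{0..2*pi}" complex_of_real]
    by (simp add: o_def integrable_continuous_real continuous_intros dc bounded_linear_of_real)
  ultimately have 0: "integral {0..2 * pi} (\<lambda>\<theta>. (cmod (d (cis \<theta>)))\<^sup>2) = 0" by simp
  have "(cmod (d (cis t)))\<^sup>2 = 0" if "t \<in> {0..2 * pi}" for t
  proof (rule has_integral_0_cbox_imp_0[of 0 "2 * pi" "\<lambda>\<theta>. (cmod (d (cis \<theta>)))\<^sup>2" t])
    have i: "(\<lambda>\<theta>. (cmod (d (cis \<theta>)))\<^sup>2) integrable_on {0..2 * pi}"
      by (intro integrable_continuous_real continuous_intros dc)
    show "((\<lambda>\<theta>. (cmod (d (cis \<theta>)))\<^sup>2) has_integral 0) (cbox 0 (2 * pi))"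
      using integrable_integral[OF i] 0 by simp
    show "continuous_on (cbox 0 (2 * pi)) (\<lambda>\<theta>. (cmod (d (cis \<theta>)))\<^sup>2)"
      by (intro continuous_intros dc)
  qed (use that pi_gt_zero in \<open>auto simp del: pi_gt_zero\<close>)
  moreover obtain t where "t \<in> {0..2 * pi}" "d (cis \<theta>) = d (cis t)"
    using periodic_reduce[of "circle_deriv 0 d", OF circle_deriv_periodic[OF d], of \<theta>] by (auto simp: circle_deriv_0)
  ultimately show ?thesis by (simp add: d_def)
qed

lemma distr_value_of_fun:
  assumes g: "g \<in> circle_smooth" shows "distr_value (distr_of_fun g) (cis \<theta>) = g (cis \<theta>)"
  unfolding distr_value_def using assms distr_of_fun_inj by (intro the_equality) blast+

text \<open>The index set is general, with a frequency map \<kappa>, because the application sums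
  over pairs (j, l) with frequency j - l. Rapid decay of the coefficients allows termwise
  differentiation to every order.\<close>

lemma trig_series_smooth:
  fixes c :: "'i \<Rightarrow> complex" and \<kappa> :: "'i \<Rightarrow> int"
  assumes I: "countable (UNIV :: 'i set)" "infinite (UNIV :: 'i set)"
    and c: "\<And>N. (\<lambda>i. cmod (c i) * \<bar>real_of_int (\<kappa> i)\<bar> ^ N) summable_on UNIV"
    and g: "\<And>\<theta>. g (cis \<theta>) = (\<Sum>\<^sub>\<infinity>i. c i * cis (of_int (\<kappa> i) * \<theta>))"
  shows "g \<in> circle_smooth"
proof (rule circle_smoothI)
  let ?D = "\<lambda>N \<theta>. \<Sum>\<^sub>\<infinity>i. c i * (\<i> * of_int (\<kappa> i)) ^ N * cis (of_int (\<kappa> i) * \<theta>)"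
  show "?D 0 = (\<lambda>\<theta>. g (cis \<theta>))" by (simp add: g)
  show "(?D N has_vector_derivative ?D (Suc N) \<theta>) (at \<theta>)" for N \<theta>
  proof -
    have n: "cmod (c i * (\<i> * of_int (\<kappa> i)) ^ N * cis (of_int (\<kappa> i) * t)) = cmod (c i) * \<bar>real_of_int (\<kappa> i)\<bar> ^ N" for i t N
      by (simp add: norm_mult norm_power)
    have s: "(\<lambda>i. c i * (\<i> * of_int (\<kappa> i)) ^ N * cis (of_int (\<kappa> i) * t)) summable_on UNIV" for t N
      by (rule abs_summable_summable) (simp only: n c)
    have "(?D N has_derivative (\<lambda>h. \<Sum>\<^sub>\<infinity>i. h *\<^sub>R (c i * (\<i> * of_int (\<kappa> i)) ^ N * (\<i> * of_int (\<kappa> i)) * cis (of_int (\<kappa> i) * \<theta>)))) (at \<theta> within UNIV)"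
    proof (rule has_derivative_infsum[OF I, where M = "\<lambda>i. cmod (c i) * \<bar>real_of_int (\<kappa> i)\<bar> ^ Suc N"])
      show "((\<lambda>\<theta>. c i * (\<i> * of_int (\<kappa> i)) ^ N * cis (of_int (\<kappa> i) * \<theta>)) has_derivative
         (\<lambda>h. h *\<^sub>R (c i * (\<i> * of_int (\<kappa> i)) ^ N * (\<i> * of_int (\<kappa> i)) * cis (of_int (\<kappa> i) * y)))) (at y within UNIV)" for i y
        using has_vector_derivative_cis_mult unfolding has_vector_derivative_def by blast
      show "cmod (h *\<^sub>R (c i * (\<i> * of_int (\<kappa> i)) ^ N * (\<i> * of_int (\<kappa> i)) * cis (of_int (\<kappa> i) * y)))
          \<le> cmod (c i) * \<bar>real_of_int (\<kappa> i)\<bar> ^ Suc N * norm h" for i y h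
        by (simp add: norm_mult norm_power mult_ac)
      show "(\<lambda>i. cmod (c i) * \<bar>real_of_int (\<kappa> i)\<bar> ^ Suc N) summable_on UNIV" by (rule c)
    qed (use s in auto)
    moreover have "(\<Sum>\<^sub>\<infinity>i. h *\<^sub>R (c i * (\<i> * of_int (\<kappa> i)) ^ N * (\<i> * of_int (\<kappa> i)) * cis (of_int (\<kappa> i) * \<theta>))) = h *\<^sub>R ?D (Suc N) \<theta>" for h
      by (subst infsum_scaleR_right[symmetric]) (simp add: mult_ac)
    ultimately show ?thesis by (simp add: has_vector_derivative_def)
  qed
qed

lemma integral_cis:
  "((\<lambda>\<theta>. cis (of_int k * \<theta>)) has_integral (if k = 0 then of_real (2 * pi) else 0)) {0..2 * pi}"
proof (cases "k = 0")
  case True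
  have "0 \<le> 2 * pi" using pi_gt_zero by linarith
  then have "((\<lambda>\<theta>::real. 1::complex) has_integral of_real (2 * pi)) {0..2 * pi}"
    using has_integral_const_real[of "1::complex" 0 "2 * pi"] unfolding of_real_def by (simp only: content_real diff_zero)
  moreover have "(\<lambda>\<theta>. cis (of_int k * \<theta>)) = (\<lambda>_. 1)"
    unfolding True by (simp only: of_int_0 mult_zero_left cis_zero)
  ultimately show ?thesis using True by (simp only: simp_thms if_True)
next
  case False
  have e: "1 / (\<i> * of_int k) * (\<i> * of_int k) = (1::complex)" using False by simp
  have "((\<lambda>\<theta>. cis (of_int k * \<theta>)) has_integral
      (1 / (\<i> * of_int k)) * cis (of_int k * (2 * pi)) - (1 / (\<i> * of_int k)) * cis (of_int k * 0)) {0..2 * pi}"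
  proof (rule fundamental_theorem_of_calculus)
    show "((\<lambda>t. (1 / (\<i> * of_int k)) * cis (of_int k * t)) has_vector_derivative cis (of_int k * \<theta>)) (at \<theta> within {0..2 * pi})" for \<theta>
      by (rule has_vector_derivative_at_within)
         (rule has_vector_derivative_cis_mult[of "1 / (\<i> * of_int k)" k \<theta>, unfolded e mult_1_left])
  qed simp
  moreover have "cis (of_int k * (2 * pi)) = 1"
    using cis_multiple_2pi[of "of_int k"] by (simp only: mult.commute Ints_of_int)
  ultimately show ?thesis using False by simp
qed

text \<open>The Weierstrass test gives uniform convergence, hence continuity and exchange of sum and
  integral. As \<kappa> may take a value repeatedly, orthogonality collects the whole fibre over
  k.\<close>

lemma trig_series_integral:
  fixes c :: "'i \<Rightarrow> complex" and \<kappa> :: "'i \<Rightarrow> int"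
  assumes c: "(\<lambda>i. cmod (c i)) summable_on UNIV"
  shows "continuous_on A (\<lambda>\<theta>. \<Sum>\<^sub>\<infinity>i. c i * cis (of_int (\<kappa> i) * \<theta>))"
    "integral {0..2 * pi} (\<lambda>\<theta>. (\<Sum>\<^sub>\<infinity>i. c i * cis (of_int (\<kappa> i) * \<theta>)) * cis (- (of_int k * \<theta>))) =
      of_real (2 * pi) * (\<Sum>\<^sub>\<infinity>i\<in>\<kappa> -` {k}. c i)"
proof -
  have ul: "uniform_limit B (\<lambda>X \<theta>. \<Sum>i\<in>X. c i * cis (of_int (\<mu> i) * \<theta>)) (\<lambda>\<theta>. \<Sum>\<^sub>\<infinity>i. c i * cis (of_int (\<mu> i) * \<theta>))
      (finite_subsets_at_top UNIV)" for B and \<mu> :: "'i \<Rightarrow> int"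
    by (rule Weierstrass_m_test_general[OF _ c]) (simp add: norm_mult)
  have ct: "continuous_on B (\<lambda>\<theta>. \<Sum>i\<in>X. c i * cis (of_int (\<mu> i) * \<theta>))" for B X and \<mu> :: "'i \<Rightarrow> int"
    by (intro continuous_intros)
  show "continuous_on A (\<lambda>\<theta>. \<Sum>\<^sub>\<infinity>i. c i * cis (of_int (\<kappa> i) * \<theta>))"
    by (rule uniform_limit_theorem[OF _ ul]) (auto intro!: ct always_eventually)
  have prod: "(\<Sum>\<^sub>\<infinity>i. c i * cis (of_int (\<kappa> i) * \<theta>)) * cis (- (of_int k * \<theta>)) = (\<Sum>\<^sub>\<infinity>i. c i * cis (of_int (\<kappa> i - k) * \<theta>))" for \<theta>
    by (subst infsum_cmult_left'[symmetric]) (simp add: cis_mult mult.assoc left_diff_distrib)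
  obtain I J where IJ: "\<And>X. ((\<lambda>\<theta>. \<Sum>i\<in>X. c i * cis (of_int (\<kappa> i - k) * \<theta>)) has_integral I X) {0..2 * pi}"
      "((\<lambda>\<theta>. \<Sum>\<^sub>\<infinity>i. c i * cis (of_int (\<kappa> i - k) * \<theta>)) has_integral J) {0..2 * pi}"
      "(I \<longlongrightarrow> J) (finite_subsets_at_top UNIV)"
    by (rule uniform_limit_integral[OF ul[of "\<lambda>i. \<kappa> i - k" "{0..2 * pi}"] ct finite_subsets_at_top_neq_bot]) blast
  have "I X = (\<Sum>i\<in>X. c i * (if \<kappa> i = k then of_real (2 * pi) else 0))" if "finite X" for X
  proof -
    have "((\<lambda>\<theta>. \<Sum>i\<in>X. c i * cis (of_int (\<kappa> i - k) * \<theta>)) has_integral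
        (\<Sum>i\<in>X. c i * (if \<kappa> i - k = 0 then of_real (2 * pi) else 0))) {0..2 * pi}"
      by (intro has_integral_sum has_integral_mult_right integral_cis that)
    from has_integral_unique[OF IJ(1)[of X] this] show ?thesis by simp
  qed
  then have "\<forall>\<^sub>F X in finite_subsets_at_top UNIV. I X = (\<Sum>i\<in>X. c i * (if \<kappa> i = k then of_real (2 * pi) else 0))"
    by (simp add: eventually_finite_subsets_at_top_weakI)
  \<comment> \<open>The integrals of the finite partial sums converge along the very filter that
    defines \<open>has_sum\<close>, so their limit is the sum.\<close>
  with IJ(3) have "((\<lambda>i. c i * (if \<kappa> i = k then of_real (2 * pi) else 0)) has_sum J) UNIV"
    unfolding has_sum_def by (rule Lim_transform_eventually)
  then have "J = (\<Sum>\<^sub>\<infinity>i. c i * (if \<kappa> i = k then of_real (2 * pi) else 0))" by (simp add: infsumI)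
  also have "\<dots> = (\<Sum>\<^sub>\<infinity>i\<in>\<kappa> -` {k}. c i * of_real (2 * pi))"
    by (rule infsum_cong_neutral) auto
  also have "\<dots> = of_real (2 * pi) * (\<Sum>\<^sub>\<infinity>i\<in>\<kappa> -` {k}. c i)" by (subst infsum_cmult_left') (simp add: mult.commute)
  finally have "J = of_real (2 * pi) * (\<Sum>\<^sub>\<infinity>i\<in>\<kappa> -` {k}. c i)" .
  then show "integral {0..2 * pi} (\<lambda>\<theta>. (\<Sum>\<^sub>\<infinity>i. c i * cis (of_int (\<kappa> i) * \<theta>)) * cis (- (of_int k * \<theta>))) =
      of_real (2 * pi) * (\<Sum>\<^sub>\<infinity>i\<in>\<kappa> -` {k}. c i)"
    unfolding prod using integral_unique[OF IJ(2)] by simp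
qed

lemma fourier_coeff_trig_series:
  fixes c :: "'i \<Rightarrow> complex" and \<kappa> :: "'i \<Rightarrow> int"
  assumes c: "(\<lambda>i. cmod (c i)) summable_on UNIV"
    and g: "\<And>\<theta>. g (cis \<theta>) = (\<Sum>\<^sub>\<infinity>i. c i * cis (of_int (\<kappa> i) * \<theta>))"
  shows "distr_of_fun g \<in> circle_distributions"
    "fourier_coeff (distr_of_fun g) k = (\<Sum>\<^sub>\<infinity>i\<in>\<kappa> -` {k}. c i)"
proof -
  have ct: "continuous_on {0..2 * pi} (\<lambda>\<theta>. g (cis \<theta>))"
    unfolding g using trig_series_integral(1)[OF c] .
  then show "distr_of_fun g \<in> circle_distributions" by (rule distr_of_fun_distribution)
  show "fourier_coeff (distr_of_fun g) k = (\<Sum>\<^sub>\<infinity>i\<in>\<kappa> -` {k}. c i)"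
    unfolding fourier_coeff_def distr_of_fun_eq[OF ct circle_smooth_monomial(1)] cis_power_int g
    using trig_series_integral(2)[OF c, of \<kappa> k] by simp
qed

section \<open>Density of trigonometric polynomials\<close>

text \<open>On the circle \<open>cnj \<zeta>\<close> is the inverse of \<zeta>, so a real polynomial
  becomes a Laurent polynomial in \<zeta>, and a power of \<zeta> clears the denominators.\<close>

lemma real_polynomial_on_circle:
  assumes "real_polynomial_function (p :: complex \<Rightarrow> real)"
  shows "\<exists>q n. \<forall>\<zeta>. cmod \<zeta> = 1 \<longrightarrow> of_real (p \<zeta>) * \<zeta> ^ n = poly q \<zeta>"
  using assms
proof (induction rule: real_polynomial_function.induct)
  case (linear f)
  then have lin: "linear f" by (rule bounded_linear.linear)
  \<comment> \<open>A real linear f is a combination of \<zeta> and \<open>cnj \<zeta>\<close>;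
    after multiplication by \<zeta> these become the terms of degree 2 and 0.\<close>
  let ?q = "[:(of_real (f 1) + \<i> * of_real (f \<i>)) / 2, 0, (of_real (f 1) - \<i> * of_real (f \<i>)) / 2:]"
  have "of_real (f \<zeta>) * \<zeta> ^ 1 = poly ?q \<zeta>" if "cmod \<zeta> = 1" for \<zeta>
  proof -
    have "\<zeta> = Re \<zeta> *\<^sub>R 1 + Im \<zeta> *\<^sub>R \<i>" by (simp add: complex_eq_iff)
    then have f: "f \<zeta> = Re \<zeta> * f 1 + Im \<zeta> * f \<i>"
      using linear_add[OF lin] linear_scale[OF lin] by (metis real_scaleR_def)
    have "(Re \<zeta>)\<^sup>2 + (Im \<zeta>)\<^sup>2 = 1" using that by (simp add: cmod_def)
    then show ?thesis
      by (simp add: f complex_eq_iff power2_eq_square field_simps) algebra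
  qed
  then show ?case by blast
next
  case (const c)
  have "of_real c * \<zeta> ^ 0 = poly [:of_real c:] \<zeta>" for \<zeta> :: complex by simp
  then show ?case by blast
next
  case (add f g)
  then obtain q n q' n' where
    q: "\<And>\<zeta>. cmod \<zeta> = 1 \<Longrightarrow> of_real (f \<zeta>) * \<zeta> ^ n = poly q \<zeta>"
    "\<And>\<zeta>. cmod \<zeta> = 1 \<Longrightarrow> of_real (g \<zeta>) * \<zeta> ^ n' = poly q' \<zeta>" by blast
  have "of_real (f \<zeta> + g \<zeta>) * \<zeta> ^ (n + n') = poly (q * monom 1 n' + q' * monom 1 n) \<zeta>" if "cmod \<zeta> = 1" for \<zeta>
    by (simp add: q[OF that, symmetric] poly_monom power_add algebra_simps)
  then show ?case by blast
next
  case (mult f g)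
  then obtain q n q' n' where
    q: "\<And>\<zeta>. cmod \<zeta> = 1 \<Longrightarrow> of_real (f \<zeta>) * \<zeta> ^ n = poly q \<zeta>"
    "\<And>\<zeta>. cmod \<zeta> = 1 \<Longrightarrow> of_real (g \<zeta>) * \<zeta> ^ n' = poly q' \<zeta>" by blast
  have "of_real (f \<zeta> * g \<zeta>) * \<zeta> ^ (n + n') = poly (q * q') \<zeta>" if "cmod \<zeta> = 1" for \<zeta>
    by (simp add: q[OF that, symmetric] power_add)
  then show ?case by blast
qed

lemma periodic_cis_cong:
  fixes F :: "real \<Rightarrow> 'a"
  assumes "\<And>\<theta>. F (\<theta> + 2 * pi) = F \<theta>" and "cis s = cis t"
  shows "F s = F t"
proof -
  interpret periodic_fun_simple F "2 * pi" by standard (rule assms)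
  have "sin s = sin t \<and> cos s = cos t" using assms(2) by (simp add: complex_eq_iff)
  then obtain n where n: "s = t + 2 * pi * of_int n" using sin_cos_eq_iff[of s t] by (auto elim!: Ints_cases)
  show ?thesis unfolding n using plus_of_int[of t n] by (simp add: mult.commute)
qed

text \<open>Stone-Weierstrass on the unit circle, applied to the function that G induces
  there.\<close>

lemma continuous_trig_approx:
  fixes G :: "real \<Rightarrow> complex"
  assumes per: "\<And>\<theta>. G (\<theta> + 2 * pi) = G \<theta>" and ct: "continuous_on UNIV G" and e: "\<epsilon> > 0"
  shows "\<exists>A c. finite A \<and> (\<forall>\<theta>. cmod (G \<theta> - (\<Sum>k\<in>A. c k * cis (of_int k * \<theta>))) \<le> \<epsilon>)"
proof -
  define g where "g \<zeta> = G (Arg \<zeta>)" for \<zeta>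
  have g: "g (cis \<theta>) = G \<theta>" for \<theta>
    unfolding g_def by (rule periodic_cis_cong[of G, OF per]) (simp add: cis_Arg sgn_div_norm)
  have "continuous_on (sphere 0 1) g" unfolding continuous_on_eq_continuous_within
  proof
    fix \<zeta>0 :: complex assume z0: "\<zeta>0 \<in> sphere 0 1"
    then have nz: "\<zeta>0 \<noteq> 0" by auto
    \<comment> \<open>\<open>Arg\<close> jumps on the negative axis. Rotating by \<zeta>0 moves the
      point to 1, where \<open>Arg\<close> is continuous, and changes the angle only by a multiple
      of 2 pi.\<close>
    have "continuous (at \<zeta>0 within sphere 0 1) (\<lambda>\<zeta>. G (Arg (\<zeta> / \<zeta>0) + Arg \<zeta>0))"
    proof (rule continuous_within_compose3[where g = G])
      show "isCont G (Arg (\<zeta>0 / \<zeta>0) + Arg \<zeta>0)" using ct by (simp add: continuous_on_eq_continuous_at)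
      have "continuous (at \<zeta>0 within sphere 0 1) (\<lambda>\<zeta>. Arg (\<zeta> / \<zeta>0))"
      proof (rule continuous_within_compose3[where g = Arg])
        show "isCont Arg (\<zeta>0 / \<zeta>0)" using nz by (intro continuous_at_Arg) simp
        show "continuous (at \<zeta>0 within sphere 0 1) (\<lambda>\<zeta>. \<zeta> / \<zeta>0)"
          using nz by (intro continuous_intros)
      qed
      then show "continuous (at \<zeta>0 within sphere 0 1) (\<lambda>\<zeta>. Arg (\<zeta> / \<zeta>0) + Arg \<zeta>0)"
        by (intro continuous_intros)
    qed
    moreover have "G (Arg (\<zeta> / \<zeta>0) + Arg \<zeta>0) = g \<zeta>" if "\<zeta> \<in> sphere 0 1" for \<zeta>
      unfolding g_def
    proof (rule periodic_cis_cong[of G, OF per])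
      have "\<zeta> \<noteq> 0" using that by auto
      then show "cis (Arg (\<zeta> / \<zeta>0) + Arg \<zeta>0) = cis (Arg \<zeta>)"
        unfolding cis_mult[symmetric] using nz that z0 by (simp add: cis_Arg sgn_div_norm norm_divide)
    qed
    ultimately show "continuous (at \<zeta>0 within sphere 0 1) g"
      using continuous_transform_within[of _ _ _ 1, OF _ zero_less_one z0] by blast
  qed
  from Stone_Weierstrass_polynomial_function[OF compact_sphere this e]
  obtain p where p: "polynomial_function p" "\<And>\<zeta>. \<zeta> \<in> sphere 0 1 \<Longrightarrow> cmod (g \<zeta> - p \<zeta>) < \<epsilon>" by blast
  have "real_polynomial_function (Re \<circ> p)" "real_polynomial_function (Im \<circ> p)"
    using p(1) bounded_linear_Re bounded_linear_Im unfolding polynomial_function_def by blast+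
  from this[THEN real_polynomial_on_circle] obtain q n q' n' where
    q: "\<And>\<zeta>. cmod \<zeta> = 1 \<Longrightarrow> of_real (Re (p \<zeta>)) * \<zeta> ^ n = poly q \<zeta>"
    "\<And>\<zeta>. cmod \<zeta> = 1 \<Longrightarrow> of_real (Im (p \<zeta>)) * \<zeta> ^ n' = poly q' \<zeta>" by auto
  define Q where "Q = q * monom 1 n' + [:\<i>:] * (q' * monom 1 n)"
  have Q: "p \<zeta> * \<zeta> ^ (n + n') = poly Q \<zeta>" if "cmod \<zeta> = 1" for \<zeta>
  proof -
    have "p \<zeta> * \<zeta> ^ (n + n') = (of_real (Re (p \<zeta>)) + \<i> * of_real (Im (p \<zeta>))) * \<zeta> ^ (n + n')"
      by (simp only: complex_eq[symmetric])
    also have "\<dots> = poly Q \<zeta>"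
      by (simp add: Q_def q[OF that, symmetric] poly_monom power_add algebra_simps)
    finally show ?thesis .
  qed
  \<comment> \<open>Undoing the multiplication by \<zeta>^(n + n') shifts all exponents down by n +
    n'.\<close>
  define A where "A = (\<lambda>i. int i - int (n + n')) ` {..degree Q}"
  have "p (cis \<theta>) = (\<Sum>k\<in>A. coeff Q (nat (k + int (n + n'))) * cis (of_int k * \<theta>))" for \<theta>
  proof -
    have "p (cis \<theta>) = poly Q (cis \<theta>) * cis (- (real (n + n') * \<theta>))"
      using Q[of "cis \<theta>", symmetric] by (simp only: norm_cis Complex.DeMoivre mult.assoc cis_mult) simp
    also have "\<dots> = (\<Sum>i\<le>degree Q. coeff Q i * cis (of_int (int i - int (n + n')) * \<theta>))"
      unfolding poly_altdef sum_distrib_right Complex.DeMoivre mult.assoc cis_mult by (simp add: algebra_simps)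
    also have "\<dots> = (\<Sum>k\<in>A. coeff Q (nat (k + int (n + n'))) * cis (of_int k * \<theta>))"
      unfolding A_def by (subst sum.reindex) (auto simp: inj_on_def)
    finally show ?thesis .
  qed
  then have "cmod (G \<theta> - (\<Sum>k\<in>A. coeff Q (nat (k + int (n + n'))) * cis (of_int k * \<theta>))) \<le> \<epsilon>" for \<theta>
    using p(2)[of "cis \<theta>"] by (simp add: g less_imp_le)
  moreover have "finite A" by (simp add: A_def)
  ultimately show ?thesis by (intro exI[of _ A] exI[of _ "\<lambda>k. coeff Q (nat (k + int (n + n')))"]) simp
qed

text \<open>The parameter j is the order of differentiation, so the derivatives of one trigonometric
  polynomial form a chain as in \<open>circle_smoothI\<close>.\<close>

definition trig_poly :: "int set \<Rightarrow> (int \<Rightarrow> complex) \<Rightarrow> nat \<Rightarrow> real \<Rightarrow> complex" where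
  "trig_poly A c j \<theta> = (\<Sum>k\<in>A. c k * (\<i> * of_int k) ^ j * cis (of_int k * \<theta>))"

lemma trig_poly_deriv: "(trig_poly A c j has_vector_derivative trig_poly A c (Suc j) \<theta>) (at \<theta>)"
proof -
  have "((\<lambda>\<theta>. c k * (\<i> * of_int k) ^ j * cis (of_int k * \<theta>)) has_vector_derivative
     c k * (\<i> * of_int k) ^ Suc j * cis (of_int k * \<theta>)) (at \<theta>)" for k
    using has_vector_derivative_cis_mult[of "c k * (\<i> * of_int k) ^ j" k \<theta>]
    by (simp only: power_Suc2 mult.assoc)
  then show ?thesis unfolding trig_poly_def[abs_def] by (rule has_vector_derivative_sum)
qed

lemma trig_poly_periodic: "trig_poly A c j (\<theta> + 2 * pi) = trig_poly A c j \<theta>"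
proof -
  have "cis (of_int k * (\<theta> + 2 * pi)) = cis (of_int k * \<theta>)" for k
    using cis_multiple_2pi[of "of_int k"] by (simp add: distrib_left cis_mult[symmetric] mult.commute)
  then show ?thesis by (simp only: trig_poly_def)
qed

text \<open>Simultaneous approximation of the first derivatives: approximate the last one and
  integrate, after removing the constant term, which is small as the mean of a derivative
  vanishes.\<close>

lemma trig_poly_approx:
  fixes F :: "nat \<Rightarrow> real \<Rightarrow> complex"
  assumes "\<And>j \<theta>. (F j has_vector_derivative F (Suc j) \<theta>) (at \<theta>)"
    and "\<And>j \<theta>. F j (\<theta> + 2 * pi) = F j \<theta>" and "\<epsilon> > 0"
  shows "\<exists>A c. finite A \<and> (\<forall>j\<le>N. \<forall>\<theta>. cmod (F j \<theta> - trig_poly A c j \<theta>) \<le> \<epsilon>)"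
  using assms
proof (induction N arbitrary: F \<epsilon>)
  case 0
  have "continuous_on UNIV (F 0)"
    using has_vector_derivative_continuous[OF 0(1)] continuous_at_imp_continuous_on by blast
  from continuous_trig_approx[OF 0(2) this 0(3)] show ?case by (simp add: trig_poly_def)
next
  case (Suc N)
  \<comment> \<open>Orders from 1 on are approximated within 2 \<delta>: one \<delta> from the
    induction hypothesis, one from the removed constant term. Integration over a length of at most 2
    pi turns this into 4 pi \<delta> for order 0.\<close>
  define \<delta> where "\<delta> = \<epsilon> / (4 * pi + 2)"
  have "4 * pi + 2 > 0" using pi_gt_zero by linarith
  then have "\<epsilon> = (4 * pi + 2) * \<delta>" by (simp add: \<delta>_def)
  then have "\<epsilon> = 4 * pi * \<delta> + 2 * \<delta>" by (simp only: distrib_right)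
  moreover have "\<delta> > 0" using Suc.prems(3) \<open>4 * pi + 2 > 0\<close> by (simp add: \<delta>_def)
  ultimately have \<delta>: "\<delta> > 0" "\<epsilon> = 4 * pi * \<delta> + 2 * \<delta>" by blast+
  obtain A c where A: "finite A" "\<And>j \<theta>. j \<le> N \<Longrightarrow> cmod (F (Suc j) \<theta> - trig_poly A c j \<theta>) \<le> \<delta>"
    using Suc.IH[of "\<lambda>j. F (Suc j)" \<delta>] Suc.prems(1,2) \<delta>(1) by blast
  define e where "e = (if 0 \<in> A then c 0 else 0)"
  \<comment> \<open>Coefficients of the antiderivative; the one at frequency 0 is the constant of
    integration, chosen so that the approximant agrees with \<open>F 0\<close> at the point
    0.\<close>
  define c' where "c' k = (if k = 0 then F 0 0 - (\<Sum>k\<in>A - {0}. c k / (\<i> * of_int k)) else c k / (\<i> * of_int k))" for k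
  define A' where "A' = insert 0 A"
  have Ad: "(\<Sum>k\<in>A. f k) = (if 0 \<in> A then f 0 else 0) + (\<Sum>k\<in>A - {0}. f k)" for f :: "int \<Rightarrow> complex"
    using A(1) by (auto simp: sum.remove)
  have Ad': "(\<Sum>k\<in>A'. f k) = f 0 + (\<Sum>k\<in>A - {0}. f k)" for f :: "int \<Rightarrow> complex"
    using A(1) by (simp add: A'_def sum.insert_remove)
  \<comment> \<open>The factor \<open>0 ^ j\<close> is 1 for j = 0 and 0 otherwise: dropping the
    constant term affects the first derivative only.\<close>
  have T: "trig_poly A' c' (Suc j) \<theta> = trig_poly A c j \<theta> - e * 0 ^ j" for j \<theta>
  proof -
    have "trig_poly A' c' (Suc j) \<theta> = (\<Sum>k\<in>A - {0}. c k * (\<i> * of_int k) ^ j * cis (of_int k * \<theta>))"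
      unfolding trig_poly_def Ad' by (simp, intro sum.cong) (auto simp: c'_def)
    also have "\<dots> = trig_poly A c j \<theta> - e * 0 ^ j" unfolding trig_poly_def Ad e_def by simp
    finally show ?thesis .
  qed
  have T0: "trig_poly A' c' 0 0 = F 0 0"
  proof -
    have "(\<Sum>k\<in>A - {0}. c' k) = (\<Sum>k\<in>A - {0}. c k / (\<i> * of_int k))"
      by (intro sum.cong) (auto simp: c'_def)
    then show ?thesis unfolding trig_poly_def Ad' by (simp add: c'_def)
  qed
  have p0: "0 \<le> 2 * pi" using pi_gt_zero by linarith
  have e: "cmod e \<le> \<delta>"
  proof -
    have i1: "(F 1 has_integral F 0 (2 * pi) - F 0 0) {0..2 * pi}"
      using Suc.prems(1)[of 0] by (intro fundamental_theorem_of_calculus p0) (simp add: has_vector_derivative_at_within)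
    have "(trig_poly A c 0 has_integral (\<Sum>k\<in>A. c k * (if k = 0 then of_real (2 * pi) else 0))) {0..2 * pi}"
      unfolding trig_poly_def[abs_def] power_0 mult_1_right
      by (intro has_integral_sum has_integral_mult_right integral_cis A(1))
    moreover have "(\<Sum>k\<in>A. c k * (if k = 0 then of_real (2 * pi) else 0)) = e * of_real (2 * pi)"
      unfolding Ad e_def by simp
    moreover have "F 0 (2 * pi) - F 0 0 = 0" using Suc.prems(2)[of 0 0] by simp
    ultimately have "((\<lambda>\<theta>. F 1 \<theta> - trig_poly A c 0 \<theta>) has_integral - (e * of_real (2 * pi))) {0..2 * pi}"
      using has_integral_diff[OF i1] by fastforce
    from has_integral_bound[of \<delta> _ _ 0 "2 * pi", unfolded box_real, OF _ this]
    have "cmod e * (2 * pi) \<le> \<delta> * (2 * pi)"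
      using A(2)[of 0] \<delta>(1) content_real[OF p0] by (simp add: norm_mult)
    then show ?thesis using pi_gt_zero by (simp del: pi_gt_zero)
  qed
  have S: "cmod (F (Suc j) \<theta> - trig_poly A' c' (Suc j) \<theta>) \<le> 2 * \<delta>" if "j \<le> N" for j \<theta>
  proof -
    have "cmod (F (Suc j) \<theta> - trig_poly A' c' (Suc j) \<theta>) = cmod ((F (Suc j) \<theta> - trig_poly A c j \<theta>) + e * 0 ^ j)"
      unfolding T by (simp add: algebra_simps)
    also have "\<dots> \<le> \<delta> + cmod (e * 0 ^ j)"
      using A(2)[OF that, of \<theta>] by (intro order_trans[OF norm_triangle_ineq] add_right_mono)
    also have "cmod (e * 0 ^ j) \<le> \<delta>" using e \<delta>(1) by (cases j) auto
    finally show ?thesis by simp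
  qed
  have Z: "cmod (F 0 \<theta> - trig_poly A' c' 0 \<theta>) \<le> 4 * pi * \<delta>" for \<theta>
  proof -
    define D where "D \<theta> = F 0 \<theta> - trig_poly A' c' 0 \<theta>" for \<theta>
    obtain t where t: "t \<in> {0..2 * pi}" "D \<theta> = D t"
      using periodic_reduce[of D \<theta>] Suc.prems(2)[of 0] trig_poly_periodic unfolding D_def by auto
    have "((\<lambda>\<theta>. F 1 \<theta> - trig_poly A' c' 1 \<theta>) has_integral D t - D 0) {0..t}"
    proof (rule fundamental_theorem_of_calculus)
      show "(D has_vector_derivative F 1 x - trig_poly A' c' 1 x) (at x within {0..t})" for x
        using has_vector_derivative_diff[OF Suc.prems(1)[of 0 x] trig_poly_deriv[of A' c' 0 x]]
        unfolding D_def[abs_def] One_nat_def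
        by (rule has_vector_derivative_at_within)
    qed (use t in auto)
    from has_integral_bound[of "2 * \<delta>" _ _ 0 t, unfolded box_real, OF _ this]
    have "cmod (D t - D 0) \<le> 2 * \<delta> * t" using S[of 0] \<delta>(1) t(1) by simp
    also have "\<dots> \<le> 2 * \<delta> * (2 * pi)" using t(1) \<delta>(1) by (intro mult_left_mono) auto
    finally have "cmod (D \<theta>) \<le> 4 * pi * \<delta>" using t(2) T0 by (simp add: D_def mult_ac)
    then show ?thesis by (simp add: D_def)
  qed
  have "cmod (F j \<theta> - trig_poly A' c' j \<theta>) \<le> \<epsilon>" if "j \<le> Suc N" for j \<theta>
  proof (cases j)
    case 0
    then show ?thesis using Z[of \<theta>] \<delta> by simp
  next
    case (Suc i)
    moreover have "0 \<le> 4 * pi * \<delta>" using \<delta>(1) pi_gt_zero by (intro mult_nonneg_nonneg) linarith+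
    ultimately show ?thesis using S[of i \<theta>] \<delta>(2) that by simp
  qed
  moreover have "finite A'" using A(1) by (simp add: A'_def)
  ultimately show ?case by (intro exI[of _ A'] exI[of _ c']) simp
qed

lemma distribution_trig_poly:
  assumes "finite A"
  shows "(\<lambda>\<zeta>. \<Sum>k\<in>A. c k * \<zeta> powi k) \<in> circle_smooth"
    "circle_deriv j (\<lambda>\<zeta>. \<Sum>k\<in>A. c k * \<zeta> powi k) = trig_poly A c j"
    "h \<in> circle_distributions \<Longrightarrow> h (\<lambda>\<zeta>. \<Sum>k\<in>A. c k * \<zeta> powi k) = (\<Sum>k\<in>A. c k * fourier_coeff h (- k))"
proof -
  have "trig_poly A c 0 = (\<lambda>\<theta>. \<Sum>k\<in>A. c k * cis \<theta> powi k)"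
    by (simp add: trig_poly_def fun_eq_iff cis_power_int)
  from circle_smoothI[of "trig_poly A c" "\<lambda>\<zeta>. \<Sum>k\<in>A. c k * \<zeta> powi k", OF this trig_poly_deriv]
  show "(\<lambda>\<zeta>. \<Sum>k\<in>A. c k * \<zeta> powi k) \<in> circle_smooth"
    "circle_deriv j (\<lambda>\<zeta>. \<Sum>k\<in>A. c k * \<zeta> powi k) = trig_poly A c j" by blast+
  assume h: "h \<in> circle_distributions"
  have "(\<lambda>\<zeta>. \<Sum>k\<in>A. c k * \<zeta> powi k) \<in> circle_smooth \<and>
      h (\<lambda>\<zeta>. \<Sum>k\<in>A. c k * \<zeta> powi k) = (\<Sum>k\<in>A. c k * fourier_coeff h (- k))"
    using assms
  proof (induction A)
    case empty
    show ?case
      using circle_smooth_cmult(1)[OF circle_smooth_monomial(1), of 0 0]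
        circle_distributionsD(2)[OF h circle_smooth_monomial(1), of 0 0] by simp
  next
    case (insert k A)
    note m = circle_smooth_monomial(1)[of k]
    show ?case
      using insert circle_smooth_add(1)[OF circle_smooth_cmult(1)[OF m, of "c k"]]
        circle_distributionsD(1)[OF h circle_smooth_cmult(1)[OF m, of "c k"]]
        circle_distributionsD(2)[OF h m, of "c k"]
      by (simp add: fourier_coeff_def)
  qed
  then show "h (\<lambda>\<zeta>. \<Sum>k\<in>A. c k * \<zeta> powi k) = (\<Sum>k\<in>A. c k * fourier_coeff h (- k))" ..
qed

text \<open>Both functionals agree on trigonometric polynomials, and these approximate a test
  function in all the finitely many seminorms that control the two. This is the uniqueness behind
  \<open>circle_convolution\<close>.\<close>

lemma distribution_eqI:
  assumes f: "f \<in> circle_distributions" and h: "h \<in> circle_distributions"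
    and eq: "\<And>k. fourier_coeff f k = fourier_coeff h k"
  shows "f = h"
proof
  fix \<psi>
  show "f \<psi> = h \<psi>"
  proof (cases "\<psi> \<in> circle_smooth")
    case False
    then show ?thesis using circle_distributionsD(4) f h by metis
  next
    case \<psi>: True
    obtain C N where C: "C \<ge> 0" "\<And>\<psi>. \<psi> \<in> circle_smooth \<Longrightarrow> cmod (f \<psi>) \<le> C * (\<Sum>k\<le>N. SUP \<theta>. cmod (circle_deriv k \<psi> \<theta>))"
      using circle_distributionsD(3)[OF f] by blast
    obtain C' N' where C': "C' \<ge> 0" "\<And>\<psi>. \<psi> \<in> circle_smooth \<Longrightarrow> cmod (h \<psi>) \<le> C' * (\<Sum>k\<le>N'. SUP \<theta>. cmod (circle_deriv k \<psi> \<theta>))"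
      using circle_distributionsD(3)[OF h] by blast
    have "cmod (f \<psi> - h \<psi>) \<le> \<epsilon>" if \<epsilon>: "\<epsilon> > 0" for \<epsilon>
    proof -
      \<comment> \<open>Each continuity estimate adds up \<open>Suc N\<close> or
        \<open>Suc N'\<close> seminorms of size at most \<delta>; the summand 1 keeps
        \<open>K\<close> positive.\<close>
      define K where "K = C * real (Suc N) + C' * real (Suc N') + 1"
      have K: "K > 0" using C(1) C'(1) by (simp add: K_def add_nonneg_pos)
      define \<delta> where "\<delta> = \<epsilon> / K"
      have \<delta>: "\<delta> > 0" using \<epsilon> K by (simp add: \<delta>_def)
      have "\<exists>A c. finite A \<and> (\<forall>j\<le>max N N'. \<forall>\<theta>. cmod (circle_deriv j \<psi> \<theta> - trig_poly A c j \<theta>) \<le> \<delta>)"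
        by (rule trig_poly_approx[where F = "\<lambda>j. circle_deriv j \<psi>", OF circle_deriv_has_vector_derivative[OF \<psi>] circle_deriv_periodic[OF \<psi>] \<delta>])
      then obtain A c where A: "finite A" "\<And>j \<theta>. j \<le> max N N' \<Longrightarrow> cmod (circle_deriv j \<psi> \<theta> - trig_poly A c j \<theta>) \<le> \<delta>"
        by meson
      define p where "p \<zeta> = (\<Sum>k\<in>A. c k * \<zeta> powi k)" for \<zeta>
      note P = distribution_trig_poly[OF A(1), where c = c, folded p_def]
      define d where "d \<zeta> = \<psi> \<zeta> + (-1) * p \<zeta>" for \<zeta>
      have d: "d \<in> circle_smooth" unfolding d_def[abs_def] by (intro circle_smooth_add circle_smooth_cmult \<psi> P)
      have dd: "(SUP \<theta>. cmod (circle_deriv j d \<theta>)) \<le> \<delta>" if "j \<le> max N N'" for j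
      proof (rule cSUP_least)
        show "cmod (circle_deriv j d \<theta>) \<le> \<delta>" for \<theta>
          using A(2)[OF that, of \<theta>] unfolding d_def[abs_def] circle_smooth_add(2)[OF \<psi> circle_smooth_cmult(1)[OF P(1)]]
            circle_smooth_cmult(2)[OF P(1)] P(2) by simp
      qed simp
      have ld: "g d = g \<psi> - g p" if "g \<in> circle_distributions" for g
        unfolding d_def[abs_def] circle_distributionsD(1)[OF that \<psi> circle_smooth_cmult(1)[OF P(1)]]
          circle_distributionsD(2)[OF that P(1)] by simp
      have "f p = h p" using P(3)[OF f] P(3)[OF h] eq by simp
      then have "cmod (f \<psi> - h \<psi>) = cmod (f d - h d)" by (simp add: ld f h)
      also have "\<dots> \<le> cmod (f d) + cmod (h d)" by (rule norm_triangle_ineq4)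
      also have "\<dots> \<le> C * (\<Sum>k\<le>N. \<delta>) + C' * (\<Sum>k\<le>N'. \<delta>)"
        using C(1) C'(1) dd
        by (intro add_mono order_trans[OF C(2)[OF d]] order_trans[OF C'(2)[OF d]] mult_left_mono sum_mono) auto
      also have "\<dots> = (C * real (Suc N) + C' * real (Suc N')) * \<delta>" by (simp add: algebra_simps)
      also have "\<dots> \<le> K * \<delta>" using \<delta> by (intro mult_right_mono) (auto simp: K_def)
      also have "\<dots> = \<epsilon>" using K by (simp add: \<delta>_def)
      finally show ?thesis .
    qed
    then have "cmod (f \<psi> - h \<psi>) \<le> 0" by (rule field_le_epsilon[of _ 0, simplified])
    then show ?thesis by simp
  qed
qed

section \<open>Distributions with prescribed Fourier coefficients\<close>

lemma summable_on_nat_inverse_square: "(\<lambda>n. 1 / (1 + real n)\<^sup>2) summable_on UNIV"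
proof (rule norm_summable_imp_summable_on)
  have "summable (\<lambda>n. 1 / (real (Suc n))\<^sup>2)"
    using inverse_power_summable[of 2, where 'a = real] by (subst summable_Suc_iff) (simp add: inverse_eq_divide)
  then show "summable (\<lambda>n. norm (1 / (1 + real n)\<^sup>2))" by (simp add: add.commute)
qed

lemma summable_on_int_inverse_square: "(\<lambda>k::int. 1 / (1 + \<bar>real_of_int k\<bar>)\<^sup>2) summable_on UNIV"
proof -
  let ?f = "\<lambda>k::int. 1 / (1 + \<bar>real_of_int k\<bar>)\<^sup>2"
  have "?f summable_on range int" "?f summable_on range (\<lambda>n. - int n)"
    using summable_on_nat_inverse_square by (subst summable_on_reindex; simp add: o_def inj_on_def)+
  then have "?f summable_on (range int \<union> range (\<lambda>n. - int n))" by (rule summable_on_union)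
  moreover have "range int \<union> range (\<lambda>n. - int n) = UNIV"
    by (auto simp: image_iff) (metis int_cases2)
  ultimately show ?thesis by simp
qed

text \<open>Dividing c_k by a high power of -ik gives an absolutely convergent Fourier series G.
  Pairing G with the M-th derivative of the test function restores that power; up to sign the result
  is the M-th derivative of G in the sense of distributions. The coefficient at 0, where division is
  impossible, is supplied by a constant function.\<close>

lemma distribution_with_fourier_coeffs:
  assumes c: "\<And>k. cmod (c k) \<le> C * (1 + \<bar>real_of_int k\<bar>) ^ N"
  shows "\<exists>f\<in>circle_distributions. \<forall>k. fourier_coeff f k = c k"
proof -
  have C: "C \<ge> 0" using c[of 0] order_trans[OF norm_ge_zero] by fastforce
  \<comment> \<open>Two orders more than the growth exponent leave a decay like 1 / k^2.\<close>
  define M where "M = N + 2"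
  define d where "d k = (if k = 0 then 0 else c k / (- \<i> * of_int k) ^ M) / of_real (2 * pi)" for k
  have "cmod (d k) \<le> (C * 2 ^ M) * (1 / (1 + \<bar>real_of_int k\<bar>)\<^sup>2)" for k
  proof (cases "k = 0")
    case True then show ?thesis using C by (simp add: d_def)
  next
    case False
    let ?x = "1 + \<bar>real_of_int k\<bar>"
    have k: "\<bar>real_of_int k\<bar> \<ge> 1" using False by linarith
    have "cmod (d k) = cmod (c k) / \<bar>real_of_int k\<bar> ^ M / (2 * pi)"
      using False pi_gt_zero by (simp add: d_def norm_divide norm_mult norm_power del: pi_gt_zero)
    also have "\<dots> \<le> cmod (c k) / \<bar>real_of_int k\<bar> ^ M / 1"
      using pi_gt3 by (intro divide_left_mono) auto
    also have "\<dots> \<le> (C * ?x ^ N) / \<bar>real_of_int k\<bar> ^ M"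
      using c[of k] by (simp add: divide_right_mono)
    \<comment> \<open>For |k| \<ge> 1 one has |k| \<ge> (1 + |k|) / 2, which produces the factor
      2^M.\<close>
    also have "\<dots> \<le> (C * ?x ^ N) / (?x / 2) ^ M"
      using k C by (intro divide_left_mono power_mono mult_nonneg_nonneg mult_pos_pos zero_less_power) auto
    also have "\<dots> = (C * 2 ^ M) * (?x ^ N / ?x ^ M)" by (simp add: power_divide)
    also have "?x ^ N / ?x ^ M = 1 / ?x\<^sup>2" by (simp add: M_def power_add power2_eq_square add_nonneg_eq_0_iff)
    finally show ?thesis .
  qed
  then have ds: "(\<lambda>k. cmod (d k)) summable_on UNIV"
    by (intro Infinite_Sum.abs_summable_on_comparison_test'[OF summable_on_cmult_right[OF summable_on_int_inverse_square]])
  define G where "G \<theta> = (\<Sum>\<^sub>\<infinity>k. d k * cis (of_int k * \<theta>))" for \<theta>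
  have Gc: "continuous_on B G" for B
    unfolding G_def[abs_def] using trig_series_integral(1)[OF ds, of B "\<lambda>k. k"] by simp
  define c0 where "c0 = c 0 / of_real (2 * pi)"
  define f where "f = (\<lambda>\<psi>. if \<psi> \<in> circle_smooth
      then integral {0..2 * pi} (\<lambda>\<theta>. c0 * circle_deriv 0 \<psi> \<theta> + G \<theta> * circle_deriv M \<psi> \<theta>) else 0)"
  have f: "f \<in> circle_distributions" unfolding f_def
    by (rule integral_distribution) (auto intro: Gc)
  have "fourier_coeff f k = c k" for k
  proof -
    have "fourier_coeff f k = integral {0..2 * pi} (\<lambda>\<theta>. c0 * cis (of_int (- k) * \<theta>) +
        (- \<i> * of_int k) ^ M * (G \<theta> * cis (- (of_int k * \<theta>))))"
      unfolding fourier_coeff_def f_def circle_smooth_monomial(2) by (simp add: circle_smooth_monomial(1) mult_ac)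
    also have "\<dots> = integral {0..2 * pi} (\<lambda>\<theta>. c0 * cis (of_int (- k) * \<theta>)) +
        integral {0..2 * pi} (\<lambda>\<theta>. (- \<i> * of_int k) ^ M * (G \<theta> * cis (- (of_int k * \<theta>))))"
      by (intro integral_add integrable_continuous_real continuous_intros Gc)
    also have "integral {0..2 * pi} (\<lambda>\<theta>. c0 * cis (of_int (- k) * \<theta>)) = c0 * (if - k = 0 then of_real (2 * pi) else 0)"
      by (intro integral_unique has_integral_mult_right integral_cis)
    also have "integral {0..2 * pi} (\<lambda>\<theta>. (- \<i> * of_int k) ^ M * (G \<theta> * cis (- (of_int k * \<theta>)))) =
        (- \<i> * of_int k) ^ M * (of_real (2 * pi) * d k)"
      using trig_series_integral(2)[OF ds, of "\<lambda>k. k" k] by (simp add: G_def vimage_def)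
    finally show ?thesis using pi_gt_zero by (simp add: c0_def d_def M_def del: pi_gt_zero)
  qed
  with f show ?thesis by blast
qed

section \<open>The Poisson kernel and Poisson integrals\<close>

text \<open>The Taylor coefficients of \<open>(1 - w) powr (- (\<alpha> + 1))\<close>.\<close>

definition kernel_coeff :: "real \<Rightarrow> nat \<Rightarrow> real" where
  "kernel_coeff \<alpha> l = pochhammer (\<alpha> + 1) l / fact l"

lemma kernel_coeff_Suc:
  "kernel_coeff \<alpha> (Suc l) = (\<alpha> + 1 + real l) / real (Suc l) * kernel_coeff \<alpha> l"
  by (simp add: kernel_coeff_def pochhammer_Suc field_simps)

lemma kernel_coeff_sums_complex:
  assumes "cmod w < 1"
  shows "(\<lambda>l. of_real (kernel_coeff \<alpha> l) * w ^ l) sums (1 - w) powr (- of_real (\<alpha> + 1))"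
proof -
  have "((- complex_of_real (\<alpha> + 1)) gchoose l) * (- w) ^ l = of_real (kernel_coeff \<alpha> l) * w ^ l" for l
  proof -
    have "((- complex_of_real (\<alpha> + 1)) gchoose l) = (-1) ^ l * of_real (kernel_coeff \<alpha> l)"
      unfolding gbinomial_pochhammer kernel_coeff_def minus_minus pochhammer_of_real by simp
    moreover have "(-1) ^ l * (- w) ^ l = w ^ l" by (simp add: power_mult_distrib[symmetric])
    ultimately show ?thesis by (metis mult.assoc mult.commute)
  qed
  then show ?thesis using gen_binomial_complex[of "- w" "- of_real (\<alpha> + 1)"] assms by simp
qed

lemma kernel_coeff_sums_real:
  assumes "\<bar>s\<bar> < 1"
  shows "(\<lambda>l. kernel_coeff \<alpha> l * s ^ l) sums (1 - s) powr (- (\<alpha> + 1))"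
proof -
  have "((- (\<alpha> + 1)) gchoose l) * (- s) ^ l = kernel_coeff \<alpha> l * s ^ l" for l
  proof -
    have "((- (\<alpha> + 1)) gchoose l) = (-1) ^ l * kernel_coeff \<alpha> l"
      unfolding gbinomial_pochhammer kernel_coeff_def minus_minus by simp
    moreover have "(-1) ^ l * (- s) ^ l = s ^ l" by (simp add: power_mult_distrib[symmetric])
    ultimately show ?thesis by (metis mult.assoc mult.commute)
  qed
  then show ?thesis using gen_binomial_real[of "- s" "- (\<alpha> + 1)"] assms by simp
qed

text \<open>By Bernoulli's inequality the ratio is at most ((n + 2) / (n + 1))^K, and the product of
  these telescopes. The constant C takes care of the indices up to n0, where the ratio is
  uncontrolled.\<close>

lemma ratio_imp_poly_bounded:
  fixes x :: "nat \<Rightarrow> real"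
  assumes x: "\<And>n. x n \<ge> 0" and r: "\<And>n. n \<ge> n0 \<Longrightarrow> x (Suc n) \<le> (1 + real K / real (Suc n)) * x n"
  shows "\<exists>C\<ge>0. \<forall>n. x n \<le> C * (1 + real n) ^ K"
proof -
  define C where "C = (\<Sum>i\<le>n0. x i)"
  have C: "C \<ge> 0" unfolding C_def by (intro sum_nonneg x)
  have small: "x n \<le> C * (1 + real n) ^ K" if "n \<le> n0" for n
  proof -
    have "x n \<le> C" unfolding C_def using that x by (intro member_le_sum) auto
    also have "C * 1 \<le> C * (1 + real n) ^ K" using C by (intro mult_left_mono one_le_power) auto
    finally show ?thesis by simp
  qed
  have "x n \<le> C * (1 + real n) ^ K" for n
  proof (induction n)
    case 0 show ?case by (rule small) simp
  next
    case (Suc n)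
    show ?case
    proof (cases "Suc n \<le> n0")
      case True then show ?thesis by (rule small)
    next
      case False
      have "x (Suc n) \<le> (1 + real K / real (Suc n)) * x n" using False by (intro r) simp
      also have "\<dots> \<le> (1 + 1 / real (Suc n)) ^ K * (C * (1 + real n) ^ K)"
      proof (intro mult_mono Suc x)
        have "-1 \<le> 1 / real (Suc n)" by (rule order_trans[of _ 0]) auto
        from Bernoulli_inequality[OF this, of K]
        show "1 + real K / real (Suc n) \<le> (1 + 1 / real (Suc n)) ^ K" by simp
      qed simp
      also have "\<dots> = C * ((1 + 1 / real (Suc n)) * (1 + real n)) ^ K" by (simp add: power_mult_distrib)
      also have "(1 + 1 / real (Suc n)) * (1 + real n) = 1 + real (Suc n)" by (simp add: field_simps)
      finally show ?thesis .
    qed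
  qed
  with C show ?thesis by blast
qed

lemma kernel_coeff_poly_bounded: "\<exists>C\<ge>0. \<exists>K. \<forall>l. \<bar>kernel_coeff \<alpha> l\<bar> \<le> C * (1 + real l) ^ K"
proof -
  obtain K :: nat where K: "\<bar>\<alpha>\<bar> \<le> real K" using real_arch_simple by blast
  have "\<exists>C\<ge>0. \<forall>l. \<bar>kernel_coeff \<alpha> l\<bar> \<le> C * (1 + real l) ^ K"
  proof (rule ratio_imp_poly_bounded[where ?n0.0 = 0])
    fix n
    have "\<bar>\<alpha> + 1 + real n\<bar> / real (Suc n) \<le> (real (Suc n) + real K) / real (Suc n)"
      using K by (intro divide_right_mono) auto
    also have "\<dots> = 1 + real K / real (Suc n)" by (simp add: add_divide_distrib)
    finally show "\<bar>kernel_coeff \<alpha> (Suc n)\<bar> \<le> (1 + real K / real (Suc n)) * \<bar>kernel_coeff \<alpha> n\<bar>"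
      unfolding kernel_coeff_Suc abs_mult by (intro mult_right_mono) auto
  qed simp
  then show ?thesis by blast
qed

text \<open>A factor \<alpha> + 1 + k of the Pochhammer symbol can vanish only at the negative
  integer \<alpha> = -1 - k.\<close>

lemma kernel_coeff_nonzero:
  assumes "\<not> (\<alpha> \<in> \<int> \<and> \<alpha> < 0)" shows "kernel_coeff \<alpha> l \<noteq> 0"
proof -
  have "\<alpha> + 1 \<noteq> - real k" for k
  proof
    assume "\<alpha> + 1 = - real k"
    then have "\<alpha> = of_int (- int k - 1)" "\<alpha> < 0" by simp_all
    then show False using assms Ints_of_int by metis
  qed
  then show ?thesis by (simp add: kernel_coeff_def pochhammer_eq_0_iff)
qed

lemma inverse_kernel_coeff_poly_bounded:
  assumes a: "\<not> (\<alpha> \<in> \<int> \<and> \<alpha> < 0)"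
  shows "\<exists>C\<ge>0. \<exists>K. \<forall>l. 1 / \<bar>kernel_coeff \<alpha> l\<bar> \<le> C * (1 + real l) ^ K"
proof -
  \<comment> \<open>From n \<ge> 2 |\<alpha>| on, the denominator \<alpha> + 1 + n of the ratio is
    at least (n + 1) / 2, so the ratio 1 - \<alpha> / (\<alpha> + 1 + n) is at most 1 + 2 |\<alpha>|
    / (n + 1).\<close>
  obtain K :: nat where K: "2 * \<bar>\<alpha>\<bar> \<le> real K" using real_arch_simple by blast
  have "\<exists>C\<ge>0. \<forall>l. 1 / \<bar>kernel_coeff \<alpha> l\<bar> \<le> C * (1 + real l) ^ K"
  proof (rule ratio_imp_poly_bounded[where ?n0.0 = K])
    fix n assume n: "n \<ge> K"
    then have nK: "real K \<le> real n" by simp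
    define t where "t = \<alpha> + 1 + real n"
    have t: "real (Suc n) / 2 \<le> t" "0 < t" using nK K by (auto simp: t_def)
    have "real (Suc n) / t = 1 - \<alpha> / t" using t(2) by (simp add: t_def field_simps)
    also have "\<dots> \<le> 1 + \<bar>\<alpha>\<bar> / t"
      using t(2) divide_right_mono[of "- \<alpha>" "\<bar>\<alpha>\<bar>" t] by simp
    also have "\<bar>\<alpha>\<bar> / t \<le> \<bar>\<alpha>\<bar> / (real (Suc n) / 2)" using t by (intro divide_left_mono) auto
    also have "\<dots> = 2 * \<bar>\<alpha>\<bar> / real (Suc n)" by simp
    also have "\<dots> \<le> real K / real (Suc n)" using K by (intro divide_right_mono) auto
    finally have *: "real (Suc n) / t \<le> 1 + real K / real (Suc n)" by simp
    have "1 / \<bar>kernel_coeff \<alpha> (Suc n)\<bar> = real (Suc n) / t * (1 / \<bar>kernel_coeff \<alpha> n\<bar>)"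
      unfolding kernel_coeff_Suc t_def[symmetric] abs_mult using t(2) by simp
    also have "\<dots> \<le> (1 + real K / real (Suc n)) * (1 / \<bar>kernel_coeff \<alpha> n\<bar>)"
      by (intro mult_right_mono *) auto
    finally show "1 / \<bar>kernel_coeff \<alpha> (Suc n)\<bar> \<le> (1 + real K / real (Suc n)) * (1 / \<bar>kernel_coeff \<alpha> n\<bar>)" .
  qed simp
  then show ?thesis by blast
qed

text \<open>Counterpart of \<open>subexp\<close> for sequences over the integers: the growth that
  Taylor coefficients on the open disc provide, before any bound on u at the boundary is
  used.\<close>

definition subexp_int :: "(int \<Rightarrow> complex) \<Rightarrow> bool" where
  "subexp_int c \<longleftrightarrow> (\<forall>\<rho>. 0 < \<rho> \<and> \<rho> < 1 \<longrightarrow> (\<exists>C. \<forall>k. cmod (c k) * \<rho> ^ nat \<bar>k\<bar> \<le> C))"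

definition poisson_coeff :: "real \<Rightarrow> (int \<Rightarrow> complex) \<Rightarrow> nat \<times> nat \<Rightarrow> complex" where
  "poisson_coeff \<alpha> c p = of_real (kernel_coeff \<alpha> (snd p)) * c (int (fst p) - int (snd p))"

text \<open>Since |j - l| \<le> j + l, the bound on c carries over to pairs; the kernel coefficients
  contribute only a polynomial factor.\<close>

lemma subexp_poisson_coeff:
  assumes c: "subexp_int c" shows "subexp (poisson_coeff \<alpha> c)"
proof -
  have 1: "subexp (\<lambda>p. c (int (fst p) - int (snd p)))"
    unfolding subexp_def
  proof (intro allI impI)
    fix \<rho> :: real assume \<rho>: "0 < \<rho> \<and> \<rho> < 1"
    then obtain C where C: "\<And>k. cmod (c k) * \<rho> ^ nat \<bar>k\<bar> \<le> C" using c unfolding subexp_int_def by blast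
    have "cmod (c (int (fst p) - int (snd p))) * \<rho> ^ (fst p + snd p) \<le> C" for p
    proof (rule order_trans[OF _ C[of "int (fst p) - int (snd p)"]])
      show "cmod (c (int (fst p) - int (snd p))) * \<rho> ^ (fst p + snd p)
          \<le> cmod (c (int (fst p) - int (snd p))) * \<rho> ^ nat \<bar>int (fst p) - int (snd p)\<bar>"
        using \<rho> by (intro mult_left_mono power_decreasing) auto
    qed
    then show "\<exists>C. \<forall>p. cmod (c (int (fst p) - int (snd p))) * \<rho> ^ (fst p + snd p) \<le> C" by blast
  qed
  obtain C K where CK: "C \<ge> 0" "\<And>l. \<bar>kernel_coeff \<alpha> l\<bar> \<le> C * (1 + real l) ^ K"
    using kernel_coeff_poly_bounded by blast
  show ?thesis
  proof (rule subexp_poly[OF 1, where K = C and N = K])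
    fix p :: "nat \<times> nat"
    have "\<bar>kernel_coeff \<alpha> (snd p)\<bar> \<le> C * (1 + real (fst p + snd p)) ^ K"
      using CK(1) by (intro order_trans[OF CK(2)] mult_left_mono power_mono) auto
    then show "cmod (poisson_coeff \<alpha> c p) \<le> C * (1 + real (fst p + snd p)) ^ K * cmod (c (int (fst p) - int (snd p)))"
      unfolding poisson_coeff_def norm_mult by (intro mult_right_mono) auto
  qed
qed

lemma poly_bounded_imp_subexp_int:
  assumes "\<And>k. cmod (c k) \<le> C * (1 + \<bar>real_of_int k\<bar>) ^ N" and C: "C \<ge> 0"
  shows "subexp_int c"
  unfolding subexp_int_def
proof (intro allI impI)
  fix \<rho> :: real assume \<rho>: "0 < \<rho> \<and> \<rho> < 1"
  have "cmod (c k) * \<rho> ^ nat \<bar>k\<bar> \<le> C * (fact N * exp 1 / (1 - \<rho>) ^ N)" for k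
  proof -
    have "cmod (c k) * \<rho> ^ nat \<bar>k\<bar> \<le> (C * (1 + real (nat \<bar>k\<bar>)) ^ N) * \<rho> ^ nat \<bar>k\<bar>"
      using assms(1)[of k] \<rho> by (intro mult_right_mono) auto
    also have "\<dots> = C * ((1 + real (nat \<bar>k\<bar>)) ^ N * \<rho> ^ nat \<bar>k\<bar>)" by simp
    also have "\<dots> \<le> C * (fact N * exp 1 / (1 - \<rho>) ^ N)"
      using \<rho> by (intro mult_left_mono poly_geom_bound C) auto
    finally show ?thesis .
  qed
  then show "\<exists>C. \<forall>k. cmod (c k) * \<rho> ^ nat \<bar>k\<bar> \<le> C" by blast
qed

section \<open>Series expansions of the kernel and of Poisson integrals\<close>

lemma summable_norm_kernel_coeff:
  assumes "0 \<le> r" "r < 1" shows "(\<lambda>l. \<bar>kernel_coeff \<alpha> l\<bar> * r ^ l) summable_on UNIV"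
proof (rule norm_summable_imp_summable_on)
  define q where "q = (1 + r) / 2"
  have q: "\<bar>q\<bar> < 1" "norm r < norm q" using assms by (auto simp: q_def)
  have "summable (\<lambda>l. kernel_coeff \<alpha> l * q ^ l)"
    using kernel_coeff_sums_real[OF q(1)] by (rule sums_summable)
  from powser_insidea[OF this q(2)] show "summable (\<lambda>l. norm (\<bar>kernel_coeff \<alpha> l\<bar> * r ^ l))"
    using assms by (simp add: abs_mult)
qed

lemma kernel_coeff_has_sum_real:
  assumes "0 \<le> s" "s < 1"
  shows "((\<lambda>l. kernel_coeff \<alpha> l * s ^ l) has_sum (1 - s) powr (- (\<alpha> + 1))) UNIV"
proof (rule norm_summable_imp_has_sum)
  show "summable (\<lambda>l. norm (kernel_coeff \<alpha> l * s ^ l))"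
    using summable_on_imp_summable[OF summable_norm_kernel_coeff[OF assms, of \<alpha>]] assms by (simp add: abs_mult)
  show "(\<lambda>l. kernel_coeff \<alpha> l * s ^ l) sums (1 - s) powr (- (\<alpha> + 1))"
    using assms by (intro kernel_coeff_sums_real) auto
qed

lemma kernel_coeff_has_sum_complex:
  assumes "cmod w < 1"
  shows "((\<lambda>l. of_real (kernel_coeff \<alpha> l) * w ^ l) has_sum (1 - w) powr (- of_real (\<alpha> + 1))) UNIV"
proof (rule norm_summable_imp_has_sum)
  show "summable (\<lambda>l. norm (of_real (kernel_coeff \<alpha> l) * w ^ l))"
    using summable_on_imp_summable[OF summable_norm_kernel_coeff[OF norm_ge_zero assms, of \<alpha>]]
    by (simp add: norm_mult norm_power)
qed (use assms kernel_coeff_sums_complex in auto)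

text \<open>The product of the geometric series in z and the binomial series in
  \<open>cnj z\<close>; the constant sequence 1 is that of the Fourier coefficients of the point
  mass at 1.\<close>

lemma poisson_kernel_series:
  assumes z: "cmod z < 1"
  shows "poisson_kernel \<alpha> z = of_real ((1 - (cmod z)\<^sup>2) powr (\<alpha> + 1)) * double_series (poisson_coeff \<alpha> (\<lambda>_. 1)) z"
proof -
  have cz: "cmod (cnj z) < 1" using z by simp
  have g: "(\<lambda>j. norm (z ^ j)) summable_on UNIV"
    using geometric_summable_on[OF norm_ge_zero z] by (simp add: norm_power)
  have "((\<lambda>p. z ^ fst p * (of_real (kernel_coeff \<alpha> (snd p)) * cnj z ^ snd p)) has_sum
      infsum (\<lambda>j. z ^ j) UNIV * infsum (\<lambda>l. of_real (kernel_coeff \<alpha> l) * cnj z ^ l) UNIV) UNIV"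
    by (rule has_sum_product[OF g])
       (use summable_norm_kernel_coeff[OF norm_ge_zero z, of \<alpha>] in \<open>simp add: norm_mult norm_power\<close>)
  moreover have "infsum (\<lambda>j. z ^ j) UNIV = 1 / (1 - z)"
    using norm_summable_imp_has_sum[OF summable_on_imp_summable[OF g] geometric_sums[OF z]] by (rule infsumI)
  moreover have "infsum (\<lambda>l. of_real (kernel_coeff \<alpha> l) * cnj z ^ l) UNIV = (1 - cnj z) powr (- of_real (\<alpha> + 1))"
    by (rule infsumI[OF kernel_coeff_has_sum_complex[OF cz]])
  ultimately have "double_series (poisson_coeff \<alpha> (\<lambda>_. 1)) z = 1 / (1 - z) * (1 - cnj z) powr (- of_real (\<alpha> + 1))"
    unfolding double_series_def poisson_coeff_def by (subst infsumI) (auto simp: mult_ac)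
  then show ?thesis unfolding poisson_kernel_def
    by (simp only: powr_minus divide_inverse inverse_mult_distrib mult_1_left mult.assoc)
qed

lemma double_series_on_circle:
  "double_series a (of_real r * cis \<theta>) =
    (\<Sum>\<^sub>\<infinity>p. (a p * of_real (r ^ (fst p + snd p))) * cis (of_int (int (fst p) - int (snd p)) * \<theta>))"
proof -
  have "a p * (of_real r * cis \<theta>) ^ fst p * cnj (of_real r * cis \<theta>) ^ snd p =
      (a p * of_real (r ^ (fst p + snd p))) * cis (of_int (int (fst p) - int (snd p)) * \<theta>)" for p
  proof -
    have "cis (of_int (int (fst p) - int (snd p)) * \<theta>) = cis (real (fst p) * \<theta>) * cis (real (snd p) * (- \<theta>))"
      by (simp add: cis_mult algebra_simps)
    then show ?thesis
      by (simp add: power_mult_distrib power_add Complex.DeMoivre[symmetric] cis_cnj[symmetric])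
  qed
  then show ?thesis unfolding double_series_def by (intro infsum_cong)
qed

text \<open>The Fourier coefficients of the Poisson kernel on the circle of radius \<open>r\<close>.\<close>

definition kernel_fourier :: "real \<Rightarrow> real \<Rightarrow> int \<Rightarrow> real" where
  "kernel_fourier \<alpha> r k = (1 - r\<^sup>2) powr (\<alpha> + 1) *
     (\<Sum>\<^sub>\<infinity>p\<in>(\<lambda>p. int (fst p) - int (snd p)) -` {k}. kernel_coeff \<alpha> (snd p) * r ^ (fst p + snd p))"

lemma infsum_of_real_complex: "(\<Sum>\<^sub>\<infinity>x\<in>A. complex_of_real (f x)) = of_real (\<Sum>\<^sub>\<infinity>x\<in>A. f x)"
proof (cases "f summable_on A")
  case True
  then show ?thesis by (intro infsumI) (simp add: has_sum_of_real_iff)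
next
  case False
  then have "\<not> (\<lambda>x. complex_of_real (f x)) summable_on A"
    using summable_on_Re[of "\<lambda>x. complex_of_real (f x)" A] by auto
  \<comment> \<open>Without summability both infinite sums take the default value 0.\<close>
  with False show ?thesis by (simp add: infsum_not_exists)
qed

text \<open>All terms with j - l = k contain the same c_k, which factors out and leaves a multiplier
  independent of c. With c = 1 the lemma describes the kernel, with the coefficients of f the
  Poisson integral, and comparing the two cases gives the convolution identity.\<close>

lemma poisson_series_fourier:
  assumes c: "subexp_int c" and r: "0 \<le> r" "r < 1"
    and g: "\<And>\<theta>. g (cis \<theta>) = of_real ((1 - r\<^sup>2) powr (\<alpha> + 1)) * double_series (poisson_coeff \<alpha> c) (of_real r * cis \<theta>)"
  shows "g \<in> circle_smooth" "distr_of_fun g \<in> circle_distributions"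
    "fourier_coeff (distr_of_fun g) k = of_real (kernel_fourier \<alpha> r k) * c k"
proof -
  let ?A = "complex_of_real ((1 - r\<^sup>2) powr (\<alpha> + 1))"
  define \<kappa> :: "nat \<times> nat \<Rightarrow> int" where "\<kappa> p = int (fst p) - int (snd p)" for p
  define d where "d p = ?A * (poisson_coeff \<alpha> c p * of_real (r ^ (fst p + snd p)))" for p
  note a = subexp_poisson_coeff[OF c, of \<alpha>]
  have g': "g (cis \<theta>) = (\<Sum>\<^sub>\<infinity>p. d p * cis (of_int (\<kappa> p) * \<theta>))" for \<theta>
    unfolding g double_series_on_circle d_def \<kappa>_def by (subst infsum_cmult_right'[symmetric]) (simp add: mult.assoc)
  have s: "(\<lambda>p. cmod (d p) * \<bar>real_of_int (\<kappa> p)\<bar> ^ N) summable_on UNIV" for N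
  proof -
    have "subexp (\<lambda>p. ?A * (of_int (\<kappa> p)) ^ N * poisson_coeff \<alpha> c p)"
    proof (rule subexp_poly[OF a, where K = "cmod ?A" and N = N])
      fix p
      have "\<bar>real_of_int (\<kappa> p)\<bar> \<le> 1 + real (fst p + snd p)" by (simp add: \<kappa>_def)
      then have "\<bar>real_of_int (\<kappa> p)\<bar> ^ N \<le> (1 + real (fst p + snd p)) ^ N" by (intro power_mono) auto
      then show "cmod (?A * (of_int (\<kappa> p)) ^ N * poisson_coeff \<alpha> c p) \<le>
          cmod ?A * (1 + real (fst p + snd p)) ^ N * cmod (poisson_coeff \<alpha> c p)"
        unfolding norm_mult norm_power norm_of_int by (intro mult_right_mono mult_left_mono) auto
    qed
    from subexp_summable[OF this r] show ?thesis
      using r by (simp add: d_def norm_mult norm_power mult_ac)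
  qed
  show "g \<in> circle_smooth"
    by (rule trig_series_smooth[OF _ _ s g']) (simp_all add: finite_prod)
  have s0: "(\<lambda>p. cmod (d p)) summable_on UNIV" using s[of 0] by simp
  show "distr_of_fun g \<in> circle_distributions" by (rule fourier_coeff_trig_series(1)[OF s0 g'])
  have "fourier_coeff (distr_of_fun g) k = (\<Sum>\<^sub>\<infinity>p\<in>\<kappa> -` {k}. d p)"
    by (rule fourier_coeff_trig_series(2)[OF s0 g'])
  also have "\<dots> = (\<Sum>\<^sub>\<infinity>p\<in>\<kappa> -` {k}. (?A * c k) * of_real (kernel_coeff \<alpha> (snd p) * r ^ (fst p + snd p)))"
    by (intro infsum_cong) (auto simp: d_def poisson_coeff_def \<kappa>_def)
  also have "\<dots> = of_real (kernel_fourier \<alpha> r k) * c k"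
    unfolding infsum_cmult_right' kernel_fourier_def \<kappa>_def[abs_def] infsum_of_real_complex by (simp add: mult_ac)
  finally show "fourier_coeff (distr_of_fun g) k = of_real (kernel_fourier \<alpha> r k) * c k" .
qed

lemma subexp_int_fourier_coeff:
  assumes "f \<in> circle_distributions" shows "subexp_int (fourier_coeff f)"
  using fourier_coeff_poly_bounded[OF assms] poly_bounded_imp_subexp_int by blast

text \<open>The series defines a smooth function on the circle of radius |z| with the right Fourier
  coefficients; \<open>distribution_eqI\<close> and \<open>distr_value_of_fun\<close> then resolve
  the two definite descriptions.\<close>

lemma poisson_integral_eq:
  assumes f: "f \<in> circle_distributions" and z: "cmod z < 1"
  shows "poisson_integral \<alpha> f z =
    of_real ((1 - (cmod z)\<^sup>2) powr (\<alpha> + 1)) * double_series (poisson_coeff \<alpha> (fourier_coeff f)) z"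
proof -
  define r where "r = cmod z"
  have r: "0 \<le> r" "r < 1" using z by (auto simp: r_def)
  define K where "K \<zeta> = poisson_kernel \<alpha> (of_real r * \<zeta>)" for \<zeta>
  define g where "g \<zeta> = of_real ((1 - r\<^sup>2) powr (\<alpha> + 1)) * double_series (poisson_coeff \<alpha> (fourier_coeff f)) (of_real r * \<zeta>)" for \<zeta>
  have one: "subexp_int (\<lambda>_. 1)" by (rule poly_bounded_imp_subexp_int[of _ 1 0]) auto
  have K: "K (cis \<theta>) = of_real ((1 - r\<^sup>2) powr (\<alpha> + 1)) * double_series (poisson_coeff \<alpha> (\<lambda>_. 1)) (of_real r * cis \<theta>)" for \<theta>
    unfolding K_def using poisson_kernel_series[of "of_real r * cis \<theta>" \<alpha>] r by (simp add: norm_mult)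
  note FK = poisson_series_fourier[OF one r K]
  note Fg = poisson_series_fourier[OF subexp_int_fourier_coeff[OF f] r g_def]
  have "circle_convolution (distr_of_fun K) f = distr_of_fun g"
    unfolding circle_convolution_def
  proof (rule the_equality)
    show "distr_of_fun g \<in> circle_distributions \<and>
       (\<forall>k. fourier_coeff (distr_of_fun g) k = fourier_coeff (distr_of_fun K) k * fourier_coeff f k)"
      using Fg FK by simp
    then show "h = distr_of_fun g" if "h \<in> circle_distributions \<and>
       (\<forall>k. fourier_coeff h k = fourier_coeff (distr_of_fun K) k * fourier_coeff f k)" for h
      using that by (intro distribution_eqI) auto
  qed
  then have "poisson_integral \<alpha> f z = distr_value (distr_of_fun g) (cis (Arg z))"
    unfolding poisson_integral_def r_def[symmetric] K_def[abs_def] by simp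
  also have "\<dots> = g (cis (Arg z))" by (rule distr_value_of_fun[OF Fg(1)])
  also have "of_real r * cis (Arg z) = z" using rcis_cmod_Arg[of z] by (simp add: rcis_def r_def)
  then have "g (cis (Arg z)) = of_real ((1 - (cmod z)\<^sup>2) powr (\<alpha> + 1)) * double_series (poisson_coeff \<alpha> (fourier_coeff f)) z"
    by (simp add: g_def r_def)
  finally show ?thesis .
qed

text \<open>For j > 0 both terms of the bracket carry the same value of c, at index j - l - 1, so
  the recursion for \<open>kernel_coeff\<close> cancels them; for j = 0 the shift \<open>up1\<close>
  contributes nothing.\<close>

lemma bracket2_poisson_coeff:
  "bracket2 (\<alpha> + 1) (poisson_coeff \<alpha> c) =
    (\<lambda>p. if fst p = 0 then of_nat (Suc (snd p)) * of_real (kernel_coeff \<alpha> (Suc (snd p))) * c (- int (Suc (snd p))) else 0)"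
proof
  fix p :: "nat \<times> nat"
  have k: "of_nat (Suc l) * complex_of_real (kernel_coeff \<alpha> (Suc l)) =
      (of_nat l + of_real (\<alpha> + 1)) * of_real (kernel_coeff \<alpha> l)" for l
  proof -
    have "real (Suc l) * kernel_coeff \<alpha> (Suc l) = (real l + (\<alpha> + 1)) * kernel_coeff \<alpha> l"
      unfolding kernel_coeff_Suc by simp
    then have "complex_of_real (real (Suc l) * kernel_coeff \<alpha> (Suc l)) = of_real ((real l + (\<alpha> + 1)) * kernel_coeff \<alpha> l)"
      by (rule arg_cong)
    then show ?thesis by (simp only: of_real_mult of_real_add of_real_of_nat_eq)
  qed
  show "bracket2 (\<alpha> + 1) (poisson_coeff \<alpha> c) p =
    (if fst p = 0 then of_nat (Suc (snd p)) * of_real (kernel_coeff \<alpha> (Suc (snd p))) * c (- int (Suc (snd p))) else 0)"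
  proof (cases "fst p")
    case 0
    then show ?thesis by (simp add: bracket2_def diff2_def up1_def poisson_coeff_def)
  next
    case (Suc j)
    have "int (Suc j) - int (Suc l) = int j - int l" for l by simp
    then show ?thesis using Suc
      by (simp only: bracket2_def diff2_def up1_def poisson_coeff_def nat.case fst_conv snd_conv mult.assoc[symmetric] k)
         simp
  qed
qed

section \<open>Poisson integrals are \<alpha>-harmonic and of temperate growth\<close>

lemma double_series_zero: "double_series (\<lambda>_. 0) z = 0" by (simp add: double_series_def)

lemma poisson_series_dbar:
  assumes c: "subexp_int c" and u: "disc_form (\<alpha> + 1) (poisson_coeff \<alpha> c) u" and z: "cmod z < 1"
  shows "dbar_z u z = of_real ((1 - (cmod z)\<^sup>2) powr \<alpha>) *
      double_series (\<lambda>p. if fst p = 0 then of_nat (Suc (snd p)) * of_real (kernel_coeff \<alpha> (Suc (snd p))) * c (- int (Suc (snd p))) else 0) z"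
  using has_wirtinger_imp(4)[OF disc_form_has_wirtinger[OF u z]] by (simp only: bracket2_poisson_coeff add_diff_cancel_right')

lemma poisson_series_alpha_harmonic:
  assumes c: "subexp_int c" and u: "disc_form (\<alpha> + 1) (poisson_coeff \<alpha> c) u"
  shows "alpha_harmonic \<alpha> u"
  unfolding alpha_harmonic_def
proof (intro conjI ballI disc_form_C2[OF u])
  fix z :: complex assume "z \<in> ball 0 1"
  then have z: "cmod z < 1" by simp
  define v where "v p = (if fst p = 0 then of_nat (Suc (snd p)) * of_real (kernel_coeff \<alpha> (Suc (snd p))) * c (- int (Suc (snd p))) else 0)"
    for p :: "nat \<times> nat"
  have sv: "subexp v"
    using subexp_bracket(2)[OF subexp_poisson_coeff[OF c], of "\<alpha> + 1" \<alpha>] unfolding bracket2_poisson_coeff v_def[abs_def] .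
  have eq: "of_real ((1 - (cmod w)\<^sup>2) powr (- \<alpha>)) * dbar_z u w = double_series v w" if "w \<in> ball 0 1" for w
  proof -
    have w: "cmod w < 1" using that by simp
    then have "1 - (cmod w)\<^sup>2 > 0" by (simp add: abs_square_less_1)
    then have "(1 - (cmod w)\<^sup>2) powr (- \<alpha>) * (1 - (cmod w)\<^sup>2) powr \<alpha> = 1" by (simp add: powr_add[symmetric])
    then show ?thesis unfolding poisson_series_dbar[OF c u w] v_def[abs_def]
      by (simp only: mult.assoc[symmetric] of_real_mult[symmetric] of_real_1 mult_1_left)
  qed
  have "has_wirtinger (\<lambda>w. of_real ((1 - (cmod w)\<^sup>2) powr (- \<alpha>)) * dbar_z u w) (double_series (diff1 v) z) (double_series (diff2 v) z) z"
    by (rule has_wirtinger_cong[OF double_series_has_wirtinger[OF sv z], of "ball 0 1"]) (use z eq in auto)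
  from has_wirtinger_imp(3)[OF this]
  have "d_z (\<lambda>w. of_real ((1 - (cmod w)\<^sup>2) powr (- \<alpha>)) * dbar_z u w) z = double_series (diff1 v) z" .
  also have "diff1 v = (\<lambda>_. 0)" by (simp add: fun_eq_iff diff1_def v_def)
  finally show "d_z (\<lambda>w. of_real ((1 - (cmod w)\<^sup>2) powr (- \<alpha>)) * dbar_z u w) z = 0" by (simp add: double_series_zero)
qed

text \<open>The inequality 1 + |j - l| \<le> (1 + j)(1 + l) splits each term into a factor in j and
  a factor in l, and \<open>poly_geom_bound\<close> converts each into a power of 1 / (1 -
  |z|).\<close>

lemma poisson_series_temperate:
  assumes c: "\<And>k. cmod (c k) \<le> C * (1 + \<bar>real_of_int k\<bar>) ^ N" and C: "C \<ge> 0"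
    and u: "disc_form (\<alpha> + 1) (poisson_coeff \<alpha> c) u"
  shows "temperate_growth u"
proof -
  obtain D K where D: "D \<ge> 0" "\<And>l. \<bar>kernel_coeff \<alpha> l\<bar> \<le> D * (1 + real l) ^ K"
    using kernel_coeff_poly_bounded by blast
  \<comment> \<open>The exponents collect N from c and K from the kernel coefficients; the extra 2
    leaves inverse squares, which are summable over pairs.\<close>
  define M1 where "M1 = N + 2"
  define M2 where "M2 = K + N + 2"
  define S where "S = (\<Sum>\<^sub>\<infinity>p::nat \<times> nat. 1 / (1 + real (fst p))\<^sup>2 * (1 / (1 + real (snd p))\<^sup>2))"
  have Ssum: "(\<lambda>p::nat \<times> nat. 1 / (1 + real (fst p))\<^sup>2 * (1 / (1 + real (snd p))\<^sup>2)) summable_on UNIV"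
    by (rule summable_on_product_real[OF summable_on_nat_inverse_square summable_on_nat_inverse_square]) auto
  have S0: "S \<ge> 0" unfolding S_def by (intro infsum_nonneg) auto
  define E where "E = C * D * (fact M1 * exp 1) * (fact M2 * exp 1)"
  have E: "E \<ge> 0" using C D(1) by (simp add: E_def)
  have su: "subexp_int c" by (rule poly_bounded_imp_subexp_int[OF c C])
  have main: "cmod (double_series (poisson_coeff \<alpha> c) z) \<le> E / (1 - cmod z) ^ (M1 + M2) * S" if z: "cmod z < 1" for z
  proof (rule norm_infsum_le)
    define r where "r = cmod z"
    have r: "0 \<le> r" "r < 1" using z by (auto simp: r_def)
    show "((\<lambda>p. poisson_coeff \<alpha> c p * z ^ fst p * cnj z ^ snd p) has_sum double_series (poisson_coeff \<alpha> c) z) UNIV"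
      unfolding double_series_def by (rule has_sum_infsum[OF double_series_summable[OF subexp_poisson_coeff[OF su] z]])
    show "((\<lambda>p. E / (1 - cmod z) ^ (M1 + M2) * (1 / (1 + real (fst p))\<^sup>2 * (1 / (1 + real (snd p))\<^sup>2))) has_sum
        E / (1 - cmod z) ^ (M1 + M2) * S) UNIV"
      unfolding S_def by (intro has_sum_cmult_right has_sum_infsum Ssum)
    fix p :: "nat \<times> nat"
    obtain j l where p: "p = (j, l)" by (cases p)
    have geom: "(1 + real n) ^ m * r ^ n \<le> fact (m + 2) * exp 1 / (1 - r) ^ (m + 2) * (1 / (1 + real n)\<^sup>2)" for n m
    proof -
      have "((1 + real n) ^ m * r ^ n) * (1 + real n)\<^sup>2 \<le> fact (m + 2) * exp 1 / (1 - r) ^ (m + 2)"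
        using poly_geom_bound[OF r, of n "m + 2"] by (simp only: power_add mult_ac)
      then show ?thesis
        unfolding times_divide_eq_right mult_1_right by (subst pos_le_divide_eq) (simp_all del: fact_Suc)
    qed
    have "cmod (c (int j - int l)) \<le> C * ((1 + real j) * (1 + real l)) ^ N"
    proof (rule order_trans[OF c], intro mult_left_mono power_mono C)
      have "\<bar>real_of_int (int j - int l)\<bar> \<le> real j + real l" by simp
      moreover have "0 \<le> real j * real l" by simp
      moreover have "(1 + real j) * (1 + real l) = 1 + (real j + real l) + real j * real l"
        by (simp add: algebra_simps)
      ultimately show "1 + \<bar>real_of_int (int j - int l)\<bar> \<le> (1 + real j) * (1 + real l)" by linarith
    qed auto
    then have "cmod (poisson_coeff \<alpha> c p) \<le> (D * (1 + real l) ^ K) * (C * ((1 + real j) * (1 + real l)) ^ N)"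
      unfolding poisson_coeff_def norm_mult p using D by (intro mult_mono) auto
    then have "cmod (poisson_coeff \<alpha> c p * z ^ fst p * cnj z ^ snd p) \<le>
        (D * (1 + real l) ^ K) * (C * ((1 + real j) * (1 + real l)) ^ N) * r ^ (j + l)"
      using r norm_double_series_term[of "poisson_coeff \<alpha> c" p z]
      by (simp add: p r_def[symmetric] mult_right_mono del: distrib_left distrib_right)
    also have "\<dots> = (C * D) * (((1 + real j) ^ N * r ^ j) * ((1 + real l) ^ (K + N) * r ^ l))"
      by (simp add: power_add power_mult_distrib mult_ac)
    also have "\<dots> \<le> (C * D) * ((fact M1 * exp 1 / (1 - r) ^ M1 * (1 / (1 + real j)\<^sup>2)) *
        (fact M2 * exp 1 / (1 - r) ^ M2 * (1 / (1 + real l)\<^sup>2)))"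
      unfolding M1_def M2_def using r C D(1)
      by (intro mult_left_mono mult_mono geom mult_nonneg_nonneg divide_nonneg_nonneg zero_le_power) auto
    also have "\<dots> = E / (1 - r) ^ (M1 + M2) * (1 / (1 + real j)\<^sup>2 * (1 / (1 + real l)\<^sup>2))"
      unfolding E_def power_add divide_inverse inverse_mult_distrib by (simp only: mult_ac mult_1_left)
    finally show "cmod (poisson_coeff \<alpha> c p * z ^ fst p * cnj z ^ snd p)
      \<le> E / (1 - cmod z) ^ (M1 + M2) * (1 / (1 + real (fst p))\<^sup>2 * (1 / (1 + real (snd p))\<^sup>2))"
      by (simp add: p r_def)
  qed
  define M where "M = M1 + M2"
  \<comment> \<open>The exponent to be dominated is \<alpha> + 1 - M, which may be nonnegative; the
    maximum with 1 makes \<open>N'\<close> positive, and the summand 1 in the constant below does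
    the same for the constant.\<close>
  define N' where "N' = max 1 (real M - (\<alpha> + 1))"
  have "cmod (u z) \<le> (E * 2 ^ M * S + 1) * (1 - (cmod z)\<^sup>2) powr (- N')" if "z \<in> ball 0 1" for z
  proof -
    have z: "cmod z < 1" using that by simp
    define s where "s = 1 - (cmod z)\<^sup>2"
    have s: "0 < s" "s \<le> 1" using z by (auto simp: s_def abs_square_less_1)
    have "s = (1 - cmod z) * (1 + cmod z)" by (simp add: s_def power2_eq_square algebra_simps)
    also have "\<dots> \<le> (1 - cmod z) * 2" using z by (intro mult_left_mono) auto
    finally have "s / 2 \<le> 1 - cmod z" by simp
    then have "(s / 2) ^ M \<le> (1 - cmod z) ^ M" using s by (intro power_mono) auto
    then have "E / (1 - cmod z) ^ M \<le> E / (s / 2) ^ M"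
      using s E z by (intro divide_left_mono mult_pos_pos zero_less_power) auto
    then have 1: "cmod (double_series (poisson_coeff \<alpha> c) z) \<le> E / (s / 2) ^ M * S"
      by (intro order_trans[OF main[OF z]] mult_right_mono S0) (simp only: M_def)
    have "cmod (u z) = s powr (\<alpha> + 1) * cmod (double_series (poisson_coeff \<alpha> c) z)"
      using u that by (simp add: disc_form_def norm_mult s_def)
    also have "\<dots> \<le> s powr (\<alpha> + 1) * (E / (s / 2) ^ M * S)" by (intro mult_left_mono 1) auto
    also have "\<dots> = (E * 2 ^ M * S) * (s powr (\<alpha> + 1) / s ^ M)" by (simp add: power_divide)
    also have "s powr (\<alpha> + 1) / s ^ M = s powr (\<alpha> + 1 - real M)"
      using s by (simp add: powr_diff powr_realpow)
    also have "(E * 2 ^ M * S) * s powr (\<alpha> + 1 - real M) \<le> (E * 2 ^ M * S + 1) * s powr (- N')"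
      using s E S0 by (intro mult_mono powr_mono') (auto simp: N'_def)
    finally show ?thesis by (simp add: s_def)
  qed
  moreover have "E * 2 ^ M * S + 1 > 0" using E S0 by (simp add: add_nonneg_pos)
  moreover have "N' > 0" by (simp add: N'_def)
  ultimately show ?thesis unfolding temperate_growth_def by blast
qed

lemma poisson_integral_imp:
  assumes f: "f \<in> circle_distributions" and u: "\<And>z. z \<in> ball 0 1 \<Longrightarrow> u z = poisson_integral \<alpha> f z"
  shows "alpha_harmonic \<alpha> u" "temperate_growth u"
proof -
  have s: "subexp_int (fourier_coeff f)" by (rule subexp_int_fourier_coeff[OF f])
  have d: "disc_form (\<alpha> + 1) (poisson_coeff \<alpha> (fourier_coeff f)) u"
    unfolding disc_form_def using subexp_poisson_coeff[OF s] u poisson_integral_eq[OF f] by simp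
  show "alpha_harmonic \<alpha> u" by (rule poisson_series_alpha_harmonic[OF s d])
  show "temperate_growth u"
    using fourier_coeff_poly_bounded[OF f] poisson_series_temperate[OF _ _ d] by blast
qed

section \<open>From temperate growth to boundary distributions\<close>

lemma holomorphic_taylor_coeffs:
  assumes F: "F holomorphic_on ball 0 1"
  obtains a where "\<And>\<rho>. 0 < \<rho> \<Longrightarrow> \<rho> < 1 \<Longrightarrow> \<exists>C. \<forall>n. cmod (a n) * \<rho> ^ n \<le> C"
    "\<And>z. cmod z < 1 \<Longrightarrow> ((\<lambda>n. a n * z ^ n) has_sum F z) UNIV"
    "\<And>z. cmod z < 1 \<Longrightarrow> (\<lambda>n. cmod (a n * z ^ n)) summable_on UNIV"
proof -
  define a where "a n = (deriv ^^ n) F 0 / fact n" for n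
  have s: "(\<lambda>n. a n * z ^ n) sums F z" if "cmod z < 1" for z
    using holomorphic_power_series[OF F, of z] that by (simp add: a_def)
  have b: "\<exists>C. \<forall>n. cmod (a n) * \<rho> ^ n \<le> C" if "0 < \<rho>" "\<rho> < 1" for \<rho>
  proof -
    have "summable (\<lambda>n. a n * of_real \<rho> ^ n)" using s[of "of_real \<rho>"] that by (simp add: sums_iff)
    then have "Bseq (\<lambda>n. a n * of_real \<rho> ^ n)"
      by (intro convergent_imp_Bseq) (auto simp: convergent_def dest: summable_LIMSEQ_zero)
    then obtain C where "\<And>n. cmod (a n * of_real \<rho> ^ n) \<le> C" unfolding Bseq_def by blast
    then show ?thesis using that by (auto simp: norm_mult norm_power)
  qed
  have n: "summable (\<lambda>n. cmod (a n * z ^ n))" if z: "cmod z < 1" for z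
  proof -
    define q where "q = complex_of_real ((1 + cmod z) / 2)"
    have "cmod q = (1 + cmod z) / 2" unfolding q_def norm_of_real by simp
    then have q: "cmod q < 1" "cmod z < cmod q" using z by simp_all
    have "summable (\<lambda>n. a n * q ^ n)" using s[OF q(1)] by (rule sums_summable)
    from powser_insidea[OF this q(2)] show ?thesis .
  qed
  show thesis
  proof (rule that[OF b])
    show "((\<lambda>n. a n * z ^ n) has_sum F z) UNIV" if "cmod z < 1" for z
      by (rule norm_summable_imp_has_sum[OF n[OF that] s[OF that]])
    show "(\<lambda>n. cmod (a n * z ^ n)) summable_on UNIV" if "cmod z < 1" for z
      using norm_summable_imp_summable_on[of "\<lambda>n. cmod (a n * z ^ n)"] n[OF that] by simp
  qed auto
qed

section \<open>Fourier coefficients of the kernel, exactly and from below\<close>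

lemma vimage_int_diff:
  "(\<lambda>p. int (fst p) - int (snd p)) -` {int k} = (\<lambda>l. (k + l, l)) ` UNIV"
  "(\<lambda>p. int (fst p) - int (snd p)) -` {- int m} = (\<lambda>j. (j, j + m)) ` UNIV"
proof -
  show "(\<lambda>p. int (fst p) - int (snd p)) -` {int k} = (\<lambda>l. (k + l, l)) ` UNIV"
    by (auto simp: image_iff)
  show "(\<lambda>p. int (fst p) - int (snd p)) -` {- int m} = (\<lambda>j. (j, j + m)) ` UNIV"
    by (auto simp: image_iff)
qed

text \<open>Along j = k + l the sum is r^k times the binomial series at r^2, which cancels the
  weight exactly.\<close>

lemma kernel_fourier_nonneg:
  assumes r: "0 \<le> r" "r < 1" shows "kernel_fourier \<alpha> r (int k) = r ^ k"
proof -
  have r2: "0 \<le> r\<^sup>2" "r\<^sup>2 < 1" using r by (auto simp: abs_square_less_1)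
  have "inj (\<lambda>l. (k + l, l))" by (auto simp: inj_on_def)
  then have "kernel_fourier \<alpha> r (int k) = (1 - r\<^sup>2) powr (\<alpha> + 1) * (\<Sum>\<^sub>\<infinity>l. kernel_coeff \<alpha> l * r ^ (k + l + l))"
    unfolding kernel_fourier_def vimage_int_diff by (subst infsum_reindex) (auto simp: o_def)
  also have "(\<Sum>\<^sub>\<infinity>l. kernel_coeff \<alpha> l * r ^ (k + l + l)) = (\<Sum>\<^sub>\<infinity>l. r ^ k * (kernel_coeff \<alpha> l * (r\<^sup>2) ^ l))"
    by (intro infsum_cong) (simp add: power_add power2_eq_square power_mult_distrib)
  also have "\<dots> = r ^ k * (1 - r\<^sup>2) powr (- (\<alpha> + 1))"
    unfolding infsum_cmult_right' using infsumI[OF kernel_coeff_has_sum_real[OF r2]] by simp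
  also have "(1 - r\<^sup>2) powr (\<alpha> + 1) * (r ^ k * (1 - r\<^sup>2) powr (- (\<alpha> + 1))) =
      r ^ k * ((1 - r\<^sup>2) powr (\<alpha> + 1) * (1 - r\<^sup>2) powr (- (\<alpha> + 1)))" by simp
  also have "(1 - r\<^sup>2) powr (\<alpha> + 1) * (1 - r\<^sup>2) powr (- (\<alpha> + 1)) = 1"
    unfolding powr_add[symmetric] using r2 by simp
  finally show ?thesis by simp
qed

text \<open>From some index on the coefficients all have the same sign, so that there is no
  cancellation.\<close>

lemma kernel_fourier_neg_ge:
  assumes r: "0 \<le> r" "r < 1" and m: "0 < \<alpha> + 1 + real m"
  shows "(1 - r\<^sup>2) powr (\<alpha> + 1) * (\<bar>kernel_coeff \<alpha> m\<bar> * r ^ m) \<le> \<bar>kernel_fourier \<alpha> r (- int m)\<bar>"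
proof -
  define S where "S = (\<Sum>\<^sub>\<infinity>j. \<bar>kernel_coeff \<alpha> (j + m)\<bar> * r ^ (j + (j + m)))"
  have sg: "sgn (kernel_coeff \<alpha> (j + m)) = sgn (kernel_coeff \<alpha> m)" for j
  proof (induction j)
    case (Suc j)
    have "0 < (\<alpha> + 1 + real (j + m)) / real (Suc (j + m))" using m by (intro divide_pos_pos) auto
    then have "sgn ((\<alpha> + 1 + real (j + m)) / real (Suc (j + m))) = 1" by (rule sgn_pos)
    then show ?case using Suc by (simp only: add_Suc kernel_coeff_Suc sgn_mult mult_1_left)
  qed simp
  have k: "kernel_coeff \<alpha> (j + m) = sgn (kernel_coeff \<alpha> m) * \<bar>kernel_coeff \<alpha> (j + m)\<bar>" for j
    using sg[of j] by (metis mult_sgn_abs)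
  have inj: "inj (\<lambda>j. (j, j + m))" by (auto simp: inj_on_def)
  have "kernel_fourier \<alpha> r (- int m) = (1 - r\<^sup>2) powr (\<alpha> + 1) * (\<Sum>\<^sub>\<infinity>j. kernel_coeff \<alpha> (j + m) * r ^ (j + (j + m)))"
    unfolding kernel_fourier_def vimage_int_diff by (subst infsum_reindex[OF inj]) (simp add: o_def)
  also have "(\<Sum>\<^sub>\<infinity>j. kernel_coeff \<alpha> (j + m) * r ^ (j + (j + m))) = sgn (kernel_coeff \<alpha> m) * S"
    unfolding S_def by (subst infsum_cmult_right'[symmetric]) (metis k mult.assoc)
  finally have eq: "\<bar>kernel_fourier \<alpha> r (- int m)\<bar> = (1 - r\<^sup>2) powr (\<alpha> + 1) * (\<bar>sgn (kernel_coeff \<alpha> m)\<bar> * \<bar>S\<bar>)"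
    by (simp add: abs_mult)
  have "(\<lambda>j. \<bar>kernel_coeff \<alpha> (j + m)\<bar> * r ^ (j + m)) summable_on UNIV"
    using summable_on_reindex[of "\<lambda>j. j + m" UNIV "\<lambda>l. \<bar>kernel_coeff \<alpha> l\<bar> * r ^ l"]
      summable_on_subset_banach[OF summable_norm_kernel_coeff[OF r, of \<alpha>], of "range (\<lambda>j. j + m)"]
    by (simp add: o_def)
  then have sm: "(\<lambda>j. \<bar>kernel_coeff \<alpha> (j + m)\<bar> * r ^ (j + (j + m))) summable_on UNIV"
    by (rule summable_on_comparison_test) (use r in \<open>auto intro!: mult_left_mono power_decreasing\<close>)
  \<comment> \<open>All terms are nonnegative, so the one with j = 0 already bounds the sum from
    below.\<close>
  have "(\<Sum>j\<in>{0}. \<bar>kernel_coeff \<alpha> (j + m)\<bar> * r ^ (j + (j + m))) \<le> S"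
    unfolding S_def using r by (intro finite_sum_le_infsum sm) auto
  then have S: "\<bar>kernel_coeff \<alpha> m\<bar> * r ^ m \<le> S" by simp
  have "\<bar>kernel_coeff \<alpha> m\<bar> * r ^ m \<le> \<bar>sgn (kernel_coeff \<alpha> m)\<bar> * \<bar>S\<bar>"
  proof (cases "kernel_coeff \<alpha> m = 0")
    case False
    then show ?thesis using S by (simp add: abs_sgn_eq)
  qed simp
  then show ?thesis unfolding eq by (intro mult_left_mono) auto
qed

text \<open>With no negative frequencies only j \<ge> l contributes. Writing j = n + l separates the
  sum into the Taylor series in z and the binomial series in |z|^2, and the latter cancels the
  weight: a holomorphic function is its own Poisson series.\<close>

lemma double_series_poisson_coeff_holomorphic:
  assumes a: "((\<lambda>n. a n * z ^ n) has_sum F) UNIV" "(\<lambda>n. cmod (a n * z ^ n)) summable_on UNIV"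
    and c: "\<And>k. c k = (if k \<ge> 0 then a (nat k) else 0)" and z: "cmod z < 1"
  shows "of_real ((1 - (cmod z)\<^sup>2) powr (\<alpha> + 1)) * double_series (poisson_coeff \<alpha> c) z = F"
proof -
  define s where "s = (cmod z)\<^sup>2"
  have s: "0 \<le> s" "s < 1" using z by (auto simp: s_def abs_square_less_1)
  have sz: "complex_of_real s = z * cnj z" by (simp add: s_def complex_norm_square[symmetric])
  let ?h = "\<lambda>p. (fst p + snd p, snd p) :: nat \<times> nat"
  have inj: "inj ?h" by (auto simp: inj_on_def prod_eq_iff)
  have "double_series (poisson_coeff \<alpha> c) z = (\<Sum>\<^sub>\<infinity>p\<in>range ?h. poisson_coeff \<alpha> c p * z ^ fst p * cnj z ^ snd p)"
    unfolding double_series_def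
  proof (rule infsum_cong_neutral)
    fix p :: "nat \<times> nat" assume p: "p \<in> UNIV - range ?h"
    have "fst p < snd p"
    proof (rule ccontr)
      assume "\<not> fst p < snd p"
      then have "p = ?h (fst p - snd p, snd p)" by (simp add: prod_eq_iff)
      then show False using p by blast
    qed
    then show "poisson_coeff \<alpha> c p * z ^ fst p * cnj z ^ snd p = 0" by (simp add: poisson_coeff_def c)
  qed auto
  also have "\<dots> = (\<Sum>\<^sub>\<infinity>p. (a (fst p) * z ^ fst p) * of_real (kernel_coeff \<alpha> (snd p) * s ^ snd p))"
    unfolding infsum_reindex[OF inj] o_def
    by (intro infsum_cong) (simp add: poisson_coeff_def c sz power_add power_mult_distrib mult_ac)
  also have "\<dots> = infsum (\<lambda>n. a n * z ^ n) UNIV * infsum (\<lambda>l. complex_of_real (kernel_coeff \<alpha> l * s ^ l)) UNIV"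
  proof (rule infsumI[OF has_sum_product[OF a(2)]])
    show "(\<lambda>l. norm (complex_of_real (kernel_coeff \<alpha> l * s ^ l))) summable_on UNIV"
      using summable_norm_kernel_coeff[OF s, of \<alpha>] s by (simp add: abs_mult norm_mult norm_power)
  qed
  also have "\<dots> = F * of_real ((1 - s) powr (- (\<alpha> + 1)))"
    unfolding infsum_of_real_complex infsumI[OF a(1)] infsumI[OF kernel_coeff_has_sum_real[OF s]] ..
  finally have "of_real ((1 - s) powr (\<alpha> + 1)) * double_series (poisson_coeff \<alpha> c) z =
      F * of_real ((1 - s) powr (\<alpha> + 1) * (1 - s) powr (- (\<alpha> + 1)))" by simp
  also have "(1 - s) powr (\<alpha> + 1) * (1 - s) powr (- (\<alpha> + 1)) = 1"
    unfolding powr_add[symmetric] using s by simp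
  finally show ?thesis by (simp add: s_def)
qed

section \<open>Coefficients of an \<alpha>-harmonic function\<close>

lemma poisson_coeff_add: "poisson_coeff \<alpha> (\<lambda>k. c k + d k) = (\<lambda>p. poisson_coeff \<alpha> c p + poisson_coeff \<alpha> d p)"
  by (simp add: poisson_coeff_def fun_eq_iff distrib_left)

lemma subexp_int_add: "subexp_int c \<Longrightarrow> subexp_int d \<Longrightarrow> subexp_int (\<lambda>k. c k + d k)"
  unfolding subexp_int_def
proof (intro allI impI)
  fix \<rho> :: real
  assume c: "\<forall>\<rho>. 0 < \<rho> \<and> \<rho> < 1 \<longrightarrow> (\<exists>C. \<forall>k. cmod (c k) * \<rho> ^ nat \<bar>k\<bar> \<le> C)"
    and d: "\<forall>\<rho>. 0 < \<rho> \<and> \<rho> < 1 \<longrightarrow> (\<exists>C. \<forall>k. cmod (d k) * \<rho> ^ nat \<bar>k\<bar> \<le> C)" and \<rho>: "0 < \<rho> \<and> \<rho> < 1"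
  obtain C where C: "\<And>k. cmod (c k) * \<rho> ^ nat \<bar>k\<bar> \<le> C" using c \<rho> by blast
  obtain D where D: "\<And>k. cmod (d k) * \<rho> ^ nat \<bar>k\<bar> \<le> D" using d \<rho> by blast
  have "cmod (c k + d k) * \<rho> ^ nat \<bar>k\<bar> \<le> C + D" for k
  proof -
    have "cmod (c k + d k) * \<rho> ^ nat \<bar>k\<bar> \<le> (cmod (c k) + cmod (d k)) * \<rho> ^ nat \<bar>k\<bar>"
      using \<rho> by (intro mult_right_mono norm_triangle_ineq) auto
    then show ?thesis using C[of k] D[of k] by (simp add: distrib_right)
  qed
  then show "\<exists>C. \<forall>k. cmod (c k + d k) * \<rho> ^ nat \<bar>k\<bar> \<le> C" by blast
qed

lemma alpha_harmonic_imp_disc_form: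
  assumes a: "\<not> (\<alpha> \<in> \<int> \<and> \<alpha> < 0)" and u: "alpha_harmonic \<alpha> u"
  obtains c where "subexp_int c" "disc_form (\<alpha> + 1) (poisson_coeff \<alpha> c) u"
proof -
  have C1: "C1_on (ball 0 1) u" "C1_on (ball 0 1) (partial_x u)" "C1_on (ball 0 1) (partial_y u)"
    using u by (auto simp: alpha_harmonic_def C2_on_def)
  define g where "g w = of_real ((1 - (cmod w)\<^sup>2) powr (- \<alpha>)) * dbar_z u w" for w
  have gw: "has_wirtinger g 0 (dbar_z g z) z" if z: "z \<in> ball 0 1" for z
  proof -
    have "partial_x u differentiable (at z)" "partial_y u differentiable (at z)"
      using C1_on_imp_differentiable[OF C1(2) open_ball z] C1_on_imp_differentiable[OF C1(3) open_ball z] .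
    then have "(\<lambda>z. (partial_x u z + \<i> * partial_y u z) * (1 / 2)) differentiable (at z)"
      by (intro differentiable_mult differentiable_add differentiable_const)
    then have "dbar_z u differentiable (at z)" by (simp add: dbar_z_def[abs_def])
    from has_wirtinger_mult[OF has_wirtinger_one_minus_norm_powr differentiable_imp_has_wirtinger[OF this], of "- \<alpha>"] z
    have "g differentiable (at z)" unfolding g_def[abs_def] has_wirtinger_def differentiable_def by auto
    from differentiable_imp_has_wirtinger[OF this] show ?thesis
      using u z by (simp add: alpha_harmonic_def g_def[abs_def])
  qed
  have "(\<lambda>w. g (cnj w)) holomorphic_on (cnj -` ball 0 1)"
    by (rule d_zero_imp_holomorphic[OF open_ball]) (use gw in blast)
  moreover have "cnj -` ball 0 1 = ball 0 1" by auto
  ultimately have hol: "(\<lambda>w. g (cnj w)) holomorphic_on ball 0 1" by simp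
  obtain b where b: "\<And>\<rho>. 0 < \<rho> \<Longrightarrow> \<rho> < 1 \<Longrightarrow> \<exists>C. \<forall>n. cmod (b n) * \<rho> ^ n \<le> C"
    "\<And>z. cmod z < 1 \<Longrightarrow> ((\<lambda>n. b n * z ^ n) has_sum g (cnj z)) UNIV"
    by (rule holomorphic_taylor_coeffs[OF hol]) (rule that)
  \<comment> \<open>Solves (l + 1) \<beta>_(l+1) c_(-l-1) = b_l for k = -(l + 1), so that the dbar
    derivative of the Poisson series of \<open>c1\<close> is the prescribed one; hence the index
    \<open>nat (- k) - 1\<close>.\<close>
  define c1 where "c1 k = (if k < 0 then b (nat (- k) - 1) / (of_nat (nat (- k)) * of_real (kernel_coeff \<alpha> (nat (- k)))) else 0)"
    for k :: int
  have c1: "subexp_int c1"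
    unfolding subexp_int_def
  proof (intro allI impI)
    fix \<rho> :: real assume \<rho>: "0 < \<rho> \<and> \<rho> < 1"
    obtain D K where D: "D \<ge> 0" "\<And>l. 1 / \<bar>kernel_coeff \<alpha> l\<bar> \<le> D * (1 + real l) ^ K"
      using inverse_kernel_coeff_poly_bounded[OF a] by blast
    \<comment> \<open>The bound on b is taken at the larger radius \<sigma>; the ratio q = \<rho> /
      \<sigma> absorbs the polynomial growth of the inverse kernel coefficients.\<close>
    define \<sigma> where "\<sigma> = (1 + \<rho>) / 2"
    have \<sigma>: "0 < \<sigma>" "\<sigma> < 1" "\<rho> < \<sigma>" using \<rho> by (auto simp: \<sigma>_def)
    define q where "q = \<rho> / \<sigma>"
    have q: "0 \<le> q" "q < 1" using \<rho> \<sigma> by (auto simp: q_def)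
    obtain C where C: "\<And>n. cmod (b n) * \<sigma> ^ n \<le> C" using b(1)[OF \<sigma>(1,2)] by blast
    have C0: "0 \<le> C" using order_trans[OF _ C[of 0]] by simp
    have "cmod (c1 k) * \<rho> ^ nat \<bar>k\<bar> \<le> C * (D * (fact K * exp 1 / (1 - q) ^ K))" for k
    proof (cases "k < 0")
      case True
      then obtain n where k: "k = - int (Suc n)" by (metis neg_int_cases gr0_implies_Suc)
      have nk: "nat (- k) = Suc n" "nat \<bar>k\<bar> = Suc n" by (simp_all add: k)
      have "cmod (c1 k) * \<rho> ^ nat \<bar>k\<bar> = cmod (b n) * (1 / \<bar>kernel_coeff \<alpha> (Suc n)\<bar>) * (1 / real (Suc n)) * \<rho> ^ Suc n"
        unfolding c1_def nk using True by (simp add: norm_divide norm_mult del: of_nat_Suc power_Suc)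
      also have "\<dots> \<le> cmod (b n) * (D * (1 + real (Suc n)) ^ K) * 1 * \<rho> ^ Suc n"
        using \<rho> D(1) by (intro mult_mono mult_left_mono mult_nonneg_nonneg D(2) zero_le_power) auto
      also have "\<dots> = (cmod (b n) * \<sigma> ^ Suc n) * (D * ((1 + real (Suc n)) ^ K * q ^ Suc n))"
        using \<sigma> by (simp add: q_def power_divide del: power_Suc)
      also have "cmod (b n) * \<sigma> ^ Suc n \<le> cmod (b n) * \<sigma> ^ n"
        using \<sigma> by (intro mult_left_mono power_decreasing) auto
      also have "\<dots> \<le> C" by (rule C)
      also have "C * (D * ((1 + real (Suc n)) ^ K * q ^ Suc n)) \<le> C * (D * (fact K * exp 1 / (1 - q) ^ K))"
        using q by (intro mult_left_mono poly_geom_bound D(1) C0) auto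
      finally show ?thesis using q D(1) by (simp add: mult_right_mono)
    next
      case False
      then show ?thesis using C0 D(1) q by (simp add: c1_def)
    qed
    then show "\<exists>C. \<forall>k. cmod (c1 k) * \<rho> ^ nat \<bar>k\<bar> \<le> C" by blast
  qed
  define H where "H z = of_real ((1 - (cmod z)\<^sup>2) powr (\<alpha> + 1)) * double_series (poisson_coeff \<alpha> c1) z" for z
  have H: "disc_form (\<alpha> + 1) (poisson_coeff \<alpha> c1) H"
    using subexp_poisson_coeff[OF c1] by (simp add: disc_form_def H_def)
  have dH: "dbar_z H z = dbar_z u z" if z: "cmod z < 1" for z
  proof -
    let ?v = "\<lambda>p::nat \<times> nat. if fst p = 0 then of_nat (Suc (snd p)) * of_real (kernel_coeff \<alpha> (Suc (snd p))) * c1 (- int (Suc (snd p))) else 0"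
    have cz: "cmod (cnj z) < 1" using z by simp
    have inj: "inj (\<lambda>n. (0::nat, n::nat))" by (auto simp: inj_on_def)
    have "double_series ?v z = (\<Sum>\<^sub>\<infinity>p\<in>range (\<lambda>n. (0, n)). ?v p * z ^ fst p * cnj z ^ snd p)"
      unfolding double_series_def by (rule infsum_cong_neutral) (auto simp: image_iff prod_eq_iff)
    also have "\<dots> = (\<Sum>\<^sub>\<infinity>n. b n * cnj z ^ n)"
      unfolding infsum_reindex[OF inj] o_def
    proof (rule infsum_cong)
      fix n
      have "nat (- (- int (Suc n))) = Suc n" "- int (Suc n) < 0" by simp_all
      then have "c1 (- int (Suc n)) = b n / (of_nat (Suc n) * of_real (kernel_coeff \<alpha> (Suc n)))"
        unfolding c1_def by (simp only: if_True diff_Suc_1)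
      then show "?v (0, n) * z ^ fst (0, n) * cnj z ^ snd (0, n) = b n * cnj z ^ n"
        using kernel_coeff_nonzero[OF a, of "Suc n"] by (simp del: of_nat_Suc)
    qed
    also have "\<dots> = g z" using infsumI[OF b(2)[OF cz]] by simp
    finally have v: "double_series ?v z = g z" .
    have "1 - (cmod z)\<^sup>2 > 0" using z by (simp add: abs_square_less_1)
    then have "(1 - (cmod z)\<^sup>2) powr \<alpha> * (1 - (cmod z)\<^sup>2) powr (- \<alpha>) = 1" by (simp add: powr_add[symmetric])
    then have "of_real ((1 - (cmod z)\<^sup>2) powr \<alpha>) * g z = dbar_z u z"
      unfolding g_def by (simp only: mult.assoc[symmetric] of_real_mult[symmetric] of_real_1 mult_1_left)
    then show ?thesis using poisson_series_dbar[OF c1 H z] by (simp only: v)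
  qed
  have hol': "(\<lambda>z. u z - H z) holomorphic_on ball 0 1"
  proof (rule dbar_zero_imp_holomorphic[OF open_ball])
    fix z :: complex assume z: "z \<in> ball 0 1"
    then have z': "cmod z < 1" by simp
    note Hw = disc_form_has_wirtinger[OF H z']
    from has_wirtinger_diff[OF differentiable_imp_has_wirtinger[OF C1_on_imp_differentiable[OF C1(1) open_ball z]] Hw]
    show "\<exists>p. has_wirtinger (\<lambda>z. u z - H z) p 0 z"
      using has_wirtinger_imp(4)[OF Hw] dH[OF z'] by auto
  qed
  obtain a where a: "\<And>\<rho>. 0 < \<rho> \<Longrightarrow> \<rho> < 1 \<Longrightarrow> \<exists>C. \<forall>n. cmod (a n) * \<rho> ^ n \<le> C"
    "\<And>z. cmod z < 1 \<Longrightarrow> ((\<lambda>n. a n * z ^ n) has_sum (u z - H z)) UNIV"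
    "\<And>z. cmod z < 1 \<Longrightarrow> (\<lambda>n. cmod (a n * z ^ n)) summable_on UNIV"
    by (rule holomorphic_taylor_coeffs[OF hol']) (rule that)
  define c2 where "c2 k = (if k \<ge> 0 then a (nat k) else 0)" for k :: int
  have c2: "subexp_int c2"
    unfolding subexp_int_def
  proof (intro allI impI)
    fix \<rho> :: real assume \<rho>: "0 < \<rho> \<and> \<rho> < 1"
    then obtain C where C: "\<And>n. cmod (a n) * \<rho> ^ n \<le> C" using a(1) by blast
    have "0 \<le> C" using order_trans[OF _ C[of 0]] by simp
    then have "cmod (c2 k) * \<rho> ^ nat \<bar>k\<bar> \<le> C" for k using C[of "nat k"] by (simp add: c2_def)
    then show "\<exists>C. \<forall>k. cmod (c2 k) * \<rho> ^ nat \<bar>k\<bar> \<le> C" by blast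
  qed
  show thesis
  proof (rule that)
    show c: "subexp_int (\<lambda>k. c1 k + c2 k)" by (rule subexp_int_add[OF c1 c2])
    show "disc_form (\<alpha> + 1) (poisson_coeff \<alpha> (\<lambda>k. c1 k + c2 k)) u"
      unfolding disc_form_def
    proof (intro conjI ballI subexp_poisson_coeff[OF c])
      fix z :: complex assume "z \<in> ball 0 1"
      then have z: "cmod z < 1" by simp
      have "of_real ((1 - (cmod z)\<^sup>2) powr (\<alpha> + 1)) * double_series (poisson_coeff \<alpha> c2) z = u z - H z"
        by (rule double_series_poisson_coeff_holomorphic[OF a(2,3) c2_def z]) (rule z)+
      then show "u z = of_real ((1 - (cmod z)\<^sup>2) powr (\<alpha> + 1)) * double_series (poisson_coeff \<alpha> (\<lambda>k. c1 k + c2 k)) z"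
        unfolding poisson_coeff_add double_series_add[OF subexp_poisson_coeff[OF c1] subexp_poisson_coeff[OF c2] z]
        by (simp add: distrib_left H_def)
    qed
  qed
qed

section \<open>Temperate growth forces polynomially bounded coefficients\<close>

lemma fourier_coeff_distr_of_fun_bound:
  assumes g: "continuous_on {0..2 * pi} (\<lambda>\<theta>. g (cis \<theta>))" and B: "\<And>\<theta>. cmod (g (cis \<theta>)) \<le> B"
  shows "cmod (fourier_coeff (distr_of_fun g) k) \<le> B"
proof -
  have p: "0 \<le> 2 * pi" "0 < 2 * pi" using pi_gt_zero by linarith+
  have "cmod (integral {0..2 * pi} (\<lambda>\<theta>. g (cis \<theta>) * cis \<theta> powi (- k))) \<le> B * (2 * pi - 0)"
  proof (rule integral_bound[OF p(1)])
    show "continuous_on {0..2 * pi} (\<lambda>\<theta>. g (cis \<theta>) * cis \<theta> powi (- k))"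
      unfolding cis_power_int using g by (intro continuous_intros)
    show "cmod (g (cis t) * cis t powi (- k)) \<le> B" for t using B[of t] by (simp add: norm_mult norm_power_int)
  qed
  then show ?thesis
    unfolding fourier_coeff_def distr_of_fun_eq[OF g circle_smooth_monomial(1)] norm_divide norm_of_real
    using p by (simp add: pos_divide_le_eq del: pi_gt_zero)
qed

lemma temperate_imp_poly_bounded:
  assumes a: "\<not> (\<alpha> \<in> \<int> \<and> \<alpha> < 0)" and c: "subexp_int c"
    and u: "disc_form (\<alpha> + 1) (poisson_coeff \<alpha> c) u" and t: "temperate_growth u"
  shows "\<exists>C N. \<forall>k. cmod (c k) \<le> C * (1 + \<bar>real_of_int k\<bar>) ^ N"
proof -
  obtain B N where B: "B > 0" "\<And>z. z \<in> ball 0 1 \<Longrightarrow> cmod (u z) \<le> B * (1 - (cmod z)\<^sup>2) powr (- N)"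
    using t unfolding temperate_growth_def by blast
  \<comment> \<open>A Fourier coefficient of u on the circle of radius r is at most the supremum of
    |u| there; this is the only use of temperate growth.\<close>
  have coef: "\<bar>kernel_fourier \<alpha> r k\<bar> * cmod (c k) \<le> B * (1 - r\<^sup>2) powr (- N)" if r: "0 \<le> r" "r < 1" for r k
  proof -
    define g where "g \<zeta> = u (of_real r * \<zeta>)" for \<zeta>
    have b: "of_real r * cis \<theta> \<in> ball 0 1" for \<theta> using r by (simp add: norm_mult)
    have g: "g (cis \<theta>) = of_real ((1 - r\<^sup>2) powr (\<alpha> + 1)) * double_series (poisson_coeff \<alpha> c) (of_real r * cis \<theta>)" for \<theta>
      using u b[of \<theta>] r by (simp add: g_def disc_form_def norm_mult)
    note F = poisson_series_fourier[OF c r g]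
    have "cmod (fourier_coeff (distr_of_fun g) k) \<le> B * (1 - r\<^sup>2) powr (- N)"
    proof (rule fourier_coeff_distr_of_fun_bound)
      show "continuous_on {0..2 * pi} (\<lambda>\<theta>. g (cis \<theta>))"
        using circle_deriv_continuous[OF F(1), of _ 0] by (simp add: circle_deriv_0)
      show "cmod (g (cis \<theta>)) \<le> B * (1 - r\<^sup>2) powr (- N)" for \<theta>
        using B(2)[OF b[of \<theta>]] r by (simp add: g_def norm_mult)
    qed
    then show ?thesis by (simp add: F(3) norm_mult)
  qed
  define R where "R n = real n / (1 + real n)" for n
  have R: "0 \<le> R n" "R n < 1" for n by (auto simp: R_def)
  \<comment> \<open>The inverse of R_n^n is (1 + 1 / n)^n, which is at most e; for n = 0 both powers
    are trivial.\<close>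
  have Rn: "exp (- 1) \<le> R n ^ n" for n
  proof (cases "n = 0")
    case False
    have "1 + 1 / real n \<le> exp (1 / real n)" by (rule exp_ge_add_one_self)
    then have "(1 + 1 / real n) ^ n \<le> exp (1 / real n) ^ n" by (intro power_mono) auto
    also have "\<dots> = exp 1" using False by (simp add: exp_of_nat_mult[symmetric])
    finally have "inverse (exp 1) \<le> inverse ((1 + 1 / real n) ^ n)"
      by (intro le_imp_inverse_le) (auto intro!: zero_less_power add_pos_nonneg)
    moreover have "inverse ((1 + 1 / real n) ^ n) = R n ^ n"
      using False by (simp add: R_def power_inverse[symmetric] field_simps)
    ultimately show ?thesis by (simp add: exp_minus)
  qed simp
  \<comment> \<open>The base lies between 1 / (1 + n) and 1, so the bound by |x| covers exponents of
    either sign.\<close>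
  have Rp: "(1 - (R n)\<^sup>2) powr (- x) \<le> (1 + real n) ^ K" if K: "\<bar>x\<bar> \<le> real K" for n x K
  proof -
    have "(R n)\<^sup>2 \<le> R n" using R[of n] by (simp add: power2_eq_square mult_left_le_one_le)
    moreover have "1 - R n = 1 / (1 + real n)" by (simp add: R_def field_simps)
    ultimately have 1: "1 / (1 + real n) \<le> 1 - (R n)\<^sup>2" by linarith
    have 0: "0 < 1 / (1 + real n)" by simp
    have "(1 - (R n)\<^sup>2) powr (- x) \<le> (1 - (R n)\<^sup>2) powr (- real K)"
    proof (rule powr_mono')
      show "0 \<le> 1 - (R n)\<^sup>2" using 0 1 by linarith
    qed (use K in auto)
    also have "\<dots> \<le> (1 / (1 + real n)) powr (- real K)"
      using 0 1 by (intro powr_mono2') simp_all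
    also have "\<dots> = (1 + real n) ^ K"
      by (simp add: powr_minus powr_realpow[symmetric] powr_divide)
    finally show ?thesis .
  qed
  obtain K1 :: nat where K1: "\<bar>N\<bar> \<le> real K1" using real_arch_simple by blast
  obtain K2 :: nat where K2: "\<bar>N + (\<alpha> + 1)\<bar> \<le> real K2" using real_arch_simple by blast
  obtain D K3 where D: "D \<ge> 0" "\<And>l. 1 / \<bar>kernel_coeff \<alpha> l\<bar> \<le> D * (1 + real l) ^ K3"
    using inverse_kernel_coeff_poly_bounded[OF a] by blast
  \<comment> \<open>Beyond m0 the number \<alpha> + 1 + m is positive and the lower bound for
    negative frequencies applies; the finitely many remaining coefficients are absorbed in
    \<open>Q\<close>.\<close>
  obtain m0 :: nat where m0: "\<bar>\<alpha>\<bar> \<le> real m0" using real_arch_simple by blast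
  define E where "E = exp 1 * B"
  have E: "E > 0" using B(1) by (simp add: E_def)
  define Q where "Q = (\<Sum>m\<le>m0. cmod (c (- int m)))"
  have Q: "Q \<ge> 0" unfolding Q_def by (intro sum_nonneg) auto
  have pos: "cmod (c (int n)) \<le> E * (1 + real n) ^ K1" for n
  proof -
    have "exp (- 1) * cmod (c (int n)) \<le> R n ^ n * cmod (c (int n))" by (intro mult_right_mono Rn) auto
    also have "\<dots> \<le> B * (1 - (R n)\<^sup>2) powr (- N)"
      using coef[OF R[of n], of "int n"] kernel_fourier_nonneg[OF R[of n], of \<alpha> n] R[of n] by simp
    also have "\<dots> \<le> B * (1 + real n) ^ K1" using B(1) by (intro mult_left_mono Rp K1) auto
    finally show ?thesis by (simp add: E_def exp_minus field_simps)
  qed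
  have neg: "cmod (c (- int m)) \<le> E * D * (1 + real m) ^ (K2 + K3)" if m: "m > m0" for m
  proof -
    define s where "s = 1 - (R m)\<^sup>2"
    have s: "s > 0" using R[of m] by (simp add: s_def abs_square_less_1)
    define \<beta> where "\<beta> = \<bar>kernel_coeff \<alpha> m\<bar>"
    have \<beta>: "\<beta> > 0" using kernel_coeff_nonzero[OF a] by (simp add: \<beta>_def)
    have m': "0 < \<alpha> + 1 + real m" using m m0 by linarith
    have "(s powr (\<alpha> + 1) * (\<beta> * exp (- 1))) * cmod (c (- int m)) \<le> (s powr (\<alpha> + 1) * (\<beta> * R m ^ m)) * cmod (c (- int m))"
      using \<beta> by (intro mult_right_mono mult_left_mono Rn) auto
    also have "\<dots> \<le> \<bar>kernel_fourier \<alpha> (R m) (- int m)\<bar> * cmod (c (- int m))"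
      using kernel_fourier_neg_ge[OF R[of m] m'] unfolding s_def \<beta>_def by (intro mult_right_mono) auto
    also have "\<dots> \<le> B * s powr (- N)" using coef[OF R[of m]] by (simp add: s_def)
    finally have 1: "(s powr (\<alpha> + 1) * (\<beta> * exp (- 1))) * cmod (c (- int m)) \<le> B * s powr (- N)" .
    \<comment> \<open>Three factors equal to 1, inserted to solve the preceding estimate for
      |c_(-m)|.\<close>
    have i: "exp 1 * exp (- 1) = (1::real)" "1 / \<beta> * \<beta> = 1" "s powr (- (\<alpha> + 1)) * s powr (\<alpha> + 1) = 1"
      using s \<beta> unfolding powr_add[symmetric] exp_add[symmetric] by simp_all
    have "cmod (c (- int m)) = (exp 1 * exp (- 1)) * (1 / \<beta> * \<beta>) * (s powr (- (\<alpha> + 1)) * s powr (\<alpha> + 1)) * cmod (c (- int m))"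
      unfolding i by simp
    also have "\<dots> = (exp 1 * (1 / \<beta>) * s powr (- (\<alpha> + 1))) *
        ((s powr (\<alpha> + 1) * (\<beta> * exp (- 1))) * cmod (c (- int m)))"
      by (simp only: mult_ac)
    also have "\<dots> \<le> (exp 1 * (1 / \<beta>) * s powr (- (\<alpha> + 1))) * (B * s powr (- N))"
      using \<beta> by (intro mult_left_mono 1) auto
    also have "\<dots> = E * (1 / \<beta>) * (s powr (- (\<alpha> + 1)) * s powr (- N))" by (simp add: E_def)
    also have "s powr (- (\<alpha> + 1)) * s powr (- N) = s powr (- (N + (\<alpha> + 1)))"
      by (simp add: powr_add[symmetric])
    also have "E * (1 / \<beta>) * s powr (- (N + (\<alpha> + 1))) \<le> E * (D * (1 + real m) ^ K3) * (1 + real m) ^ K2"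
      unfolding s_def \<beta>_def using E D(1)
      by (intro mult_mono mult_left_mono Rp K2 D(2) mult_nonneg_nonneg) auto
    finally show ?thesis by (simp add: power_add mult_ac)
  qed
  have "cmod (c k) \<le> (E + E * D + Q) * (1 + \<bar>real_of_int k\<bar>) ^ (K1 + K2 + K3)" for k
  proof -
    define x where "x = 1 + \<bar>real_of_int k\<bar>"
    have x: "1 \<le> x" by (simp add: x_def)
    have ED: "0 \<le> E * D" using E D(1) by simp
    have le: "F * x ^ i \<le> (E + E * D + Q) * x ^ (K1 + K2 + K3)" if "0 \<le> F" "F \<le> E + E * D + Q" "i \<le> K1 + K2 + K3" for F i
      using that x E ED Q by (intro mult_mono power_increasing) auto
    consider n where "k = int n" | m where "k = - int m" "m > m0" | m where "k = - int m" "m \<le> m0"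
      by (metis int_cases2 not_le)
    then have "cmod (c k) \<le> (E + E * D + Q) * x ^ (K1 + K2 + K3)"
    proof cases
      case (1 n)
      then have "cmod (c k) \<le> E * x ^ K1" using pos[of n] by (simp add: x_def)
      also have "\<dots> \<le> (E + E * D + Q) * x ^ (K1 + K2 + K3)" using E ED Q by (intro le) auto
      finally show ?thesis .
    next
      case (2 m)
      then have "cmod (c k) \<le> (E * D) * x ^ (K2 + K3)" using neg[of m] by (simp add: x_def)
      also have "\<dots> \<le> (E + E * D + Q) * x ^ (K1 + K2 + K3)" using E ED Q by (intro le) auto
      finally show ?thesis .
    next
      case (3 m)
      then have "cmod (c k) \<le> Q * x ^ 0" unfolding Q_def using member_le_sum[of m "{..m0}" "\<lambda>m. cmod (c (- int m))"] by simp
      also have "\<dots> \<le> (E + E * D + Q) * x ^ (K1 + K2 + K3)" using E ED Q by (intro le) auto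
      finally show ?thesis .
    qed
    then show ?thesis by (simp add: x_def)
  qed
  then show ?thesis by blast
qed

theorem corollary3p4:
  fixes \<alpha> :: real and u :: "complex \<Rightarrow> complex"
  assumes "\<not> (\<alpha> \<in> \<int> \<and> \<alpha> < 0)"
  shows "(\<exists>f\<in>circle_distributions. \<forall>z\<in>ball 0 1. u z = poisson_integral \<alpha> f z)
     \<longleftrightarrow> alpha_harmonic \<alpha> u \<and> temperate_growth u"
proof
  assume "\<exists>f\<in>circle_distributions. \<forall>z\<in>ball 0 1. u z = poisson_integral \<alpha> f z"
  then show "alpha_harmonic \<alpha> u \<and> temperate_growth u" using poisson_integral_imp by blast
next
  assume u: "alpha_harmonic \<alpha> u \<and> temperate_growth u"
  obtain c where c: "subexp_int c" "disc_form (\<alpha> + 1) (poisson_coeff \<alpha> c) u"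
    using alpha_harmonic_imp_disc_form[OF assms] u by blast
  obtain C N where "\<And>k. cmod (c k) \<le> C * (1 + \<bar>real_of_int k\<bar>) ^ N"
    using temperate_imp_poly_bounded[OF assms c] u by blast
  from distribution_with_fourier_coeffs[OF this]
  obtain f where f: "f \<in> circle_distributions" "\<And>k. fourier_coeff f k = c k" by blast
  then have "fourier_coeff f = c" by (simp add: fun_eq_iff)
  then have "u z = poisson_integral \<alpha> f z" if "z \<in> ball 0 1" for z
    using poisson_integral_eq[OF f(1), of z \<alpha>] c(2) that by (simp add: disc_form_def)
  then show "\<exists>f\<in>circle_distributions. \<forall>z\<in>ball 0 1. u z = poisson_integral \<alpha> f z" using f(1) by blast
qed

end
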